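(* Let $X$ be a four-dimensional space-time, $G=SL(2,\mathbb R)\times U(1)$ and $M=X\times G$. Let $\kappa_0$ be Newton's constant, let $\delta$ and $\delta_0=\tfrac23\delta$ be length parameters (the radii of the $U(1)$ subgroups of $SL(2,\mathbb R)$ and of the $U(1)$ factor of $G$, respectively), and define $$\kappa=\frac{16\pi}{3}\kappa_0,\qquad g=\frac{(\kappa\delta)^{1/3}}{\delta},\qquad g_0=\frac{(\kappa\delta)^{1/3}}{\delta_0}.$$ Let $\beta^K$ ($K=0,1,2,3$) be a global nonsingular tetrad of smooth one-forms on $X$. On $M$ let $\rho$ be a complex scalar field of the form $\rho=e^{iy/\delta_0}\tilde\rho(x)$, with $\tilde\rho$ a complex function of $x\in X$, and let $\mu=e^{iy/\delta_0}\tilde\mu$ with $\tilde\mu$ a constant. With the remaining objects as defined in the context, put $$L=\frac{1}{16\pi\kappa_0}R_v+\frac1{g_0}\,\overline{v_K(\rho+\mu)}\;v^K(\rho+\mu),$$ $$L_g=\frac1{4g}F^K_{\alpha\beta}F_K^{\alpha\beta}+\frac1{g_0}\,\overline{D_\alpha(\rho+\mu)}\;D^\alpha(\rho+\mu).$$ Then: (1) The total Lagrangian $L$ equals the Hilbert-Einstein Lagrangian for the gravitational field plus the Dirac-Yang-Mills Lagrangian for the fermion field: $L=\dfrac{1}{16\pi\kappa_0}R_X+L_g$. (2) Similarly for the total action $S=\int L\,d\beta\wedge d\alpha$: $$S=\int\Big(\frac{1}{16\pi\kappa_0}R_X+L_g\Big)\,d\beta\wedge d\alpha .$$ (3) The limit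 $g\to\infty$ (equivalently $g_0=\tfrac32 g\to\infty$), which is required to obtain Dirac's bispinor equation from $L_g$, forces the length parameters $\delta$ and $\delta_0$ to become vanishingly small compared with the Planck length $\lambda_P=\kappa_0^{1/2}$, i.e. $\delta/\lambda_P\to0$ and $\delta_0/\lambda_P\to0$.
   Context: Indices. $J,K,L,M$ and space-time indices $\alpha,\beta,\gamma,\delta$ run over $0,1,2,3$, and repeated indices are summed. Gauge indices are lowered and raised with $(g_{JK})=(g^{JK})=\mathrm{diag}(1,-1,-1,-1)$. As an index, $\delta$ is a space-time index; otherwise $\delta$ is the length parameter. The group $G$. Fix a tetrad of right-invariant vector fields $a_K$ on $G$ forming a basis of its Lie algebra, with dual right-invariant one-forms $\alpha^K$, such that $$[a_0,a_1]=-\delta^{-1}a_2,\qquad [a_0,a_2]=\delta^{-1}a_1,\qquad [a_1,a_2]=\delta^{-1}a_0,$$ all other commutators vanishing (apart from those given by antisymmetry). Write $[a_J,a_K]=\delta^{-1}f_{JK}^L a_L$, which defines the structure constants $f_{JK}^L$. Here $y$ is a global $U(1)$ coordinate of $G$ for which $a_3=-\partial/\partial y$ is a $U(1)$ unit vector field commuting with every right-invariant vector field on $G$; the $U(1)$ factor has radius $\delta_0$. The metric on $G$ is $\alpha=g_{JK}\alpha^J\otimes\alpha^K$, with volume form $d\alpha$. The space-time $X$. The gravitational field is the metric $\beta=g_{JK}\beta^J\otimes\beta^K$, with volume form $d\beta$. The dual tetrad of vector fields $b_K$ satisfies $\beta^K(b_J)=\delta^K_J$. In local coordinates $x^\alpha$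 on $X$ write $\beta^K=\beta^K_\alpha dx^\alpha$ and $\beta=g_{\alpha\beta}dx^\alpha\otimes dx^\beta$, so that $g_{\alpha\beta}=g_{JK}\beta^J_\alpha\beta^K_\beta$. Space-time indices are lowered and raised with $g_{\alpha\beta}$ and its inverse $g^{\alpha\beta}$. $R_X$ is the scalar curvature of $X$ with the metric $\beta$. The manifold $M=X\times G$. The forms $\alpha^K,\beta^K$ also denote their pullbacks to $M$ under the projections, and $a_K,b_K,\partial_\alpha=\partial/\partial x^\alpha$ also denote the corresponding vector fields on $M$. Define $$\nu^K=\alpha^K-(\kappa\delta)^{1/3}|\rho|\,\beta^K,\qquad \gamma=g_{JK}(\beta^J\otimes\beta^K+\nu^J\otimes\nu^K),$$ $$v_K=b_K+(\kappa\delta)^{1/3}|\rho|\,a_K,\qquad v^K=g^{JK}v_J.$$ Here $\gamma$ is the Kaluza-Klein metric on $M$; its volume form is $d\gamma=d\beta\wedge d\alpha$. The vector fields $(v_K,a_K)$ are dual to $(\beta^K,\nu^K)$, and $\langle\cdot,\cdot\rangle=\gamma(\cdot,\cdot)$. The notation $v_K(\rho+\mu)$ means the derivative of the function $\rho+\mu$ along $v_K$. Curvature. $R(\,,\,)$ is the curvature two-form associated with the metric $\gamma$ on $M$, and $R_v$ is the sum of sectional curvatures over the four-dimensional subspaces spanned by the orthonormal tetrad $v_K$ in each tangent space of $M$: $$R_v=g^{JK}g^{LM}\langle R(v_J,v_L)v_K,v_M\rangle .$$ Yang-Mills quantities. $$F^K_\alpha=|\rho|\beta^K_\alpha,\qquad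 F^L_{\alpha\beta}=\partial_\alpha F^L_\beta-\partial_\beta F^L_\alpha+g f^L_{JK}F^J_\alpha F^K_\beta,\qquad F_K^{\alpha\beta}=g^{\gamma\alpha}g^{\delta\beta}g_{JK}F^J_{\gamma\delta},$$ $$D_\alpha(\rho+\mu)=\partial_\alpha\rho-ig_0F^3_\alpha(\rho+\mu),\qquad D^\alpha=g^{\alpha\beta}D_\beta .$$ The Dirac limit. On Minkowski space-time, with $\mu=2m_0/g_0$ ($m_0$ the fermion mass) and $g_0=\tfrac32 g$, Dirac's bispinor Lagrangian $L_D=\mathrm{Re}[i\overline\Psi\gamma^\alpha\partial_\alpha\Psi-m_0 s]$ satisfies $L_D=\lim_{g\to\infty}L_g$. Here $\gamma^\alpha,\gamma^5$ are Dirac matrices, $\overline\Psi=\Psi^+\gamma^0$, and $s$ is the complex scalar with $\mathrm{Re}\,s=\overline\Psi\Psi$, $\mathrm{Im}\,s=i\overline\Psi\gamma^5\Psi$. The bispinor field $\Psi$ is related to $(F^K_\alpha,\rho)$ by $j^K_\alpha=4|\rho|^2F^K_\alpha$, $s=4|\rho|^2\bar\rho$, where $j^0_\alpha=\overline\Psi\gamma_\alpha\Psi$, $j^1_\alpha=\mathrm{Re}[\overline\Psi\gamma_\alpha\Psi^C]$, $j^2_\alpha=\mathrm{Im}[\overline\Psi\gamma_\alpha\Psi^C]$, $j^3_\alpha=\overline\Psi\gamma_\alpha\gamma^5\Psi$, and $\Psi^C$ is the charge conjugate of $\Psi$. This is the limit referred to in (3). *)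

theory Defs
  imports "HOL-Analysis.Analysis"
begin

section \<open>Smooth manifolds given by atlases\<close>

text \<open>\<open>Ck_on\<close> and \<open>smooth_on\<close> are meant for open sets \<open>S\<close>: the derivatives are taken in the
  whole space.\<close>

primrec Ck_on :: "nat \<Rightarrow> 'e::euclidean_space set \<Rightarrow> ('e \<Rightarrow> 'b::real_normed_vector) \<Rightarrow> bool" where
  "Ck_on 0 S f \<longleftrightarrow> continuous_on S f"
| "Ck_on (Suc k) S f \<longleftrightarrow>
     (\<forall>x\<in>S. f differentiable (at x)) \<and> (\<forall>v. Ck_on k S (\<lambda>x. frechet_derivative f (at x) v))"

definition smooth_on :: "'e::euclidean_space set \<Rightarrow> ('e \<Rightarrow> 'b::real_normed_vector) \<Rightarrow> bool" where
  "smooth_on S f \<longleftrightarrow> (\<forall>k. Ck_on k S f)"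

text \<open>A chart is its domain together with its coordinate map; the values of the coordinate map
  outside the domain are irrelevant.\<close>

type_synonym ('a, 'e) chart = "'a set \<times> ('a \<Rightarrow> 'e)"
type_synonym ('a, 'e) atlas = "('a, 'e) chart set"

definition points :: "('a, 'e) atlas \<Rightarrow> 'a set" where
  "points \<A> = (\<Union>c\<in>\<A>. fst c)"

text \<open>Hausdorff and second countable by the type class constraints on the ambient type.\<close>

definition smooth_manifold ::
  "('a::{t2_space,second_countable_topology}, 'e::euclidean_space) atlas \<Rightarrow> bool" where
  "smooth_manifold \<A> \<longleftrightarrow>
     (\<forall>(U, \<phi>)\<in>\<A>. openin (top_of_set (points \<A>)) U \<and> open (\<phi> ` U) \<and>
        homeomorphism U (\<phi> ` U) \<phi> (inv_into U \<phi>)) \<and>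
     (\<forall>(U, \<phi>)\<in>\<A>. \<forall>(V, \<psi>)\<in>\<A>. smooth_on (\<phi> ` (U \<inter> V)) (\<psi> \<circ> inv_into U \<phi>))"

definition smooth_at ::
  "('a, 'e::euclidean_space) atlas \<Rightarrow> 'a \<Rightarrow> ('a \<Rightarrow> 'b::real_normed_vector) \<Rightarrow> bool" where
  "smooth_at \<A> p f \<longleftrightarrow>
     (\<exists>(U, \<phi>)\<in>\<A>. p \<in> U \<and>
        (\<exists>W. open W \<and> \<phi> p \<in> W \<and> W \<subseteq> \<phi> ` U \<and> smooth_on W (f \<circ> inv_into U \<phi>)))"

definition smooth_fun ::
  "('a, 'e::euclidean_space) atlas \<Rightarrow> ('a \<Rightarrow> 'b::real_normed_vector) \<Rightarrow> bool" where
  "smooth_fun \<A> f \<longleftrightarrow> (\<forall>p\<in>points \<A>. smooth_at \<A> p f)"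

section \<open>Tangent vectors, vector fields and one-forms\<close>

text \<open>A tangent vector at \<open>p\<close> is a directional derivative acting on (germs of) functions that are
  smooth near \<open>p\<close>. By convention it sends every other function to 0, so that equality of tangent
  vectors is equality of functionals.\<close>

type_synonym 'a tvec = "('a \<Rightarrow> real) \<Rightarrow> real"
type_synonym 'a vfield = "'a \<Rightarrow> 'a tvec"
type_synonym 'a oneform = "'a \<Rightarrow> 'a tvec \<Rightarrow> real"
type_synonym 'a metric_field = "'a \<Rightarrow> 'a tvec \<Rightarrow> 'a tvec \<Rightarrow> real"

definition coord_vec ::
  "('a, 'e::euclidean_space) atlas \<Rightarrow> ('a, 'e) chart \<Rightarrow> 'a \<Rightarrow> 'e \<Rightarrow> 'a tvec" where
  "coord_vec \<A> c p u = (\<lambda>f. if smooth_at \<A> p f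
     then frechet_derivative (f \<circ> inv_into (fst c) (snd c)) (at (snd c p)) u else 0)"

definition tangent_space :: "('a, 'e::euclidean_space) atlas \<Rightarrow> 'a \<Rightarrow> 'a tvec set" where
  "tangent_space \<A> p = {coord_vec \<A> c p u | c u. c \<in> \<A> \<and> p \<in> fst c}"

definition vector_field :: "('a, 'e::euclidean_space) atlas \<Rightarrow> 'a vfield \<Rightarrow> bool" where
  "vector_field \<A> V \<longleftrightarrow> (\<forall>p\<in>points \<A>. V p \<in> tangent_space \<A> p \<and>
     (\<forall>f. smooth_at \<A> p f \<longrightarrow> smooth_at \<A> p (\<lambda>q. V q f)))"

definition one_form :: "('a, 'e::euclidean_space) atlas \<Rightarrow> 'a oneform \<Rightarrow> bool" where
  "one_form \<A> \<theta> \<longleftrightarrow> (\<forall>p\<in>points \<A>.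
     (\<forall>D\<in>tangent_space \<A> p. \<forall>E\<in>tangent_space \<A> p. \<forall>r.
        \<theta> p (\<lambda>f. r * D f + E f) = r * \<theta> p D + \<theta> p E) \<and>
     (\<forall>c\<in>\<A>. p \<in> fst c \<longrightarrow> (\<forall>u. smooth_at \<A> p (\<lambda>q. \<theta> q (coord_vec \<A> c q u)))))"

definition lie_bracket ::
  "('a, 'e::euclidean_space) atlas \<Rightarrow> 'a vfield \<Rightarrow> 'a vfield \<Rightarrow> 'a vfield" where
  "lie_bracket \<A> V W p = (\<lambda>f. if smooth_at \<A> p f
     then V p (\<lambda>q. W q f) - W p (\<lambda>q. V q f) else 0)"

text \<open>Derivative of a complex-valued function along a tangent vector.\<close>

definition cderiv :: "'a tvec \<Rightarrow> ('a \<Rightarrow> complex) \<Rightarrow> complex" where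
  "cderiv D f = Complex (D (\<lambda>q. Re (f q))) (D (\<lambda>q. Im (f q)))"

section \<open>Levi-Civita connection and curvature\<close>

definition is_levi_civita :: "('a, 'e::euclidean_space) atlas \<Rightarrow> 'a metric_field \<Rightarrow>
    ('a vfield \<Rightarrow> 'a vfield \<Rightarrow> 'a vfield) \<Rightarrow> bool" where
  "is_levi_civita \<A> h conn \<longleftrightarrow>
    (\<forall>V W. vector_field \<A> V \<longrightarrow> vector_field \<A> W \<longrightarrow> vector_field \<A> (conn V W)) \<and>
    (\<forall>V V' W s. vector_field \<A> V \<longrightarrow> vector_field \<A> V' \<longrightarrow> vector_field \<A> W \<longrightarrow> smooth_fun \<A> s \<longrightarrow>
      (\<forall>p\<in>points \<A>. \<forall>f. conn (\<lambda>q k. s q * V q k + V' q k) W p f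
          = s p * conn V W p f + conn V' W p f)) \<and>
    (\<forall>V W W' s. vector_field \<A> V \<longrightarrow> vector_field \<A> W \<longrightarrow> vector_field \<A> W' \<longrightarrow> smooth_fun \<A> s \<longrightarrow>
      (\<forall>p\<in>points \<A>. \<forall>f. conn V (\<lambda>q k. s q * W q k + W' q k) p f
          = s p * conn V W p f + V p s * W p f + conn V W' p f)) \<and>
    (\<forall>V W. vector_field \<A> V \<longrightarrow> vector_field \<A> W \<longrightarrow>
      (\<forall>p\<in>points \<A>. \<forall>f. conn V W p f - conn W V p f = lie_bracket \<A> V W p f)) \<and>
    (\<forall>V W Z. vector_field \<A> V \<longrightarrow> vector_field \<A> W \<longrightarrow> vector_field \<A> Z \<longrightarrow>
      (\<forall>p\<in>points \<A>. V p (\<lambda>q. h q (W q) (Z q))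
          = h p (conn V W p) (Z p) + h p (W p) (conn V Z p)))"

definition levi_civita :: "('a, 'e::euclidean_space) atlas \<Rightarrow> 'a metric_field \<Rightarrow>
    'a vfield \<Rightarrow> 'a vfield \<Rightarrow> 'a vfield" where
  "levi_civita \<A> h = (SOME conn. is_levi_civita \<A> h conn)"

definition curvature :: "('a, 'e::euclidean_space) atlas \<Rightarrow> 'a metric_field \<Rightarrow>
    'a vfield \<Rightarrow> 'a vfield \<Rightarrow> 'a vfield \<Rightarrow> 'a vfield" where
  "curvature \<A> h V W Z = (let conn = levi_civita \<A> h in
     (\<lambda>p f. conn V (conn W Z) p f - conn W (conn V Z) p f - conn (lie_bracket \<A> V W) Z p f))"

text \<open>The metric \<open>diag(1,-1,-1,-1)\<close>; the index type \<open>4\<close> has the elements \<open>0, 1, 2, 3\<close>.\<close>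

definition eta :: "4 \<Rightarrow> 4 \<Rightarrow> real" where
  "eta J K = (if J = K then (if J = 0 then 1 else -1) else 0)"

text \<open>\<open>g\<^sup>J\<^sup>K g\<^sup>L\<^sup>M \<langle>R(e\<^sub>J,e\<^sub>L)e\<^sub>K,e\<^sub>M\<rangle>\<close> for an orthonormal tetrad \<open>e\<close>.
  For a tetrad on a four-dimensional space-time this is the scalar curvature. Since
  \<open>R(V,W) = [\<nabla>\<^sub>V,\<nabla>\<^sub>W] - \<nabla>\<^bsub>[V,W]\<^esub>\<close>, the order of the arguments
  fixes the sign for which \<open>R\<^sub>X / (16 \<pi> \<kappa>\<^sub>0)\<close> is the Hilbert-Einstein Lagrangian in
  signature \<open>(+,-,-,-)\<close>; it is opposite to that of the contraction \<open>\<langle>R(e\<^sub>J,e\<^sub>L)e\<^sub>M,e\<^sub>K\<rangle>\<close>.\<close>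

definition tetrad_curvature :: "('a, 'e::euclidean_space) atlas \<Rightarrow> 'a metric_field \<Rightarrow>
    (4 \<Rightarrow> 'a vfield) \<Rightarrow> 'a \<Rightarrow> real" where
  "tetrad_curvature \<A> h e p = (\<Sum>J\<in>UNIV. \<Sum>K\<in>UNIV. \<Sum>L\<in>UNIV. \<Sum>M\<in>UNIV.
     eta J K * eta L M * h p (curvature \<A> h (e J) (e L) (e K) p) (e M p))"

section \<open>Tetrads and volume\<close>

definition coframe :: "('a, real^4) atlas \<Rightarrow> (4 \<Rightarrow> 'a oneform) \<Rightarrow> bool" where
  "coframe \<A> \<theta> \<longleftrightarrow> (\<forall>K. one_form \<A> (\<theta> K)) \<and>
     (\<forall>p\<in>points \<A>. \<forall>D\<in>tangent_space \<A> p. (\<forall>K. \<theta> K p D = 0) \<longrightarrow> D = (\<lambda>f. 0))"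

definition dual_tetrads ::
  "('a, real^4) atlas \<Rightarrow> (4 \<Rightarrow> 'a vfield) \<Rightarrow> (4 \<Rightarrow> 'a oneform) \<Rightarrow> bool" where
  "dual_tetrads \<A> e \<theta> \<longleftrightarrow> (\<forall>K. vector_field \<A> (e K)) \<and> (\<forall>K. one_form \<A> (\<theta> K)) \<and>
     (\<forall>p\<in>points \<A>. \<forall>J K. \<theta> K p (e J p) = (if J = K then 1 else 0))"

definition tetrad_metric :: "(4 \<Rightarrow> 'a oneform) \<Rightarrow> 'a metric_field" where
  "tetrad_metric \<theta> p D E = (\<Sum>J\<in>UNIV. \<Sum>K\<in>UNIV. eta J K * (\<theta> J p D * \<theta> K p E))"

text \<open>The measure of the volume form \<open>\<theta>\<^sup>0 \<and> \<theta>\<^sup>1 \<and> \<theta>\<^sup>2 \<and> \<theta>\<^sup>3\<close>, with respect to the orientation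
  given by the tetrad: in each chart it has density \<open>\<bar>det(\<theta>\<^sup>K\<^sub>\<alpha>)\<bar>\<close>.\<close>

definition tetrad_volume ::
  "('a::topological_space, real^4) atlas \<Rightarrow> (4 \<Rightarrow> 'a oneform) \<Rightarrow> 'a measure" where
  "tetrad_volume \<A> \<theta> = (THE \<nu>. space \<nu> = points \<A> \<and>
     sets \<nu> = sets (restrict_space borel (points \<A>)) \<and>
     (\<forall>(U, \<phi>)\<in>\<A>. \<forall>B\<in>sets \<nu>. B \<subseteq> U \<longrightarrow>
        emeasure \<nu> B = (\<integral>\<^sup>+z\<in>\<phi> ` B. ennreal \<bar>det (\<chi> K i. \<theta> K (inv_into U \<phi> z)
          (coord_vec \<A> (U, \<phi>) (inv_into U \<phi> z) (axis i 1)))\<bar> \<partial>lborel)))"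

section \<open>Products\<close>

definition prod_atlas :: "('a, 'e) atlas \<Rightarrow> ('b, 'd) atlas \<Rightarrow> ('a \<times> 'b, 'e \<times> 'd) atlas" where
  "prod_atlas \<A> \<B> = {(U \<times> V, map_prod \<phi> \<psi>) | U \<phi> V \<psi>. (U, \<phi>) \<in> \<A> \<and> (V, \<psi>) \<in> \<B>}"

text \<open>Vectors tangent to a factor as vectors on the product (at the point \<open>p\<close>), and pullbacks of
  one-forms under the two projections.\<close>

definition lift_fst :: "('a \<times> 'b, 'e::euclidean_space) atlas \<Rightarrow> 'a \<times> 'b \<Rightarrow> 'a tvec \<Rightarrow> ('a \<times> 'b) tvec" where
  "lift_fst \<M> p D = (\<lambda>f. if smooth_at \<M> p f then D (\<lambda>x. f (x, snd p)) else 0)"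

definition lift_snd :: "('a \<times> 'b, 'e::euclidean_space) atlas \<Rightarrow> 'a \<times> 'b \<Rightarrow> 'b tvec \<Rightarrow> ('a \<times> 'b) tvec" where
  "lift_snd \<M> p D = (\<lambda>f. if smooth_at \<M> p f then D (\<lambda>q. f (fst p, q)) else 0)"

definition pull_fst :: "'a oneform \<Rightarrow> ('a \<times> 'b) oneform" where
  "pull_fst \<theta> p D = \<theta> (fst p) (\<lambda>f. D (\<lambda>q. f (fst q)))"

definition pull_snd :: "'b oneform \<Rightarrow> ('a \<times> 'b) oneform" where
  "pull_snd \<theta> p D = \<theta> (snd p) (\<lambda>f. D (\<lambda>q. f (snd q)))"

section \<open>The group \<open>G = SL(2,R) \<times> U(1)\<close>\<close>

type_synonym gpoint = "(real^2^2) \<times> complex"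

definition G_set :: "gpoint set" where
  "G_set = {(A, z). det A = 1 \<and> cmod z = 1}"

definition G_mult :: "gpoint \<Rightarrow> gpoint \<Rightarrow> gpoint" where
  "G_mult p q = (fst p ** fst q, snd p * snd q)"

text \<open>The smooth structure of \<open>G\<close> as a submanifold of its ambient Euclidean space: charts are the
  diffeomorphisms from relatively open subsets of \<open>G\<close> onto open subsets of \<open>R\<^sup>4\<close>.\<close>

definition G_atlas :: "(gpoint, real^4) atlas" where
  "G_atlas = {(U, \<phi>). \<exists>W. open W \<and> U = G_set \<inter> W \<and> smooth_on W \<phi> \<and> inj_on \<phi> U \<and>
     open (\<phi> ` U) \<and> smooth_on (\<phi> ` U) (inv_into U \<phi>)}"

definition right_invariant :: "gpoint vfield \<Rightarrow> bool" where
  "right_invariant V \<longleftrightarrow> vector_field G_atlas V \<and>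
     (\<forall>q\<in>G_set. \<forall>r\<in>G_set. \<forall>f. smooth_at G_atlas (G_mult q r) f \<longrightarrow>
        V (G_mult q r) f = V q (\<lambda>s. f (G_mult s r)))"

text \<open>\<open>struct_const J K L\<close> is \<open>f\<^sub>J\<^sub>K\<^sup>L\<close>, read off from \<open>[a\<^sub>0,a\<^sub>1] = -a\<^sub>2/\<delta>\<close>,
  \<open>[a\<^sub>0,a\<^sub>2] = a\<^sub>1/\<delta>\<close>, \<open>[a\<^sub>1,a\<^sub>2] = a\<^sub>0/\<delta>\<close>.\<close>

definition struct_const :: "4 \<Rightarrow> 4 \<Rightarrow> 4 \<Rightarrow> real" where
  "struct_const J K L =
     (if (J, K, L) \<in> {(0, 2, 1), (1, 2, 0), (1, 0, 2)} then 1
      else if (J, K, L) \<in> {(2, 0, 1), (2, 1, 0), (0, 1, 2)} then -1 else 0)"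

text \<open>\<open>y\<close> is the coordinate on the \<open>U(1)\<close> factor with \<open>z = e\<^bsup>iy/\<delta>\<^sub>0\<^esup>\<close>; the last
  clause says \<open>a\<^sub>3 = -\<partial>/\<partial>y\<close>.\<close>

definition group_tetrad :: "real \<Rightarrow> real \<Rightarrow> (4 \<Rightarrow> gpoint vfield) \<Rightarrow> bool" where
  "group_tetrad \<delta> \<delta>0 a \<longleftrightarrow> (\<forall>K. right_invariant (a K)) \<and>
     (\<forall>V. right_invariant V \<longrightarrow>
        (\<exists>!r. \<forall>q\<in>G_set. \<forall>f. V q f = (\<Sum>K\<in>UNIV. r K * a K q f))) \<and>
     (\<forall>J K. \<forall>q\<in>G_set. \<forall>f. lie_bracket G_atlas (a J) (a K) q f
        = 1 / \<delta> * (\<Sum>L\<in>UNIV. struct_const J K L * a L q f)) \<and>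
     (\<forall>A y f. (A, cis (y / \<delta>0)) \<in> G_set \<longrightarrow> smooth_at G_atlas (A, cis (y / \<delta>0)) f \<longrightarrow>
        ((\<lambda>t. f (A, cis (t / \<delta>0))) has_real_derivative - a 3 (A, cis (y / \<delta>0)) f) (at y))"

section \<open>The Kaluza-Klein Lagrangian\<close>

definition kappa :: "real \<Rightarrow> real" where
  "kappa \<kappa>0 = 16 * pi / 3 * \<kappa>0"

definition delta0 :: "real \<Rightarrow> real" where
  "delta0 \<delta> = 2 / 3 * \<delta>"

definition coupling :: "real \<Rightarrow> real \<Rightarrow> real" where
  "coupling \<kappa>0 \<delta> = root 3 (kappa \<kappa>0 * \<delta>) / \<delta>"

definition coupling0 :: "real \<Rightarrow> real \<Rightarrow> real" where
  "coupling0 \<kappa>0 \<delta> = root 3 (kappa \<kappa>0 * \<delta>) / delta0 \<delta>"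

type_synonym 'x mpoint = "'x \<times> gpoint"

definition M_atlas :: "('x, real^4) atlas \<Rightarrow> ('x mpoint, (real^4) \<times> (real^4)) atlas" where
  "M_atlas \<A> = prod_atlas \<A> G_atlas"

definition nu :: "real \<Rightarrow> real \<Rightarrow> (4 \<Rightarrow> 'x oneform) \<Rightarrow> (4 \<Rightarrow> gpoint oneform) \<Rightarrow>
    ('x mpoint \<Rightarrow> complex) \<Rightarrow> 4 \<Rightarrow> 'x mpoint oneform" where
  "nu \<kappa>0 \<delta> \<beta> \<alpha> \<rho> K p D =
     pull_snd (\<alpha> K) p D - root 3 (kappa \<kappa>0 * \<delta>) * cmod (\<rho> p) * pull_fst (\<beta> K) p D"

definition kk_metric :: "real \<Rightarrow> real \<Rightarrow> (4 \<Rightarrow> 'x oneform) \<Rightarrow> (4 \<Rightarrow> gpoint oneform) \<Rightarrow>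
    ('x mpoint \<Rightarrow> complex) \<Rightarrow> 'x mpoint metric_field" where
  "kk_metric \<kappa>0 \<delta> \<beta> \<alpha> \<rho> p D E =
     tetrad_metric (\<lambda>K. pull_fst (\<beta> K)) p D E + tetrad_metric (nu \<kappa>0 \<delta> \<beta> \<alpha> \<rho>) p D E"

definition kk_v :: "real \<Rightarrow> real \<Rightarrow> ('x, real^4) atlas \<Rightarrow> (4 \<Rightarrow> 'x vfield) \<Rightarrow>
    (4 \<Rightarrow> gpoint vfield) \<Rightarrow> ('x mpoint \<Rightarrow> complex) \<Rightarrow> 4 \<Rightarrow> 'x mpoint vfield" where
  "kk_v \<kappa>0 \<delta> \<A> b a \<rho> K p = (\<lambda>f. lift_fst (M_atlas \<A>) p (b K (fst p)) f
     + root 3 (kappa \<kappa>0 * \<delta>) * cmod (\<rho> p) * lift_snd (M_atlas \<A>) p (a K (snd p)) f)"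

text \<open>The quadratic expression in \<open>kk_lagrangian\<close> (and in \<open>ym_lagrangian\<close>) is a Hermitian form, so
  \<open>Re\<close> only changes the type.\<close>

definition kk_lagrangian :: "real \<Rightarrow> real \<Rightarrow> ('x, real^4) atlas \<Rightarrow> (4 \<Rightarrow> 'x oneform) \<Rightarrow>
    (4 \<Rightarrow> 'x vfield) \<Rightarrow> (4 \<Rightarrow> gpoint oneform) \<Rightarrow> (4 \<Rightarrow> gpoint vfield) \<Rightarrow>
    ('x mpoint \<Rightarrow> complex) \<Rightarrow> ('x mpoint \<Rightarrow> complex) \<Rightarrow> 'x mpoint \<Rightarrow> real" where
  "kk_lagrangian \<kappa>0 \<delta> \<A> \<beta> b \<alpha> a \<rho> \<mu> p =
     1 / (16 * pi * \<kappa>0) *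
       tetrad_curvature (M_atlas \<A>) (kk_metric \<kappa>0 \<delta> \<beta> \<alpha> \<rho>) (kk_v \<kappa>0 \<delta> \<A> b a \<rho>) p
     + 1 / coupling0 \<kappa>0 \<delta> * Re (\<Sum>J\<in>UNIV. \<Sum>K\<in>UNIV. of_real (eta J K) *
         (cnj (cderiv (kk_v \<kappa>0 \<delta> \<A> b a \<rho> K p) (\<lambda>q. \<rho> q + \<mu> q)) *
          cderiv (kk_v \<kappa>0 \<delta> \<A> b a \<rho> J p) (\<lambda>q. \<rho> q + \<mu> q)))"

definition scalar_curvature ::
  "('x, real^4) atlas \<Rightarrow> (4 \<Rightarrow> 'x oneform) \<Rightarrow> (4 \<Rightarrow> 'x vfield) \<Rightarrow> 'x \<Rightarrow> real" where
  "scalar_curvature \<A> \<beta> b = tetrad_curvature \<A> (tetrad_metric \<beta>) b"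

section \<open>The Dirac-Yang-Mills Lagrangian in local coordinates\<close>

text \<open>In what follows \<open>c\<close> is a chart of \<open>X\<close>, whose coordinates are \<open>x\<^sup>\<alpha>\<close>.
  \<open>partial_M \<A> c p \<alpha>\<close> is the vector field \<open>\<partial>/\<partial>x\<^sup>\<alpha>\<close> on \<open>M\<close>.\<close>

definition partial_X :: "('x, real^4) atlas \<Rightarrow> ('x, real^4) chart \<Rightarrow> 'x \<Rightarrow> 4 \<Rightarrow> 'x tvec" where
  "partial_X \<A> c x \<alpha> = coord_vec \<A> c x (axis \<alpha> 1)"

definition partial_M :: "('x, real^4) atlas \<Rightarrow> ('x, real^4) chart \<Rightarrow> 'x mpoint \<Rightarrow> 4 \<Rightarrow> 'x mpoint tvec" where
  "partial_M \<A> c p \<alpha> = lift_fst (M_atlas \<A>) p (partial_X \<A> c (fst p) \<alpha>)"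

definition g_low :: "('x, real^4) atlas \<Rightarrow> (4 \<Rightarrow> 'x oneform) \<Rightarrow> ('x, real^4) chart \<Rightarrow> 'x \<Rightarrow> real^4^4" where
  "g_low \<A> \<beta> c x = (\<chi> \<alpha> \<gamma>. tetrad_metric \<beta> x (partial_X \<A> c x \<alpha>) (partial_X \<A> c x \<gamma>))"

definition g_up :: "('x, real^4) atlas \<Rightarrow> (4 \<Rightarrow> 'x oneform) \<Rightarrow> ('x, real^4) chart \<Rightarrow> 'x \<Rightarrow> real^4^4" where
  "g_up \<A> \<beta> c x = matrix_inv (g_low \<A> \<beta> c x)"

definition F_pot :: "('x, real^4) atlas \<Rightarrow> (4 \<Rightarrow> 'x oneform) \<Rightarrow> ('x mpoint \<Rightarrow> complex) \<Rightarrow>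
    ('x, real^4) chart \<Rightarrow> 4 \<Rightarrow> 4 \<Rightarrow> 'x mpoint \<Rightarrow> real" where
  "F_pot \<A> \<beta> \<rho> c K \<alpha> p = cmod (\<rho> p) * \<beta> K (fst p) (partial_X \<A> c (fst p) \<alpha>)"

definition F_field :: "real \<Rightarrow> real \<Rightarrow> ('x, real^4) atlas \<Rightarrow> (4 \<Rightarrow> 'x oneform) \<Rightarrow>
    ('x mpoint \<Rightarrow> complex) \<Rightarrow> ('x, real^4) chart \<Rightarrow> 4 \<Rightarrow> 4 \<Rightarrow> 4 \<Rightarrow> 'x mpoint \<Rightarrow> real" where
  "F_field \<kappa>0 \<delta> \<A> \<beta> \<rho> c L \<alpha> \<gamma> p =
     partial_M \<A> c p \<alpha> (F_pot \<A> \<beta> \<rho> c L \<gamma>) - partial_M \<A> c p \<gamma> (F_pot \<A> \<beta> \<rho> c L \<alpha>)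
     + coupling \<kappa>0 \<delta> * (\<Sum>J\<in>UNIV. \<Sum>K\<in>UNIV.
         struct_const J K L * F_pot \<A> \<beta> \<rho> c J \<alpha> p * F_pot \<A> \<beta> \<rho> c K \<gamma> p)"

definition F_field_up :: "real \<Rightarrow> real \<Rightarrow> ('x, real^4) atlas \<Rightarrow> (4 \<Rightarrow> 'x oneform) \<Rightarrow>
    ('x mpoint \<Rightarrow> complex) \<Rightarrow> ('x, real^4) chart \<Rightarrow> 4 \<Rightarrow> 4 \<Rightarrow> 4 \<Rightarrow> 'x mpoint \<Rightarrow> real" where
  "F_field_up \<kappa>0 \<delta> \<A> \<beta> \<rho> c K \<alpha> \<gamma> p =
     (\<Sum>\<epsilon>\<in>UNIV. \<Sum>\<zeta>\<in>UNIV. \<Sum>J\<in>UNIV. g_up \<A> \<beta> c (fst p) $ \<epsilon> $ \<alpha> * g_up \<A> \<beta> c (fst p) $ \<zeta> $ \<gamma> *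
        eta J K * F_field \<kappa>0 \<delta> \<A> \<beta> \<rho> c J \<epsilon> \<zeta> p)"

definition D_cov :: "real \<Rightarrow> real \<Rightarrow> ('x, real^4) atlas \<Rightarrow> (4 \<Rightarrow> 'x oneform) \<Rightarrow>
    ('x mpoint \<Rightarrow> complex) \<Rightarrow> ('x mpoint \<Rightarrow> complex) \<Rightarrow> ('x, real^4) chart \<Rightarrow> 4 \<Rightarrow> 'x mpoint \<Rightarrow> complex" where
  "D_cov \<kappa>0 \<delta> \<A> \<beta> \<rho> \<mu> c \<alpha> p = cderiv (partial_M \<A> c p \<alpha>) \<rho>
     - \<i> * of_real (coupling0 \<kappa>0 \<delta>) * of_real (F_pot \<A> \<beta> \<rho> c 3 \<alpha> p) * (\<rho> p + \<mu> p)"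

definition ym_lagrangian :: "real \<Rightarrow> real \<Rightarrow> ('x, real^4) atlas \<Rightarrow> (4 \<Rightarrow> 'x oneform) \<Rightarrow>
    ('x mpoint \<Rightarrow> complex) \<Rightarrow> ('x mpoint \<Rightarrow> complex) \<Rightarrow> ('x, real^4) chart \<Rightarrow> 'x mpoint \<Rightarrow> real" where
  "ym_lagrangian \<kappa>0 \<delta> \<A> \<beta> \<rho> \<mu> c p =
     1 / (4 * coupling \<kappa>0 \<delta>) * (\<Sum>K\<in>UNIV. \<Sum>\<alpha>\<in>UNIV. \<Sum>\<gamma>\<in>UNIV.
        F_field \<kappa>0 \<delta> \<A> \<beta> \<rho> c K \<alpha> \<gamma> p * F_field_up \<kappa>0 \<delta> \<A> \<beta> \<rho> c K \<alpha> \<gamma> p)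
     + 1 / coupling0 \<kappa>0 \<delta> * Re (\<Sum>\<alpha>\<in>UNIV. \<Sum>\<gamma>\<in>UNIV. of_real (g_up \<A> \<beta> c (fst p) $ \<alpha> $ \<gamma>) *
        (cnj (D_cov \<kappa>0 \<delta> \<A> \<beta> \<rho> \<mu> c \<alpha> p) * D_cov \<kappa>0 \<delta> \<A> \<beta> \<rho> \<mu> c \<gamma> p))"

end

theory Submission
  imports Defs
begin

text \<open>The curvature of a metric with constant coefficients in a global frame is an explicit expression
  in the brackets of the frame (Koszul). For the frame \<open>(v\<^sub>K, a\<^sub>K)\<close> of \<open>M\<close> the
  bracket \<open>[v\<^sub>J, v\<^sub>K]\<close> is the lift of \<open>[b\<^sub>J, b\<^sub>K]\<close> plus a vertical part
  \<open>\<Omega>\<close>, and \<open>[v\<^sub>J, a\<^sub>K]\<close> is vertical. Hence, as in O'Neill's formula,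
  \<open>R\<^sub>v = R\<^sub>X + (3/4) |\<Omega>|\<^sup>2\<close>, and \<open>\<Omega>\<close> is \<open>(\<kappa>\<delta>)\<^bsup>1/3\<^esup>\<close>
  times the field strength \<open>F\<close> in the tetrad. In the scalar term only \<open>a\<^sub>3\<close> acts on the phase,
  since the brackets of right-invariant fields, among them \<open>a\<^sub>0, a\<^sub>1, a\<^sub>2\<close>, annihilate the
  coordinate of the abelian factor.\<close>

section \<open>Calculus of smooth maps\<close>

text \<open>\<open>levi_civita\<close> is a \<open>SOME\<close>, so nothing about curvature can be
  computed until the chosen connection is pinned down. A global frame with constant inner products
  gives an explicit Levi-Civita connection, and uniqueness on smooth fields carries its components
  over to the chosen one. When the curvature of the fields v_K is expanded in the eight-field frame
  of M, no coefficient has more than one vertical index, so the group enters only through the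
  vertical part of [v_J, v_K]. The factor 16 \<pi> / 3 in \<open>kappa\<close> is matched to
  O'Neill's 3/4: one has 3 / (64 \<pi> \<kappa>0) = 1 / (4 \<kappa>), and with k the cube root of
  \<kappa>\<delta> the relation g k^2 = \<kappa> turns k^2 |F|^2 / (4 \<kappa>) into |F|^2 / (4 g).
  Tangent vectors are functionals on all functions, equal to 0 on those not smooth at the point.
  Hence the many case distinctions on \<open>smooth_at\<close>, and the filter \<open>nbhds\<close>
  for everything that depends on germs only. The statement on the action is the pointwise identity
  under the integral; the limit rests on g^3 \<delta>^2 = \<kappa>.\<close>

lemma Ck_on_cong:
  fixes f g :: "'e::euclidean_space \<Rightarrow> 'b::real_normed_vector"
  assumes "open S" "Ck_on k S f" "\<And>x. x \<in> S \<Longrightarrow> g x = f x"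
  shows "Ck_on k S g"
  using assms(2,3)
proof (induction k arbitrary: f g)
  case 0
  then show ?case using continuous_on_cong[of S S g f] by auto
next
  case (Suc k)
  have *: "(g has_derivative frechet_derivative f (at x)) (at x)" if "x \<in> S" for x
  proof (rule has_derivative_transform_within_open)
    show "(f has_derivative frechet_derivative f (at x)) (at x)"
      using Suc.prems that by (auto simp: frechet_derivative_works)
  qed (use \<open>open S\<close> that Suc.prems(2) in auto)
  then have "frechet_derivative g (at x) = frechet_derivative f (at x)" if "x \<in> S" for x
    using frechet_derivative_at[OF *[OF that]] by simp
  then have "Ck_on k S (\<lambda>x. frechet_derivative g (at x) v)" for v
    using Suc.prems Suc.IH[of "\<lambda>x. frechet_derivative f (at x) v" "\<lambda>x. frechet_derivative g (at x) v"]
    by simp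
  with * show ?case by (auto simp: differentiable_def)
qed

text \<open>Lets a derivative \<open>f'\<close> found by the differentiation rules stand in for
  \<open>frechet_derivative\<close>, with which it agrees on \<open>S\<close> by uniqueness.\<close>

lemma Ck_on_SucI:
  fixes f :: "'e::euclidean_space \<Rightarrow> 'b::real_normed_vector"
  assumes "open S" and d: "\<And>x. x \<in> S \<Longrightarrow> (f has_derivative f' x) (at x)"
    and "\<And>v. Ck_on k S (\<lambda>x. f' x v)"
  shows "Ck_on (Suc k) S f"
proof -
  have "frechet_derivative f (at x) = f' x" if "x \<in> S" for x
    using frechet_derivative_at[OF d[OF that]] by simp
  then have "Ck_on k S (\<lambda>x. frechet_derivative f (at x) v)" for v
    by (intro Ck_on_cong[OF assms(1,3)]) auto
  then show ?thesis using d by (auto simp: differentiable_def)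
qed

lemma Ck_on_has_derivative:
  "Ck_on (Suc k) S f \<Longrightarrow> x \<in> S \<Longrightarrow> (f has_derivative frechet_derivative f (at x)) (at x)"
  by (auto simp: frechet_derivative_works)

lemma Ck_on_subset: "Ck_on k S f \<Longrightarrow> T \<subseteq> S \<Longrightarrow> Ck_on k T f"
  by (induction k arbitrary: f) (auto intro: continuous_on_subset)

lemma Ck_on_SucD: "Ck_on (Suc k) S f \<Longrightarrow> Ck_on k S f"
proof (induction k arbitrary: f)
  case 0
  then show ?case
    by (auto intro!: continuous_at_imp_continuous_on differentiable_imp_continuous_within)
next
  case (Suc k)
  then have "Ck_on k S (\<lambda>x. frechet_derivative f (at x) v)" for v
    by (intro Suc.IH) auto
  with Suc.prems show ?case by simp
qed

lemma Ck_on_const: "Ck_on k S (\<lambda>x. c)"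
  by (induction k arbitrary: c) (auto simp: frechet_derivative_const)

lemma Ck_on_add:
  assumes "open S" shows "Ck_on k S f \<Longrightarrow> Ck_on k S g \<Longrightarrow> Ck_on k S (\<lambda>x. f x + g x)"
proof (induction k arbitrary: f g)
  case (Suc k)
  show ?case
    by (rule Ck_on_SucI[OF assms has_derivative_add[OF Ck_on_has_derivative Ck_on_has_derivative]])
       (use Suc assms in auto)
qed (auto intro: continuous_on_add)

text \<open>The product rule keeps one factor undifferentiated in each term, so the induction step
  also uses that the factors are of the lower class, by \<open>Ck_on_SucD\<close>.\<close>

lemma Ck_on_bilinear:
  assumes "open S" "bounded_bilinear b"
  shows "Ck_on k S f \<Longrightarrow> Ck_on k S g \<Longrightarrow> Ck_on k S (\<lambda>x. b (f x) (g x))"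
proof (induction k arbitrary: f g)
  case 0
  then show ?case using bounded_bilinear.continuous_on[OF assms(2)] by auto
next
  case (Suc k)
  show ?case
    by (rule Ck_on_SucI[OF assms(1) bounded_bilinear.FDERIV[OF assms(2) Ck_on_has_derivative Ck_on_has_derivative]])
       (use Suc.IH[OF Ck_on_SucD[OF Suc.prems(1)]] Suc.IH[OF _ Ck_on_SucD[OF Suc.prems(2)]] Suc.prems assms
         in \<open>auto intro!: Ck_on_add\<close>)
qed

lemma Ck_on_bounded_linear:
  assumes "open S" "bounded_linear b"
  shows "Ck_on k S f \<Longrightarrow> Ck_on k S (\<lambda>x. b (f x))"
proof (induction k arbitrary: f)
  case 0
  then show ?case using bounded_linear.continuous_on[OF assms(2)] by auto
next
  case (Suc k)
  show ?case
    by (rule Ck_on_SucI[OF assms(1) bounded_linear.has_derivative[OF assms(2) Ck_on_has_derivative]])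
       (use Suc assms in auto)
qed

lemma Ck_on_sum:
  assumes "open S" "\<And>i. i \<in> I \<Longrightarrow> Ck_on k S (f i)"
  shows "Ck_on k S (\<lambda>x. \<Sum>i\<in>I. f i x)"
  using assms by (induction I rule: infinite_finite_induct) (auto simp: Ck_on_const intro!: Ck_on_add)

lemma Ck_on_id: "Ck_on k S (\<lambda>x. x)"
  by (cases k) (auto simp: Ck_on_const frechet_derivative_ident)

text \<open>The derivative of 1/f is a polynomial in 1/f and the derivative of f, and 1/f is of
  class k by the induction hypothesis.\<close>

lemma Ck_on_inverse:
  fixes f :: "'e::euclidean_space \<Rightarrow> real"
  assumes "open S" "\<And>x. x \<in> S \<Longrightarrow> f x \<noteq> 0"
  shows "Ck_on k S f \<Longrightarrow> Ck_on k S (\<lambda>x. inverse (f x))"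
proof (induction k)
  case 0
  then show ?case using assms by (auto intro!: continuous_on_inverse)
next
  case (Suc k)
  have "Ck_on k S (\<lambda>x. inverse (f x))" by (rule Suc.IH[OF Ck_on_SucD[OF Suc.prems]])
  then have "Ck_on k S (\<lambda>x. inverse (f x) * frechet_derivative f (at x) v * inverse (f x))" for v
    using Suc.prems by (auto intro!: Ck_on_bilinear[OF assms(1) bounded_bilinear_mult])
  then have *: "Ck_on k S (\<lambda>x. - (inverse (f x) * frechet_derivative f (at x) v * inverse (f x)))" for v
    by (rule Ck_on_bounded_linear[OF assms(1) bounded_linear_minus[OF bounded_linear_ident]])
  show ?case
  proof (rule Ck_on_SucI[OF assms(1) _ *])
    fix x assume "x \<in> S"
    then show "((\<lambda>x. inverse (f x)) has_derivative
        (\<lambda>v. - (inverse (f x) * frechet_derivative f (at x) v * inverse (f x)))) (at x)"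
      by (intro Deriv.has_derivative_inverse assms(2) Ck_on_has_derivative[OF Suc.prems])
  qed
qed

text \<open>In the chain rule the direction fed to the outer derivative varies with x, whereas
  \<open>Ck_on\<close> controls derivatives only in fixed directions. Expanding that direction in
  \<open>Basis\<close> leaves fixed directions with coefficients of class k.\<close>

lemma Ck_on_compose:
  fixes f :: "'e::euclidean_space \<Rightarrow> 'd::euclidean_space"
  assumes "open S" "open T" "f ` S \<subseteq> T"
  shows "Ck_on k S f \<Longrightarrow> Ck_on k T g \<Longrightarrow> Ck_on k S (\<lambda>x. g (f x))"
proof (induction k arbitrary: g)
  case 0
  then have "continuous_on S (\<lambda>x. g (f x))"
    using continuous_on_compose2[OF _ _ assms(3), of g] by simp
  then show ?case by simp
next
  case (Suc k)
  let ?f' = "\<lambda>x. frechet_derivative f (at x)" and ?g' = "\<lambda>x. frechet_derivative g (at x)"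
  have d: "((\<lambda>x. g (f x)) has_derivative (\<lambda>v. ?g' (f x) (?f' x v))) (at x)" if "x \<in> S" for x
  proof -
    have "f x \<in> T" using that assms(3) by blast
    from has_derivative_compose[OF Ck_on_has_derivative[OF Suc.prems(1) that] Ck_on_has_derivative[OF Suc.prems(2) this]]
    show ?thesis .
  qed
  have *: "?g' (f x) (?f' x v) = (\<Sum>b\<in>Basis. (?f' x v \<bullet> b) *\<^sub>R ?g' (f x) b)" if "x \<in> S" for x v
  proof -
    have "linear (?g' (f x))"
      by (rule has_derivative_linear[OF Ck_on_has_derivative[OF Suc.prems(2)]]) (use assms(3) that in blast)
    then have "?g' (f x) (\<Sum>b\<in>Basis. (?f' x v \<bullet> b) *\<^sub>R b) = (\<Sum>b\<in>Basis. (?f' x v \<bullet> b) *\<^sub>R ?g' (f x) b)"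
      by (simp add: linear_sum linear_cmul)
    then show ?thesis by (simp add: euclidean_representation)
  qed
  show ?case
  proof (rule Ck_on_SucI[OF assms(1) d])
    fix v
    have "Ck_on k S (\<lambda>x. \<Sum>b\<in>Basis. (?f' x v \<bullet> b) *\<^sub>R ?g' (f x) b)"
    proof (intro Ck_on_sum assms(1) Ck_on_bilinear[OF _ bounded_bilinear_scaleR])
      show "Ck_on k S (\<lambda>x. ?f' x v \<bullet> b)" for b
        using Suc.prems by (intro Ck_on_bounded_linear[OF assms(1) bounded_linear_inner_left]) auto
      show "Ck_on k S (\<lambda>x. ?g' (f x) b)" for b
        using Suc.prems(2) by (intro Suc.IH[OF Ck_on_SucD[OF Suc.prems(1)]]) auto
    qed
    then show "Ck_on k S (\<lambda>x. ?g' (f x) (?f' x v))"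
      by (rule Ck_on_cong[OF assms(1)]) (simp add: *)
  qed
qed

section \<open>Closure properties of smooth maps\<close>

lemma smooth_on_has_derivative:
  "smooth_on S f \<Longrightarrow> x \<in> S \<Longrightarrow> (f has_derivative frechet_derivative f (at x)) (at x)"
  using Ck_on_has_derivative unfolding smooth_on_def by blast

lemma smooth_on_deriv: "smooth_on S f \<Longrightarrow> smooth_on S (\<lambda>x. frechet_derivative f (at x) v)"
  unfolding smooth_on_def using Ck_on.simps(2) by blast

lemma smooth_on_continuous: "smooth_on S f \<Longrightarrow> continuous_on S f"
  unfolding smooth_on_def using Ck_on.simps(1) by blast

lemma smooth_on_cong:
  "open S \<Longrightarrow> smooth_on S f \<Longrightarrow> (\<And>x. x \<in> S \<Longrightarrow> g x = f x) \<Longrightarrow> smooth_on S g"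
  unfolding smooth_on_def using Ck_on_cong by blast

lemma smooth_on_subset: "smooth_on S f \<Longrightarrow> T \<subseteq> S \<Longrightarrow> smooth_on T f"
  unfolding smooth_on_def using Ck_on_subset by blast

lemma smooth_on_const: "smooth_on S (\<lambda>x. c)"
  unfolding smooth_on_def by (simp add: Ck_on_const)

lemma smooth_on_id: "smooth_on S (\<lambda>x. x)"
  unfolding smooth_on_def by (simp add: Ck_on_id)

lemma smooth_on_add:
  "open S \<Longrightarrow> smooth_on S f \<Longrightarrow> smooth_on S g \<Longrightarrow> smooth_on S (\<lambda>x. f x + g x)"
  unfolding smooth_on_def by (simp add: Ck_on_add)

lemma smooth_on_bilinear:
  "bounded_bilinear b \<Longrightarrow> open S \<Longrightarrow> smooth_on S f \<Longrightarrow> smooth_on S g \<Longrightarrow> smooth_on S (\<lambda>x. b (f x) (g x))"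
  unfolding smooth_on_def by (simp add: Ck_on_bilinear)

lemmas smooth_on_mult = smooth_on_bilinear[OF bounded_bilinear_mult]
lemmas smooth_on_scaleR = smooth_on_bilinear[OF bounded_bilinear_scaleR]

lemma smooth_on_bounded_linear:
  "bounded_linear b \<Longrightarrow> open S \<Longrightarrow> smooth_on S f \<Longrightarrow> smooth_on S (\<lambda>x. b (f x))"
  unfolding smooth_on_def by (simp add: Ck_on_bounded_linear)

lemma smooth_on_linear: "bounded_linear b \<Longrightarrow> open S \<Longrightarrow> smooth_on S b"
  by (rule smooth_on_bounded_linear[OF _ _ smooth_on_id])

lemma smooth_on_sum:
  "open S \<Longrightarrow> (\<And>i. i \<in> I \<Longrightarrow> smooth_on S (f i)) \<Longrightarrow> smooth_on S (\<lambda>x. \<Sum>i\<in>I. f i x)"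
  unfolding smooth_on_def by (simp add: Ck_on_sum)

lemma smooth_on_minus: "open S \<Longrightarrow> smooth_on S f \<Longrightarrow> smooth_on S (\<lambda>x. - f x)"
  by (rule smooth_on_bounded_linear[OF bounded_linear_minus[OF bounded_linear_ident]])

lemma smooth_on_inverse:
  fixes f :: "'e::euclidean_space \<Rightarrow> real"
  shows "open S \<Longrightarrow> smooth_on S f \<Longrightarrow> (\<And>x. x \<in> S \<Longrightarrow> f x \<noteq> 0) \<Longrightarrow> smooth_on S (\<lambda>x. inverse (f x))"
  unfolding smooth_on_def by (simp add: Ck_on_inverse)

lemma smooth_on_compose:
  fixes f :: "'e::euclidean_space \<Rightarrow> 'd::euclidean_space"
  shows "open S \<Longrightarrow> open T \<Longrightarrow> f ` S \<subseteq> T \<Longrightarrow> smooth_on S f \<Longrightarrow> smooth_on T g \<Longrightarrow> smooth_on S (\<lambda>x. g (f x))"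
  unfolding smooth_on_def using Ck_on_compose by blast

lemma smooth_on_Pair:
  assumes "open S" "smooth_on S f" "smooth_on S g"
  shows "smooth_on S (\<lambda>x. (f x, g x))"
proof -
  have "bounded_linear (\<lambda>x. (x, 0))" "bounded_linear (\<lambda>x. (0, x))"
    by (auto intro!: bounded_linear_Pair bounded_linear_ident bounded_linear_zero)
  then have "smooth_on S (\<lambda>x. (f x, 0) + (0, g x))"
    using assms by (intro smooth_on_add smooth_on_bounded_linear[where b="\<lambda>x. (x, 0)"]
        smooth_on_bounded_linear[where b="\<lambda>x. (0, x)"])
  then show ?thesis by simp
qed

section \<open>Symmetry of second derivatives\<close>

lemma has_derivative_along_line:
  fixes f :: "'e::euclidean_space \<Rightarrow> real"
  assumes "(f has_derivative f') (at (w + s *\<^sub>R u))"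
  shows "((\<lambda>s. f (w + s *\<^sub>R u)) has_real_derivative f' u) (at s)"
proof -
  have "((\<lambda>s. w + s *\<^sub>R u) has_derivative (\<lambda>h. h *\<^sub>R u)) (at s)"
    using has_derivative_add[OF has_derivative_const[of w] has_derivative_scaleR_left[OF has_derivative_ident]]
    by simp
  from has_derivative_compose[OF this assms]
  show ?thesis
    by (rule has_derivative_imp_has_field_derivative)
       (simp add: linear_cmul[OF has_derivative_linear[OF assms]] mult.commute)
qed

text \<open>Both iterated derivatives are limits of the second difference quotient, by applying the mean
  value theorem in either order.\<close>

lemma second_difference_mvt:
  fixes f :: "'e::euclidean_space \<Rightarrow> real"
  assumes "smooth_on (ball x r) f" "0 < t" "t * (norm u + norm v) < r"
  shows "\<exists>a b. 0 < a \<and> a < t \<and> 0 < b \<and> b < t \<and>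
    f (x + t *\<^sub>R u + t *\<^sub>R v) - f (x + t *\<^sub>R u) - f (x + t *\<^sub>R v) + f x
     = t * t * frechet_derivative (\<lambda>z. frechet_derivative f (at z) u) (at (x + a *\<^sub>R u + b *\<^sub>R v)) v"
proof -
  have in_ball: "x + a *\<^sub>R u + b *\<^sub>R v \<in> ball x r" if "0 \<le> a" "a \<le> t" "0 \<le> b" "b \<le> t" for a b
  proof -
    have "norm (a *\<^sub>R u + b *\<^sub>R v) \<le> a * norm u + b * norm v"
      using that norm_triangle_ineq[of "a *\<^sub>R u" "b *\<^sub>R v"] by simp
    also have "\<dots> \<le> t * norm u + t * norm v" using that by (intro add_mono mult_right_mono) auto
    finally have "norm (a *\<^sub>R u + b *\<^sub>R v) < r" using assms(3) by (simp add: distrib_left)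
    moreover have "dist x (x + a *\<^sub>R u + b *\<^sub>R v) = norm (a *\<^sub>R u + b *\<^sub>R v)"
      by (metis add.assoc add_diff_cancel_left' dist_commute dist_norm)
    ultimately show ?thesis by simp
  qed
  let ?f' = "\<lambda>z. frechet_derivative f (at z)"
  \<comment> \<open>The increment in direction v as a function of the step s in direction u; its
    change from 0 to t is the second difference.\<close>
  let ?h = "\<lambda>s. f (x + t *\<^sub>R v + s *\<^sub>R u) - f (x + s *\<^sub>R u)"
  let ?h' = "\<lambda>s. ?f' (x + t *\<^sub>R v + s *\<^sub>R u) u - ?f' (x + s *\<^sub>R u) u"
  have "(?h has_real_derivative ?h' s) (at s)" if "0 \<le> s" "s \<le> t" for s
  proof (rule DERIV_diff)
    have "x + s *\<^sub>R u \<in> ball x r" using in_ball[of s 0] that assms(2) by simp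
    then show "((\<lambda>s. f (x + s *\<^sub>R u)) has_real_derivative ?f' (x + s *\<^sub>R u) u) (at s)"
      by (rule has_derivative_along_line[OF smooth_on_has_derivative[OF assms(1)]])
    have "x + t *\<^sub>R v + s *\<^sub>R u \<in> ball x r"
      using in_ball[of s t] that assms(2) by (simp only: add.assoc add.commute[of "s *\<^sub>R u"])
    then show "((\<lambda>s. f (x + t *\<^sub>R v + s *\<^sub>R u)) has_real_derivative ?f' (x + t *\<^sub>R v + s *\<^sub>R u) u) (at s)"
      by (rule has_derivative_along_line[OF smooth_on_has_derivative[OF assms(1)]])
  qed
  from MVT2[OF assms(2), of ?h ?h', OF this]
  obtain a where a: "0 < a" "a < t" "?h t - ?h 0 = (t - 0) * ?h' a" by blast
  let ?g = "\<lambda>z. ?f' z u" let ?g' = "\<lambda>z. frechet_derivative ?g (at z)"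
  let ?k = "\<lambda>s. ?g (x + a *\<^sub>R u + s *\<^sub>R v)"
  let ?k' = "\<lambda>s. ?g' (x + a *\<^sub>R u + s *\<^sub>R v) v"
  have "(?k has_real_derivative ?k' s) (at s)" if "0 \<le> s" "s \<le> t" for s
    by (rule has_derivative_along_line[OF smooth_on_has_derivative[OF smooth_on_deriv[OF assms(1)]]])
       (use in_ball[of a s] that a in auto)
  from MVT2[OF assms(2), of ?k ?k', OF this]
  obtain b where b: "0 < b" "b < t" "?k t - ?k 0 = (t - 0) * ?k' b" by blast
  have "f (x + t *\<^sub>R u + t *\<^sub>R v) - f (x + t *\<^sub>R u) - f (x + t *\<^sub>R v) + f x = ?h t - ?h 0"
    by (simp add: add.assoc add.commute[of "t *\<^sub>R u"])
  also have "\<dots> = t * (?k t - ?k 0)"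
    using a(3) by (simp add: add.assoc add.commute[of "a *\<^sub>R u"])
  also have "\<dots> = t * t * ?k' b" unfolding b(3) by simp
  finally show ?thesis using a b by blast
qed

lemma symmetric_second_derivative:
  fixes f :: "'e::euclidean_space \<Rightarrow> real"
  assumes "open S" "smooth_on S f" "x \<in> S"
  shows "frechet_derivative (\<lambda>z. frechet_derivative f (at z) u) (at x) v
       = frechet_derivative (\<lambda>z. frechet_derivative f (at z) v) (at x) u"
proof -
  let ?D = "\<lambda>u v z. frechet_derivative (\<lambda>z. frechet_derivative f (at z) u) (at z) v"
  obtain r where r: "0 < r" "ball x r \<subseteq> S" using assms openE by blast
  have sm: "smooth_on (ball x r) f" using assms(2) r(2) smooth_on_subset by blast
  have lim: "\<exists>w::nat \<Rightarrow> 'e. w \<longlonglongrightarrow> x \<and> (\<forall>n. t n * t n * ?D u v (w n) =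
       f (x + t n *\<^sub>R u + t n *\<^sub>R v) - f (x + t n *\<^sub>R u) - f (x + t n *\<^sub>R v) + f x)"
    if t: "\<And>n. 0 < t n" "\<And>n. t n * (norm u + norm v) < r" "t \<longlonglongrightarrow> 0" for t u v
  proof -
    have "\<exists>a b. \<forall>n. 0 < a n \<and> a n < t n \<and> 0 < b n \<and> b n < t n \<and>
      f (x + t n *\<^sub>R u + t n *\<^sub>R v) - f (x + t n *\<^sub>R u) - f (x + t n *\<^sub>R v) + f x
      = t n * t n * ?D u v (x + a n *\<^sub>R u + b n *\<^sub>R v)"
      using second_difference_mvt[OF sm t(1) t(2)] by metis
    then obtain a b where ab: "\<And>n. 0 < a n \<and> a n < t n \<and> 0 < b n \<and> b n < t n"
      "\<And>n. f (x + t n *\<^sub>R u + t n *\<^sub>R v) - f (x + t n *\<^sub>R u) - f (x + t n *\<^sub>R v) + f x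
      = t n * t n * ?D u v (x + a n *\<^sub>R u + b n *\<^sub>R v)" by blast
    have "a \<longlonglongrightarrow> 0" "b \<longlonglongrightarrow> 0"
      using ab(1) by (auto intro!: tendsto_sandwich[OF _ _ tendsto_const t(3)] always_eventually less_imp_le)
    then have "(\<lambda>n. x + a n *\<^sub>R u + b n *\<^sub>R v) \<longlonglongrightarrow> x + 0 *\<^sub>R u + 0 *\<^sub>R v"
      by (intro tendsto_intros)
    then show ?thesis using ab(2) by (intro exI[of _ "\<lambda>n. x + a n *\<^sub>R u + b n *\<^sub>R v"]) auto
  qed
  \<comment> \<open>Step sizes that serve both orders of differentiation. The 1 added in the
    denominator covers u = v = 0 and makes the bound by r strict.\<close>
  define t where "t n = r / (norm u + norm v + 1) * inverse (real (Suc n))" for n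
  have N: "0 < norm u + norm v + 1" by (simp add: add_nonneg_pos)
  have tpos: "0 < t n" for n unfolding t_def using r(1) N by simp
  have tr: "t n * (norm u + norm v) < r" for n
  proof -
    have "t n \<le> r / (norm u + norm v + 1) * 1"
      unfolding t_def using r(1) N by (intro mult_left_mono) (auto simp: inverse_le_1_iff)
    then have "t n * (norm u + norm v) \<le> r / (norm u + norm v + 1) * (norm u + norm v)"
      by (intro mult_right_mono) auto
    also have "\<dots> < r" using r(1) N by (simp add: field_simps)
    finally show ?thesis .
  qed
  have t0: "t \<longlonglongrightarrow> 0" unfolding t_def
    using tendsto_mult[OF tendsto_const[of "r / (norm u + norm v + 1)"] LIMSEQ_inverse_real_of_nat]
    by (simp del: of_nat_Suc)
  obtain w where w: "w \<longlonglongrightarrow> x" "\<And>n. t n * t n * ?D u v (w n) =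
       f (x + t n *\<^sub>R u + t n *\<^sub>R v) - f (x + t n *\<^sub>R u) - f (x + t n *\<^sub>R v) + f x"
    using lim[OF tpos tr t0] by blast
  have "t n * (norm v + norm u) < r" for n using tr by (simp add: add.commute)
  from lim[OF tpos this t0] obtain w' where w': "w' \<longlonglongrightarrow> x" "\<And>n. t n * t n * ?D v u (w' n) =
       f (x + t n *\<^sub>R v + t n *\<^sub>R u) - f (x + t n *\<^sub>R v) - f (x + t n *\<^sub>R u) + f x"
    by blast
  have "t n * t n * ?D u v (w n) = t n * t n * ?D v u (w' n)" for n
    unfolding w(2) w'(2) by (simp add: ac_simps)
  \<comment> \<open>The second difference is symmetric in u and v, so the two iterated derivatives
    take equal values, though at different intermediate points.\<close>
  then have eq: "?D u v (w n) = ?D v u (w' n)" for n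
    using tpos[of n] by (metis less_irrefl mult_left_cancel no_zero_divisors)
  have "isCont (?D u v) x" for u v
    using smooth_on_continuous[OF smooth_on_deriv[OF smooth_on_deriv[OF assms(2)]]] assms
    by (auto simp: continuous_on_eq_continuous_at)
  then have "(\<lambda>n. ?D u v (w n)) \<longlonglongrightarrow> ?D u v x" "(\<lambda>n. ?D v u (w' n)) \<longlonglongrightarrow> ?D v u x"
    using isCont_tendsto_compose[OF _ w(1)] isCont_tendsto_compose[OF _ w'(1)] by blast+
  then show ?thesis using eq LIMSEQ_unique by auto
qed

section \<open>Smooth atlases\<close>

abbreviation cinv :: "('a, 'e) chart \<Rightarrow> 'e \<Rightarrow> 'a" where
  "cinv c \<equiv> inv_into (fst c) (snd c)"

text \<open>Neighbourhoods are transported from coordinate space and not taken from the point type: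
  in the ambient topology of \<open>G_atlas\<close>, points off the group would count as well. The
  chart chosen is immaterial by \<open>nbhds_eq\<close>.\<close>

definition nbhds :: "('a, 'e::euclidean_space) atlas \<Rightarrow> 'a \<Rightarrow> 'a filter" where
  "nbhds \<A> p = (let c = SOME c. c \<in> \<A> \<and> p \<in> fst c in filtermap (cinv c) (nhds (snd c p)))"

text \<open>Compatible charts without a topology on the point type; this covers alike the
  space-time, the group inside its ambient space, and their product.\<close>

locale smooth_atlas =
  fixes \<A> :: "('a, 'e::euclidean_space) atlas"
  assumes inj_chart: "c \<in> \<A> \<Longrightarrow> inj_on (snd c) (fst c)"
    and open_chart_inter: "c \<in> \<A> \<Longrightarrow> d \<in> \<A> \<Longrightarrow> open (snd c ` (fst c \<inter> fst d))"
    and smooth_transition: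
      "c \<in> \<A> \<Longrightarrow> d \<in> \<A> \<Longrightarrow> smooth_on (snd c ` (fst c \<inter> fst d)) (snd d \<circ> cinv c)"
begin

section \<open>Germs and smoothness in charts\<close>

lemma open_chart: "c \<in> \<A> \<Longrightarrow> open (snd c ` fst c)"
  using open_chart_inter[of c c] by simp

lemma cinv_chart [simp]: "c \<in> \<A> \<Longrightarrow> p \<in> fst c \<Longrightarrow> cinv c (snd c p) = p"
  by (simp add: inj_chart)

lemma points_chart: "c \<in> \<A> \<Longrightarrow> p \<in> fst c \<Longrightarrow> p \<in> points \<A>"
  by (auto simp: points_def)

lemma chartE:
  assumes "p \<in> points \<A>"
  obtains c where "c \<in> \<A>" "p \<in> fst c"
  using assms by (auto simp: points_def)

lemma eventually_chart_image:
  "c \<in> \<A> \<Longrightarrow> p \<in> fst c \<Longrightarrow> \<forall>\<^sub>F z in nhds (snd c p). z \<in> snd c ` fst c"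
  using open_chart[of c] eventually_nhds_in_open[of "snd c ` fst c" "snd c p"] by simp

text \<open>This is continuity of the transition map at p. With the two charts exchanged it gives
  the equality behind \<open>nbhds_eq\<close>.\<close>

lemma filtermap_chart_le:
  assumes "c \<in> \<A>" "p \<in> fst c" "d \<in> \<A>" "p \<in> fst d"
  shows "filtermap (cinv c) (nhds (snd c p)) \<le> filtermap (cinv d) (nhds (snd d p))"
proof -
  let ?S = "snd c ` (fst c \<inter> fst d)" and ?\<tau> = "snd d \<circ> cinv c"
  have S: "open ?S" "snd c p \<in> ?S" using assms open_chart_inter by auto
  have "isCont ?\<tau> (snd c p)"
    using smooth_on_continuous[OF smooth_transition[OF assms(1,3)]] S(2)
    unfolding continuous_on_eq_continuous_at[OF S(1)] by blast
  then have "filterlim ?\<tau> (nhds (?\<tau> (snd c p))) (nhds (snd c p))"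
    using tendsto_at_iff_tendsto_nhds[of ?\<tau>] by (simp add: isCont_def)
  then have lim: "filtermap ?\<tau> (nhds (snd c p)) \<le> nhds (snd d p)"
    using assms by (simp add: filterlim_def)
  have "\<forall>\<^sub>F z in nhds (snd c p). z \<in> ?S"
    using S by (auto simp: eventually_nhds)
  then have "\<forall>\<^sub>F z in nhds (snd c p). cinv c z = cinv d (?\<tau> z)"
    by eventually_elim (use assms in auto)
  then have "filtermap (cinv c) (nhds (snd c p)) = filtermap (cinv d) (filtermap ?\<tau> (nhds (snd c p)))"
    by (auto simp: filter_eq_iff eventually_filtermap intro!: eventually_subst elim: eventually_mono)
  also have "\<dots> \<le> filtermap (cinv d) (nhds (snd d p))"
    by (rule filtermap_mono[OF lim])
  finally show ?thesis .
qed

lemma nbhds_eq: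
  assumes "c \<in> \<A>" "p \<in> fst c"
  shows "nbhds \<A> p = filtermap (cinv c) (nhds (snd c p))"
proof -
  define d where "d = (SOME c. c \<in> \<A> \<and> p \<in> fst c)"
  have d: "d \<in> \<A> \<and> p \<in> fst d" unfolding d_def by (rule someI[of _ c]) (use assms in auto)
  show ?thesis
    unfolding nbhds_def Let_def d_def[symmetric]
    by (intro antisym filtermap_chart_le) (use d assms in auto)
qed

lemma eventually_nbhds:
  "c \<in> \<A> \<Longrightarrow> p \<in> fst c \<Longrightarrow> eventually P (nbhds \<A> p) \<longleftrightarrow> (\<forall>\<^sub>F z in nhds (snd c p). P (cinv c z))"
  by (simp add: nbhds_eq eventually_filtermap)

lemma eventually_in_chart:
  assumes "c \<in> \<A>" "p \<in> fst c" shows "\<forall>\<^sub>F q in nbhds \<A> p. q \<in> fst c"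
  using eventually_chart_image[OF assms] assms
  by (auto simp: eventually_nbhds elim!: eventually_mono)

lemma eventually_in_points:
  assumes "p \<in> points \<A>" shows "\<forall>\<^sub>F q in nbhds \<A> p. q \<in> points \<A>"
proof -
  obtain c where c: "c \<in> \<A>" "p \<in> fst c" using assms chartE by blast
  from eventually_in_chart[OF this] show ?thesis
    by eventually_elim (use c points_chart in blast)
qed

lemma eventually_nbhds_open:
  assumes "c \<in> \<A>" "p \<in> fst c" "open W" "snd c p \<in> W"
  shows "\<forall>\<^sub>F q in nbhds \<A> p. q \<in> fst c \<and> snd c q \<in> W"
proof -
  have "\<forall>\<^sub>F z in nhds (snd c p). z \<in> W" using assms by (auto simp: eventually_nhds)
  with eventually_chart_image[OF assms(1,2)]
  have "\<forall>\<^sub>F z in nhds (snd c p). cinv c z \<in> fst c \<and> snd c (cinv c z) \<in> W"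
    by eventually_elim (auto simp: f_inv_into_f inv_into_into)
  then show ?thesis using assms by (simp add: eventually_nbhds)
qed

text \<open>\<open>smooth_at\<close> only provides some chart; composition with the smooth
  transition map moves the test to any chart at p.\<close>

lemma smooth_at_chart:
  assumes "c \<in> \<A>" "p \<in> fst c"
  shows "smooth_at \<A> p f \<longleftrightarrow>
    (\<exists>W. open W \<and> snd c p \<in> W \<and> W \<subseteq> snd c ` fst c \<and> smooth_on W (f \<circ> cinv c))"
proof
  assume "smooth_at \<A> p f"
  then obtain d W where d: "d \<in> \<A>" "p \<in> fst d" and W: "open W" "snd d p \<in> W"
    "W \<subseteq> snd d ` fst d" "smooth_on W (f \<circ> cinv d)"
    unfolding smooth_at_def by force
  let ?S = "snd c ` (fst c \<inter> fst d)" and ?\<tau> = "snd d \<circ> cinv c"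
  have S: "open ?S" "snd c p \<in> ?S" using assms d open_chart_inter by auto
  have st: "smooth_on ?S ?\<tau>" by (rule smooth_transition[OF assms(1) d(1)])
  let ?W = "?S \<inter> ?\<tau> -` W"
  have oW: "open ?W"
    using continuous_open_preimage[OF smooth_on_continuous[OF st] S(1) W(1)] .
  have "smooth_on ?W (\<lambda>z. (f \<circ> cinv d) (?\<tau> z))"
    by (rule smooth_on_compose[OF oW W(1) _ _ W(4)]) (auto intro: smooth_on_subset[OF st, unfolded o_def])
  then have "smooth_on ?W (f \<circ> cinv c)"
    by (rule smooth_on_cong[OF oW]) (use assms d in auto)
  moreover have "snd c p \<in> ?W" using S assms W by simp
  ultimately show "\<exists>W. open W \<and> snd c p \<in> W \<and> W \<subseteq> snd c ` fst c \<and> smooth_on W (f \<circ> cinv c)"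
    using oW by blast
next
  assume "\<exists>W. open W \<and> snd c p \<in> W \<and> W \<subseteq> snd c ` fst c \<and> smooth_on W (f \<circ> cinv c)"
  then show "smooth_at \<A> p f" unfolding smooth_at_def using assms by (cases c) auto
qed

lemma smooth_at_chartE:
  assumes "smooth_at \<A> p f" "c \<in> \<A>" "p \<in> fst c"
  obtains W where "open W" "snd c p \<in> W" "W \<subseteq> snd c ` fst c" "smooth_on W (f \<circ> cinv c)"
  using assms smooth_at_chart by blast

lemma smooth_at_points: "smooth_at \<A> p f \<Longrightarrow> p \<in> points \<A>"
  unfolding smooth_at_def points_def by fastforce

lemma smooth_at_chartI:
  assumes "c \<in> \<A>" "p \<in> fst c" "open W" "snd c p \<in> W" "smooth_on W g"
    "\<forall>\<^sub>F q in nbhds \<A> p. f q = g (snd c q)"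
  shows "smooth_at \<A> p f"
proof -
  obtain S where S: "open S" "snd c p \<in> S" "\<And>z. z \<in> S \<Longrightarrow> f (cinv c z) = g (snd c (cinv c z))"
    using assms(6) unfolding eventually_nbhds[OF assms(1,2)] eventually_nhds by blast
  let ?W = "W \<inter> S \<inter> snd c ` fst c"
  have oW: "open ?W" using S assms open_chart by auto
  have "smooth_on ?W (f \<circ> cinv c)"
    by (rule smooth_on_cong[OF oW smooth_on_subset[OF assms(5)]]) (auto simp: S(3) f_inv_into_f)
  then show ?thesis
    unfolding smooth_at_chart[OF assms(1,2)] using oW S assms by (intro exI[of _ ?W]) auto
qed

lemma smooth_at_cong_imp:
  assumes "smooth_at \<A> p f" "\<forall>\<^sub>F q in nbhds \<A> p. g q = f q"
  shows "smooth_at \<A> p g"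
proof -
  obtain c where c: "c \<in> \<A>" "p \<in> fst c" using assms(1) smooth_at_points chartE by blast
  obtain W where W: "open W" "snd c p \<in> W" "smooth_on W (f \<circ> cinv c)"
    using smooth_at_chartE[OF assms(1) c] by metis
  show ?thesis
    by (rule smooth_at_chartI[OF c W])
       (use eventually_conj[OF assms(2) eventually_in_chart[OF c]] c in \<open>auto elim!: eventually_mono\<close>)
qed

lemma smooth_at_cong:
  assumes "\<forall>\<^sub>F q in nbhds \<A> p. f q = g q"
  shows "smooth_at \<A> p f \<longleftrightarrow> smooth_at \<A> p g"
proof -
  have "\<forall>\<^sub>F q in nbhds \<A> p. g q = f q" using assms by eventually_elim simp
  then show ?thesis using assms smooth_at_cong_imp by blast
qed

text \<open>The guards \<open>smooth_at\<close> in \<open>coord_vec\<close> and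
  \<open>lie_bracket\<close> are evaluated at variable points, so differentiating such expressions
  requires the guard to hold on a whole neighbourhood.\<close>

lemma eventually_smooth_at:
  assumes "smooth_at \<A> p f" shows "\<forall>\<^sub>F q in nbhds \<A> p. smooth_at \<A> q f"
proof -
  obtain c where c: "c \<in> \<A>" "p \<in> fst c" using assms(1) smooth_at_points chartE by blast
  obtain W where W: "open W" "snd c p \<in> W" "W \<subseteq> snd c ` fst c" "smooth_on W (f \<circ> cinv c)"
    using smooth_at_chartE[OF assms(1) c] .
  from eventually_nbhds_open[OF c W(1,2)] show ?thesis
    by eventually_elim (use smooth_at_chart[OF c(1)] W in blast)
qed

lemma smooth_at_const: "p \<in> points \<A> \<Longrightarrow> smooth_at \<A> p (\<lambda>q. k)"
  by (erule chartE) (rule smooth_at_chartI[OF _ _ open_UNIV UNIV_I smooth_on_const[of _ k]], auto)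

lemma smooth_at_binary:
  assumes "smooth_at \<A> p f" "smooth_at \<A> p g"
    and *: "\<And>(W::'e set) F G. open W \<Longrightarrow> smooth_on W F \<Longrightarrow> smooth_on W G \<Longrightarrow> smooth_on W (\<lambda>z. h (F z) (G z))"
  shows "smooth_at \<A> p (\<lambda>q. h (f q) (g q))"
proof -
  obtain c where c: "c \<in> \<A>" "p \<in> fst c" using assms(1) smooth_at_points chartE by blast
  obtain W where W: "open W" "snd c p \<in> W" "smooth_on W (f \<circ> cinv c)"
    using smooth_at_chartE[OF assms(1) c] by metis
  obtain W' where W': "open W'" "snd c p \<in> W'" "smooth_on W' (g \<circ> cinv c)"
    using smooth_at_chartE[OF assms(2) c] by metis
  have "smooth_on (W \<inter> W') (\<lambda>z. h ((f \<circ> cinv c) z) ((g \<circ> cinv c) z))"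
    by (rule *[of "W \<inter> W'" "f \<circ> cinv c" "g \<circ> cinv c"])
       (use W W' in \<open>auto intro: smooth_on_subset[OF W(3)] smooth_on_subset[OF W'(3)]\<close>)
  then show ?thesis
    by (intro smooth_at_chartI[OF c, of "W \<inter> W'" "\<lambda>z. h ((f \<circ> cinv c) z) ((g \<circ> cinv c) z)"])
       (use W W' c eventually_in_chart[OF c] in \<open>auto elim!: eventually_mono\<close>)
qed

lemma smooth_at_add: "smooth_at \<A> p f \<Longrightarrow> smooth_at \<A> p g \<Longrightarrow> smooth_at \<A> p (\<lambda>q. f q + g q)"
  by (rule smooth_at_binary[of p f g "(+)"]) (auto intro: smooth_on_add)

lemma smooth_at_mult:
  fixes f g :: "'a \<Rightarrow> real"
  shows "smooth_at \<A> p f \<Longrightarrow> smooth_at \<A> p g \<Longrightarrow> smooth_at \<A> p (\<lambda>q. f q * g q)"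
  by (rule smooth_at_binary[of p f g "(*)"]) (auto intro: smooth_on_mult)

lemma smooth_at_bounded_linear:
  "bounded_linear b \<Longrightarrow> smooth_at \<A> p f \<Longrightarrow> smooth_at \<A> p (\<lambda>q. b (f q))"
  by (rule smooth_at_binary[of p f f "\<lambda>x y. b x"]) (auto intro: smooth_on_bounded_linear)

lemma smooth_at_cmult:
  fixes f :: "'a \<Rightarrow> real"
  shows "smooth_at \<A> p f \<Longrightarrow> smooth_at \<A> p (\<lambda>q. k * f q)"
  using smooth_at_bounded_linear[OF bounded_linear_mult_right] .

lemma smooth_at_minus:
  fixes f :: "'a \<Rightarrow> real"
  shows "smooth_at \<A> p f \<Longrightarrow> smooth_at \<A> p (\<lambda>q. - f q)"
  using smooth_at_bounded_linear[OF bounded_linear_minus[OF bounded_linear_ident]] .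

lemma smooth_at_diff:
  fixes f g :: "'a \<Rightarrow> real"
  shows "smooth_at \<A> p f \<Longrightarrow> smooth_at \<A> p g \<Longrightarrow> smooth_at \<A> p (\<lambda>q. f q - g q)"
  using smooth_at_add[OF _ smooth_at_minus, of p f g] by simp

lemma smooth_at_sum:
  assumes "p \<in> points \<A>" "\<And>i. i \<in> I \<Longrightarrow> smooth_at \<A> p (f i)"
  shows "smooth_at \<A> p (\<lambda>q. \<Sum>i\<in>I. f i q)"
  using assms
  by (induction I rule: infinite_finite_induct) (auto simp: smooth_at_const intro!: smooth_at_add)

lemma smooth_at_has_derivative:
  assumes "smooth_at \<A> p f" "c \<in> \<A>" "p \<in> fst c"
  shows "((f \<circ> cinv c) has_derivative frechet_derivative (f \<circ> cinv c) (at (snd c p))) (at (snd c p))"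
  using smooth_at_chartE[OF assms] smooth_on_has_derivative by metis

section \<open>Coordinate vectors and tangent spaces\<close>

lemma coord_vec_smooth:
  "smooth_at \<A> p f \<Longrightarrow> coord_vec \<A> c p u f = frechet_derivative (f \<circ> cinv c) (at (snd c p)) u"
  by (simp add: coord_vec_def)

lemma coord_vec_eqI:
  assumes "smooth_at \<A> p f" "((f \<circ> cinv c) has_derivative F') (at (snd c p))"
  shows "coord_vec \<A> c p u f = F' u"
  using frechet_derivative_at[OF assms(2)] assms(1) by (simp add: coord_vec_smooth)

lemma coord_vec_linear:
  assumes "c \<in> \<A>" "p \<in> fst c" shows "linear (\<lambda>u. coord_vec \<A> c p u f)"
proof (cases "smooth_at \<A> p f")
  case True
  then show ?thesis
    using has_derivative_linear[OF smooth_at_has_derivative[OF True assms]]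
    by (simp add: coord_vec_smooth)
qed (simp add: coord_vec_def linear_zero)

lemma coord_vec_tangent: "c \<in> \<A> \<Longrightarrow> p \<in> fst c \<Longrightarrow> coord_vec \<A> c p u \<in> tangent_space \<A> p"
  unfolding tangent_space_def by blast

text \<open>The chain rule for the transition map. It allows every tangent vector to be written in
  one prescribed chart, which is how tangent spaces are seen to be linear.\<close>

lemma coord_vec_change:
  assumes "c \<in> \<A>" "p \<in> fst c" "d \<in> \<A>" "p \<in> fst d"
  shows "coord_vec \<A> d p u = coord_vec \<A> c p (frechet_derivative (snd c \<circ> cinv d) (at (snd d p)) u)"
proof
  fix f
  let ?\<tau> = "snd c \<circ> cinv d"
  show "coord_vec \<A> d p u f = coord_vec \<A> c p (frechet_derivative ?\<tau> (at (snd d p)) u) f"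
  proof (cases "smooth_at \<A> p f")
    case True
    let ?S = "snd d ` (fst d \<inter> fst c)"
    have S: "open ?S" "snd d p \<in> ?S" using assms open_chart_inter by auto
    have "(?\<tau> has_derivative frechet_derivative ?\<tau> (at (snd d p))) (at (snd d p))"
      by (rule smooth_on_has_derivative[OF smooth_transition[OF assms(3,1)] S(2)])
    moreover have "((f \<circ> cinv c) has_derivative frechet_derivative (f \<circ> cinv c) (at (snd c p)))
        (at (?\<tau> (snd d p)))"
      using smooth_at_has_derivative[OF True assms(1,2)] assms by simp
    ultimately have "((\<lambda>z. (f \<circ> cinv c) (?\<tau> z)) has_derivative
        (\<lambda>u. frechet_derivative (f \<circ> cinv c) (at (snd c p)) (frechet_derivative ?\<tau> (at (snd d p)) u)))
        (at (snd d p))"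
      by (rule has_derivative_compose)
    then have "((f \<circ> cinv d) has_derivative
        (\<lambda>u. frechet_derivative (f \<circ> cinv c) (at (snd c p)) (frechet_derivative ?\<tau> (at (snd d p)) u)))
        (at (snd d p))"
      by (rule has_derivative_transform_within_open[OF _ S]) (use assms in auto)
    from coord_vec_eqI[OF True this] True show ?thesis by (simp add: coord_vec_smooth)
  qed (simp add: coord_vec_def)
qed

lemma tangent_chartE:
  assumes "D \<in> tangent_space \<A> p" "c \<in> \<A>" "p \<in> fst c"
  obtains u where "D = coord_vec \<A> c p u"
  using assms coord_vec_change unfolding tangent_space_def by blast

lemma tangent_points: "D \<in> tangent_space \<A> p \<Longrightarrow> p \<in> points \<A>"
  unfolding tangent_space_def points_def by fastforce

lemma tangentE:
  assumes "D \<in> tangent_space \<A> p"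
  obtains c u where "c \<in> \<A>" "p \<in> fst c" "D = coord_vec \<A> c p u"
  using assms unfolding tangent_space_def by auto

lemma tangent_lincomb:
  assumes "D \<in> tangent_space \<A> p" "E \<in> tangent_space \<A> p"
  shows "(\<lambda>f. r * D f + E f) \<in> tangent_space \<A> p"
proof -
  obtain c u where c: "c \<in> \<A>" "p \<in> fst c" and u: "D = coord_vec \<A> c p u"
    using assms(1) by (rule tangentE)
  obtain v where v: "E = coord_vec \<A> c p v" using tangent_chartE[OF assms(2) c] .
  have "(\<lambda>f. r * D f + E f) = coord_vec \<A> c p (r *\<^sub>R u + v)"
    unfolding u v by (rule ext) (simp add: linear_add[OF coord_vec_linear[OF c]] linear_cmul[OF coord_vec_linear[OF c]])
  then show ?thesis using coord_vec_tangent[OF c] by metis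
qed

lemma tangent_zero: "p \<in> points \<A> \<Longrightarrow> (\<lambda>f. 0) \<in> tangent_space \<A> p"
proof (erule chartE)
  fix c assume c: "c \<in> \<A>" "p \<in> fst c"
  have "(\<lambda>f. 0) = coord_vec \<A> c p 0"
    by (rule ext) (simp add: linear_0[OF coord_vec_linear[OF c]])
  then show ?thesis using coord_vec_tangent[OF c] by metis
qed

lemma tangent_sum:
  assumes "p \<in> points \<A>" "\<And>i. i \<in> I \<Longrightarrow> D i \<in> tangent_space \<A> p"
  shows "(\<lambda>f. \<Sum>i\<in>I. r i * D i f) \<in> tangent_space \<A> p"
  using assms by (induction I rule: infinite_finite_induct) (auto simp: tangent_zero tangent_lincomb)

lemma tangent_diff:
  assumes "D \<in> tangent_space \<A> p" "E \<in> tangent_space \<A> p"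
  shows "(\<lambda>f. D f - E f) \<in> tangent_space \<A> p"
  using tangent_lincomb[OF assms(2,1), of "-1"] by (simp add: algebra_simps)

lemma tangent_nonsmooth: "D \<in> tangent_space \<A> p \<Longrightarrow> \<not> smooth_at \<A> p f \<Longrightarrow> D f = 0"
  by (auto simp: tangent_space_def coord_vec_def)

text \<open>Locality extends to the convention for non-smooth arguments: f and g are smooth at p
  together, and otherwise both values are 0.\<close>

lemma tangent_cong:
  assumes "D \<in> tangent_space \<A> p" "\<forall>\<^sub>F q in nbhds \<A> p. f q = g q"
  shows "D f = D g"
proof -
  obtain c u where c: "c \<in> \<A>" "p \<in> fst c" and u: "D = coord_vec \<A> c p u"
    using assms(1) by (rule tangentE)
  show ?thesis
  proof (cases "smooth_at \<A> p f")
    case True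
    obtain S where S: "open S" "snd c p \<in> S" "\<And>z. z \<in> S \<Longrightarrow> (f \<circ> cinv c) z = (g \<circ> cinv c) z"
      using assms(2) unfolding eventually_nbhds[OF c] eventually_nhds o_def by blast
    have "((g \<circ> cinv c) has_derivative frechet_derivative (f \<circ> cinv c) (at (snd c p))) (at (snd c p))"
      by (rule has_derivative_transform_within_open[OF smooth_at_has_derivative[OF True c] S(1,2) S(3)])
    then show ?thesis
      using coord_vec_eqI[of p g c] True smooth_at_cong[OF assms(2)] by (simp add: u coord_vec_smooth)
  next
    case False
    then show ?thesis using smooth_at_cong[OF assms(2)] by (simp add: u coord_vec_def)
  qed
qed

lemma tangent_const: "D \<in> tangent_space \<A> p \<Longrightarrow> D (\<lambda>q. k) = 0"
  by (erule tangentE) (simp add: coord_vec_def o_def frechet_derivative_const)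

lemma tangent_add:
  assumes "D \<in> tangent_space \<A> p" "smooth_at \<A> p f" "smooth_at \<A> p g"
  shows "D (\<lambda>q. f q + g q) = D f + D g"
proof -
  obtain c u where c: "c \<in> \<A>" "p \<in> fst c" and u: "D = coord_vec \<A> c p u"
    using assms(1) by (rule tangentE)
  show ?thesis
    unfolding u coord_vec_smooth[OF assms(2)] coord_vec_smooth[OF assms(3)]
    by (rule coord_vec_eqI[OF smooth_at_add[OF assms(2,3)]])
       (use has_derivative_add[OF smooth_at_has_derivative[OF assms(2) c] smooth_at_has_derivative[OF assms(3) c]]
         in \<open>simp add: o_def\<close>)
qed

lemma tangent_mult:
  assumes "D \<in> tangent_space \<A> p" "smooth_at \<A> p f" "smooth_at \<A> p g"
  shows "D (\<lambda>q. f q * g q) = f p * D g + D f * g p"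
proof -
  obtain c u where c: "c \<in> \<A>" "p \<in> fst c" and u: "D = coord_vec \<A> c p u"
    using assms(1) by (rule tangentE)
  show ?thesis
    unfolding u coord_vec_smooth[OF assms(2)] coord_vec_smooth[OF assms(3)]
    by (rule coord_vec_eqI[OF smooth_at_mult[OF assms(2,3)]])
       (use has_derivative_mult[OF smooth_at_has_derivative[OF assms(2) c] smooth_at_has_derivative[OF assms(3) c]] c
         in \<open>simp add: o_def\<close>)
qed

lemma tangent_cmult:
  assumes "D \<in> tangent_space \<A> p" "smooth_at \<A> p f"
  shows "D (\<lambda>q. k * f q) = k * D f"
  using tangent_mult[OF assms(1) smooth_at_const[OF tangent_points[OF assms(1)], of k] assms(2)]
    tangent_const[OF assms(1)] by simp

lemma tangent_minus:
  assumes "D \<in> tangent_space \<A> p" "smooth_at \<A> p f"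
  shows "D (\<lambda>q. - f q) = - D f"
  using tangent_cmult[OF assms, of "-1"] by simp

lemma tangent_fun_diff:
  assumes "D \<in> tangent_space \<A> p" "smooth_at \<A> p f" "smooth_at \<A> p g"
  shows "D (\<lambda>q. f q - g q) = D f - D g"
  using tangent_add[OF assms(1,2) smooth_at_minus[OF assms(3)]] tangent_minus[OF assms(1,3)] by simp

lemma tangent_fun_sum:
  assumes "D \<in> tangent_space \<A> p" "\<And>i. i \<in> I \<Longrightarrow> smooth_at \<A> p (f i)"
  shows "D (\<lambda>q. \<Sum>i\<in>I. f i q) = (\<Sum>i\<in>I. D (f i))"
  using assms(2)
proof (induction I rule: infinite_finite_induct)
  case (insert i I)
  then show ?case
    using tangent_add[OF assms(1), of "f i" "\<lambda>q. \<Sum>i\<in>I. f i q"] smooth_at_sum[OF tangent_points[OF assms(1)], of I f]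
    by simp
qed (simp_all add: tangent_const[OF assms(1)])

section \<open>Coordinate functions as tests for tangent vectors\<close>

lemma smooth_at_coordinate:
  assumes "c \<in> \<A>" "p \<in> fst c" shows "smooth_at \<A> p (\<lambda>q. snd c q \<bullet> b)"
  by (rule smooth_at_chartI[OF assms open_UNIV UNIV_I smooth_on_linear[OF bounded_linear_inner_left[of b] open_UNIV]])
     simp

lemma coord_vec_coordinate:
  assumes "c \<in> \<A>" "p \<in> fst c" shows "coord_vec \<A> c p u (\<lambda>q. snd c q \<bullet> b) = u \<bullet> b"
proof (rule coord_vec_eqI[OF smooth_at_coordinate[OF assms]])
  have "((\<lambda>z. z \<bullet> b) has_derivative (\<lambda>u. u \<bullet> b)) (at (snd c p))"
    by (intro bounded_linear_imp_has_derivative bounded_linear_inner_left)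
  then show "((\<lambda>q. snd c q \<bullet> b) \<circ> cinv c has_derivative (\<lambda>u. u \<bullet> b)) (at (snd c p))"
    by (rule has_derivative_transform_within_open[OF _ open_chart[OF assms(1)]])
       (use assms in \<open>auto simp: f_inv_into_f\<close>)
qed

text \<open>A vector \<open>coord_vec \<A> c p u\<close> sends the coordinate function of b to u
  \<bullet> b, so its values on coordinate functions recover u.\<close>

lemma tangent_expand:
  assumes "D \<in> tangent_space \<A> p" "c \<in> \<A>" "p \<in> fst c"
  shows "D = coord_vec \<A> c p (\<Sum>b\<in>Basis. D (\<lambda>q. snd c q \<bullet> b) *\<^sub>R b)"
    and "D f = (\<Sum>b\<in>Basis. D (\<lambda>q. snd c q \<bullet> b) * coord_vec \<A> c p b f)"
proof -
  obtain u where u: "D = coord_vec \<A> c p u" using tangent_chartE[OF assms] .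
  show "D = coord_vec \<A> c p (\<Sum>b\<in>Basis. D (\<lambda>q. snd c q \<bullet> b) *\<^sub>R b)"
    unfolding u coord_vec_coordinate[OF assms(2,3)] by (simp add: euclidean_representation)
  then have "D f = coord_vec \<A> c p (\<Sum>b\<in>Basis. D (\<lambda>q. snd c q \<bullet> b) *\<^sub>R b) f"
    by (rule fun_cong)
  also have "\<dots> = (\<Sum>b\<in>Basis. D (\<lambda>q. snd c q \<bullet> b) * coord_vec \<A> c p b f)"
    by (simp add: linear_sum[OF coord_vec_linear[OF assms(2,3)]] linear_cmul[OF coord_vec_linear[OF assms(2,3)]])
  finally show "D f = (\<Sum>b\<in>Basis. D (\<lambda>q. snd c q \<bullet> b) * coord_vec \<A> c p b f)" .
qed

lemma smooth_at_coord_vec: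
  assumes "c \<in> \<A>" "p \<in> fst c" "smooth_at \<A> p f"
  shows "smooth_at \<A> p (\<lambda>q. coord_vec \<A> c q u f)"
proof -
  obtain W where W: "open W" "snd c p \<in> W" "smooth_on W (f \<circ> cinv c)"
    using smooth_at_chartE[OF assms(3,1,2)] by metis
  show ?thesis
    by (rule smooth_at_chartI[OF assms(1,2) W(1,2) smooth_on_deriv[OF W(3), of u]])
       (use eventually_smooth_at[OF assms(3)] in \<open>auto simp: coord_vec_smooth elim!: eventually_mono\<close>)
qed

text \<open>Symmetry of second derivatives carried to the manifold, after the guard of the inner
  \<open>coord_vec\<close> has been discharged on an open set around the image of p.\<close>

lemma coord_vec_commute:
  assumes "c \<in> \<A>" "p \<in> fst c" "smooth_at \<A> p f"
  shows "coord_vec \<A> c p v (\<lambda>q. coord_vec \<A> c q u f) = coord_vec \<A> c p u (\<lambda>q. coord_vec \<A> c q v f)"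
proof -
  obtain W where W: "open W" "snd c p \<in> W" "smooth_on W (f \<circ> cinv c)"
    using smooth_at_chartE[OF assms(3,1,2)] by metis
  have 1: "coord_vec \<A> c p v (\<lambda>q. coord_vec \<A> c q u f) =
     frechet_derivative (\<lambda>z. frechet_derivative (f \<circ> cinv c) (at z) u) (at (snd c p)) v" for u v
  proof (rule coord_vec_eqI[OF smooth_at_coord_vec[OF assms]])
    have "\<forall>\<^sub>F z in nhds (snd c p). z \<in> snd c ` fst c \<and> smooth_at \<A> (cinv c z) f"
      using eventually_smooth_at[OF assms(3)] eventually_chart_image[OF assms(1,2)]
      by (simp add: eventually_nbhds[OF assms(1,2)] eventually_conj)
    then obtain S where S: "open S" "snd c p \<in> S"
      "\<And>z. z \<in> S \<Longrightarrow> z \<in> snd c ` fst c \<and> smooth_at \<A> (cinv c z) f"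
      unfolding eventually_nhds by blast
    show "((\<lambda>q. coord_vec \<A> c q u f) \<circ> cinv c has_derivative
      frechet_derivative (\<lambda>z. frechet_derivative (f \<circ> cinv c) (at z) u) (at (snd c p))) (at (snd c p))"
      by (rule has_derivative_transform_within_open[OF
            smooth_on_has_derivative[OF smooth_on_deriv[OF W(3)] W(2)] S(1,2)])
         (use S(3) in \<open>auto simp: coord_vec_smooth f_inv_into_f\<close>)
  qed
  show ?thesis unfolding 1 by (rule symmetric_second_derivative[OF W(1,3,2)])
qed

section \<open>Vector fields, one-forms and brackets\<close>

lemma vector_field_tangent: "vector_field \<A> V \<Longrightarrow> p \<in> points \<A> \<Longrightarrow> V p \<in> tangent_space \<A> p"
  unfolding vector_field_def by blast

lemma vector_field_smooth: "vector_field \<A> V \<Longrightarrow> smooth_at \<A> p f \<Longrightarrow> smooth_at \<A> p (\<lambda>q. V q f)"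
  unfolding vector_field_def using smooth_at_points by blast

text \<open>By \<open>tangent_expand\<close>, V f is near p the sum of V(x^b) times the coordinate
  derivatives of f, so smooth components suffice.\<close>

lemma vector_fieldI:
  assumes t: "\<And>p. p \<in> points \<A> \<Longrightarrow> V p \<in> tangent_space \<A> p"
    and s: "\<And>p c b. c \<in> \<A> \<Longrightarrow> p \<in> fst c \<Longrightarrow> smooth_at \<A> p (\<lambda>q. V q (\<lambda>x. snd c x \<bullet> b))"
  shows "vector_field \<A> V"
  unfolding vector_field_def
proof (intro ballI conjI allI impI t)
  fix p and f :: "'a \<Rightarrow> real" assume p: "p \<in> points \<A>" and f: "smooth_at \<A> p f"
  obtain c where c: "c \<in> \<A>" "p \<in> fst c" using p chartE by blast
  have "smooth_at \<A> p (\<lambda>q. \<Sum>b\<in>Basis. V q (\<lambda>x. snd c x \<bullet> b) * coord_vec \<A> c q b f)"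
    using p c f s smooth_at_coord_vec by (intro smooth_at_sum smooth_at_mult) auto
  moreover have "\<forall>\<^sub>F q in nbhds \<A> p. V q f = (\<Sum>b\<in>Basis. V q (\<lambda>x. snd c x \<bullet> b) * coord_vec \<A> c q b f)"
    using eventually_in_chart[OF c]
    by eventually_elim (use t c points_chart tangent_expand(2) in blast)
  ultimately show "smooth_at \<A> p (\<lambda>q. V q f)" by (rule smooth_at_cong_imp)
qed

lemma vector_field_sum:
  assumes "\<And>i. i \<in> I \<Longrightarrow> vector_field \<A> (V i)" "\<And>i. i \<in> I \<Longrightarrow> smooth_fun \<A> (s i)"
  shows "vector_field \<A> (\<lambda>p f. \<Sum>i\<in>I. s i p * V i p f)"
  unfolding vector_field_def
proof (intro ballI conjI allI impI)
  fix p assume p: "p \<in> points \<A>"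
  show "(\<lambda>f. \<Sum>i\<in>I. s i p * V i p f) \<in> tangent_space \<A> p"
    using assms(1) vector_field_tangent p by (intro tangent_sum) auto
  fix f :: "'a \<Rightarrow> real" assume f: "smooth_at \<A> p f"
  show "smooth_at \<A> p (\<lambda>q. \<Sum>i\<in>I. s i q * V i q f)"
    using assms(2) p unfolding smooth_fun_def
    by (intro smooth_at_sum smooth_at_mult vector_field_smooth[OF assms(1) f]) auto
qed

lemma one_form_lincomb:
  assumes "one_form \<A> \<theta>" "D \<in> tangent_space \<A> p" "E \<in> tangent_space \<A> p"
  shows "\<theta> p (\<lambda>f. r * D f + E f) = r * \<theta> p D + \<theta> p E"
  using assms tangent_points[OF assms(2)] unfolding one_form_def by blast

lemma one_form_zero:
  assumes "one_form \<A> \<theta>" "p \<in> points \<A>" shows "\<theta> p (\<lambda>f. 0) = 0"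
  using one_form_lincomb[OF assms(1) tangent_zero[OF assms(2)] tangent_zero[OF assms(2)], of 1] by simp

lemma one_form_diff:
  assumes "one_form \<A> \<theta>" "D \<in> tangent_space \<A> p" "E \<in> tangent_space \<A> p"
  shows "\<theta> p (\<lambda>f. D f - E f) = \<theta> p D - \<theta> p E"
  using one_form_lincomb[OF assms(1,3,2), of "-1"] by (simp add: algebra_simps)

lemma one_form_sum:
  assumes "one_form \<A> \<theta>" "p \<in> points \<A>" "\<And>i. i \<in> I \<Longrightarrow> D i \<in> tangent_space \<A> p"
  shows "\<theta> p (\<lambda>f. \<Sum>i\<in>I. r i * D i f) = (\<Sum>i\<in>I. r i * \<theta> p (D i))"
  using assms(3)
  by (induction I rule: infinite_finite_induct)
     (auto simp: one_form_zero[OF assms(1,2)] one_form_lincomb[OF assms(1)] tangent_sum[OF assms(2)])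

lemma one_form_expand:
  assumes "one_form \<A> \<theta>" "c \<in> \<A>" "p \<in> fst c" "D \<in> tangent_space \<A> p"
  shows "\<theta> p D = (\<Sum>b\<in>Basis. D (\<lambda>q. snd c q \<bullet> b) * \<theta> p (coord_vec \<A> c p b))"
proof -
  have "D = (\<lambda>f. \<Sum>b\<in>Basis. D (\<lambda>q. snd c q \<bullet> b) * coord_vec \<A> c p b f)"
    using tangent_expand(2)[OF assms(4,2,3)] by blast
  then have "\<theta> p D = \<theta> p (\<lambda>f. \<Sum>b\<in>Basis. D (\<lambda>q. snd c q \<bullet> b) * coord_vec \<A> c p b f)"
    by (rule arg_cong)
  also have "\<dots> = (\<Sum>b\<in>Basis. D (\<lambda>q. snd c q \<bullet> b) * \<theta> p (coord_vec \<A> c p b))"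
    using coord_vec_tangent assms points_chart by (intro one_form_sum) auto
  finally show ?thesis .
qed

lemma smooth_at_one_form:
  assumes "one_form \<A> \<theta>" "vector_field \<A> V" "p \<in> points \<A>"
  shows "smooth_at \<A> p (\<lambda>q. \<theta> q (V q))"
proof -
  obtain c where c: "c \<in> \<A>" "p \<in> fst c" using assms(3) chartE by blast
  have "smooth_at \<A> p (\<lambda>q. \<Sum>b\<in>Basis. V q (\<lambda>x. snd c x \<bullet> b) * \<theta> q (coord_vec \<A> c q b))"
    using assms(1,3) c unfolding one_form_def
    by (intro smooth_at_sum smooth_at_mult vector_field_smooth[OF assms(2) smooth_at_coordinate]) auto
  moreover have "\<forall>\<^sub>F q in nbhds \<A> p. \<theta> q (V q) = (\<Sum>b\<in>Basis. V q (\<lambda>x. snd c x \<bullet> b) * \<theta> q (coord_vec \<A> c q b))"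
    using eventually_in_chart[OF c]
    by eventually_elim (use one_form_expand assms(1,2) c vector_field_tangent points_chart in blast)
  ultimately show ?thesis by (rule smooth_at_cong_imp)
qed

text \<open>A priori the bracket is an operator of second order. Its second-order part cancels
  because coordinate vectors commute; what remains is a coordinate vector, so the bracket is
  tangent.\<close>

lemma lie_bracket_coord:
  assumes V: "vector_field \<A> V" and W: "vector_field \<A> W" and c: "c \<in> \<A>" "p \<in> fst c"
  shows "lie_bracket \<A> V W p = coord_vec \<A> c p
    (\<Sum>b\<in>Basis. (V p (\<lambda>q. W q (\<lambda>x. snd c x \<bullet> b)) - W p (\<lambda>q. V q (\<lambda>x. snd c x \<bullet> b))) *\<^sub>R b)"
proof
  fix f
  have p: "p \<in> points \<A>" using c points_chart by blast
  let ?x = "\<lambda>b q. snd c q \<bullet> b" and ?d = "\<lambda>b q. coord_vec \<A> c q b f"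
  show "lie_bracket \<A> V W p f = coord_vec \<A> c p
    (\<Sum>b\<in>Basis. (V p (\<lambda>q. W q (?x b)) - W p (\<lambda>q. V q (?x b))) *\<^sub>R b) f"
  proof (cases "smooth_at \<A> p f")
    case True
    have s: "smooth_at \<A> p (?d b)" "smooth_at \<A> p (?x b)" for b
      using smooth_at_coord_vec[OF c True] smooth_at_coordinate[OF c] by auto
    \<comment> \<open>Expanding W f in coordinates before V is applied separates the second
      derivatives of f, in the first sum, from the derivatives of the components of W, in the
      second.\<close>
    have second: "V p (\<lambda>q. W q f) = (\<Sum>b\<in>Basis. W p (?x b) * (\<Sum>a\<in>Basis. V p (?x a) *
        coord_vec \<A> c p a (?d b))) + (\<Sum>b\<in>Basis. V p (\<lambda>q. W q (?x b)) * ?d b p)"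
      if V: "vector_field \<A> V" and W: "vector_field \<A> W" for V W
    proof -
      have Vp: "V p \<in> tangent_space \<A> p" using V p vector_field_tangent by blast
      have "\<forall>\<^sub>F q in nbhds \<A> p. W q f = (\<Sum>b\<in>Basis. W q (?x b) * ?d b q)"
        using eventually_in_chart[OF c]
        by eventually_elim (use tangent_expand(2) W c vector_field_tangent points_chart in blast)
      then have "V p (\<lambda>q. W q f) = V p (\<lambda>q. \<Sum>b\<in>Basis. W q (?x b) * ?d b q)"
        by (rule tangent_cong[OF Vp])
      also have "\<dots> = (\<Sum>b\<in>Basis. V p (\<lambda>q. W q (?x b) * ?d b q))"
        by (rule tangent_fun_sum[OF Vp smooth_at_mult[OF vector_field_smooth[OF W s(2)] s(1)]])
      also have "\<dots> = (\<Sum>b\<in>Basis. W p (?x b) * V p (?d b) + V p (\<lambda>q. W q (?x b)) * ?d b p)"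
        by (rule sum.cong[OF refl tangent_mult[OF Vp vector_field_smooth[OF W s(2)] s(1)]])
      finally have 1: "V p (\<lambda>q. W q f) =
        (\<Sum>b\<in>Basis. W p (?x b) * V p (?d b) + V p (\<lambda>q. W q (?x b)) * ?d b p)" .
      have "V p (?d b) = (\<Sum>a\<in>Basis. V p (?x a) * coord_vec \<A> c p a (?d b))" for b
        by (rule tangent_expand(2)[OF Vp c])
      then show ?thesis unfolding 1 sum.distrib by (simp only:)
    qed
    have "(\<Sum>b\<in>Basis. W p (?x b) * (\<Sum>a\<in>Basis. V p (?x a) * coord_vec \<A> c p a (?d b)))
        = (\<Sum>b\<in>Basis. \<Sum>a\<in>Basis. W p (?x b) * (V p (?x a) * coord_vec \<A> c p b (?d a)))"
      unfolding sum_distrib_left by (intro sum.cong refl) (simp only: coord_vec_commute[OF c True])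
    also have "\<dots> = (\<Sum>a\<in>Basis. V p (?x a) * (\<Sum>b\<in>Basis. W p (?x b) * coord_vec \<A> c p b (?d a)))"
      by (subst sum.swap) (simp add: sum_distrib_left mult.left_commute)
    finally have "V p (\<lambda>q. W q f) - W p (\<lambda>q. V q f) =
      (\<Sum>b\<in>Basis. (V p (\<lambda>q. W q (?x b)) - W p (\<lambda>q. V q (?x b))) * ?d b p)"
      unfolding second[OF V W] second[OF W V] by (simp add: sum_subtractf left_diff_distrib)
    then show ?thesis
      using True by (simp add: lie_bracket_def linear_sum[OF coord_vec_linear[OF c]] linear_cmul[OF coord_vec_linear[OF c]])
  qed (simp add: lie_bracket_def coord_vec_def)
qed

lemma vector_field_lie_bracket:
  assumes V: "vector_field \<A> V" and W: "vector_field \<A> W"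
  shows "vector_field \<A> (lie_bracket \<A> V W)"
proof (rule vector_fieldI)
  fix p assume "p \<in> points \<A>"
  then obtain c where c: "c \<in> \<A>" "p \<in> fst c" using chartE by blast
  show "lie_bracket \<A> V W p \<in> tangent_space \<A> p"
    unfolding lie_bracket_coord[OF V W c] by (rule coord_vec_tangent[OF c])
next
  fix p c b assume c: "c \<in> \<A>" "p \<in> fst c"
  let ?x = "\<lambda>x. snd c x \<bullet> b"
  have "smooth_at \<A> p (\<lambda>q. V q (\<lambda>x. W x ?x) - W q (\<lambda>x. V x ?x))"
    by (intro smooth_at_diff vector_field_smooth[OF V vector_field_smooth[OF W]]
          vector_field_smooth[OF W vector_field_smooth[OF V]] smooth_at_coordinate[OF c])
  moreover have "\<forall>\<^sub>F q in nbhds \<A> p. lie_bracket \<A> V W q ?x = V q (\<lambda>x. W x ?x) - W q (\<lambda>x. V x ?x)"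
    using eventually_smooth_at[OF smooth_at_coordinate[OF c, of b]]
    by eventually_elim (simp add: lie_bracket_def)
  ultimately show "smooth_at \<A> p (\<lambda>q. lie_bracket \<A> V W q ?x)" by (rule smooth_at_cong_imp)
qed

lemma vector_field_add_scale:
  assumes "vector_field \<A> V" "vector_field \<A> W" "smooth_fun \<A> s"
  shows "vector_field \<A> (\<lambda>p f. V p f + s p * W p f)"
proof -
  have "smooth_fun \<A> (\<lambda>p. 1 :: real)" unfolding smooth_fun_def using smooth_at_const by blast
  then have "vector_field \<A> (\<lambda>p f. \<Sum>i\<in>{True, False}. (if i then \<lambda>p. 1 else s) p * (if i then V else W) p f)"
    using assms by (intro vector_field_sum) auto
  then show ?thesis by simp
qed

lemma one_form_add_scale:
  assumes "one_form \<A> \<theta>" "one_form \<A> \<eta>" "smooth_fun \<A> s"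
  shows "one_form \<A> (\<lambda>p D. \<theta> p D + s p * \<eta> p D)"
  unfolding one_form_def
proof (intro ballI conjI allI impI)
  fix p D E r assume D: "D \<in> tangent_space \<A> p" and E: "E \<in> tangent_space \<A> p"
  show "\<theta> p (\<lambda>f. r * D f + E f) + s p * \<eta> p (\<lambda>f. r * D f + E f)
     = r * (\<theta> p D + s p * \<eta> p D) + (\<theta> p E + s p * \<eta> p E)"
    unfolding one_form_lincomb[OF assms(1) D E] one_form_lincomb[OF assms(2) D E] by (simp add: algebra_simps)
next
  fix p c u assume "p \<in> points \<A>" "c \<in> \<A>" "p \<in> fst c"
  then show "smooth_at \<A> p (\<lambda>q. \<theta> q (coord_vec \<A> c q u) + s q * \<eta> q (coord_vec \<A> c q u))"
    using assms unfolding one_form_def smooth_fun_def by (intro smooth_at_add smooth_at_mult) auto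
qed

lemma cderiv_add:
  assumes "D \<in> tangent_space \<A> p" "smooth_at \<A> p (\<lambda>q. Re (f q))" "smooth_at \<A> p (\<lambda>q. Im (f q))"
    "smooth_at \<A> p (\<lambda>q. Re (g q))" "smooth_at \<A> p (\<lambda>q. Im (g q))"
  shows "cderiv D (\<lambda>q. f q + g q) = cderiv D f + cderiv D g"
  using tangent_add[OF assms(1,2,4)] tangent_add[OF assms(1,3,5)] by (simp add: cderiv_def complex_eq_iff)

text \<open>Duality makes the vectors e_i independent, and there are as many as the dimension, so
  they span. D is then a combination of them whose coefficients are the values \<theta>_i(D), all 0.
  This provides separation for the tetrad of the group.\<close>

lemma dual_separating:
  fixes e :: "'n::finite \<Rightarrow> 'a vfield" and \<theta> :: "'n \<Rightarrow> 'a oneform"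
  assumes e: "\<And>i. e i p \<in> tangent_space \<A> p" and \<theta>: "\<And>i. one_form \<A> (\<theta> i)"
    and dual: "\<And>i j. \<theta> i p (e j p) = (if i = j then 1 else 0)"
    and dim: "DIM('e) = CARD('n)"
    and D: "D \<in> tangent_space \<A> p" and zero: "\<And>i. \<theta> i p D = 0"
  shows "D = (\<lambda>f. 0)"
proof -
  obtain c w where c: "c \<in> \<A>" "p \<in> fst c" and w: "D = coord_vec \<A> c p w"
    using D by (rule tangentE)
  have "\<exists>u. e i p = coord_vec \<A> c p u" for i
    using tangent_chartE[OF e c] by metis
  then obtain u where u: "\<And>i. e i p = coord_vec \<A> c p (u i)" by metis
  have cv: "coord_vec \<A> c p v = (\<lambda>f. \<Sum>i\<in>I. r i * coord_vec \<A> c p (u i) f)"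
    if "v = (\<Sum>i\<in>I. r i *\<^sub>R u i)" for v r I
    using that by (simp add: fun_eq_iff linear_sum[OF coord_vec_linear[OF c]] linear_cmul[OF coord_vec_linear[OF c]])
  have \<theta>_sum: "\<theta> j p (coord_vec \<A> c p (\<Sum>i\<in>UNIV. r i *\<^sub>R u i)) = r j" for j r
  proof -
    have "\<theta> j p (coord_vec \<A> c p (\<Sum>i\<in>UNIV. r i *\<^sub>R u i)) = (\<Sum>i\<in>UNIV. r i * \<theta> j p (e i p))"
      unfolding cv[OF refl] u[symmetric] by (rule one_form_sum[OF \<theta> points_chart[OF c] e])
    then show ?thesis by (simp add: dual mult_delta_right)
  qed
  have coord_0: "coord_vec \<A> c p 0 = (\<lambda>f. 0)"
    by (rule ext) (rule linear_0[OF coord_vec_linear[OF c]])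
  have inj: "inj u"
  proof (rule injI, rule ccontr)
    fix i j assume "u i = u j" "i \<noteq> j"
    then have "\<theta> i p (e i p) = \<theta> i p (e j p)" by (simp add: u)
    then show False using \<open>i \<noteq> j\<close> by (simp add: dual)
  qed
  have "independent (range u)"
  proof (rule independent_if_scalars_zero)
    fix f x assume *: "(\<Sum>x\<in>range u. f x *\<^sub>R x) = 0" and "x \<in> range u"
    then obtain j where x: "x = u j" by blast
    have "(\<Sum>i\<in>UNIV. f (u i) *\<^sub>R u i) = 0" using * by (simp add: sum.reindex[OF inj])
    then have "f (u j) = \<theta> j p (coord_vec \<A> c p 0)" using \<theta>_sum[of j "\<lambda>i. f (u i)"] by simp
    also have "\<dots> = 0"
      using one_form_zero[OF \<theta> points_chart[OF c], of j] by (simp add: coord_0)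
    finally show "f x = 0" by (simp add: x)
  qed simp
  moreover have "card (range u) = DIM('e)" using card_image[OF inj] dim by simp
  ultimately have "span (range u) = UNIV"
    using card_eq_dim[of "range u" UNIV] by auto
  then have "w \<in> span (u ` UNIV)" by simp
  then obtain r where r: "w = (\<Sum>i\<in>UNIV. r i *\<^sub>R u i)"
  proof -
    assume *: "\<And>r. w = (\<Sum>i\<in>UNIV. r i *\<^sub>R u i) \<Longrightarrow> thesis"
    obtain f where "w = (\<Sum>x\<in>range u. f x *\<^sub>R x)"
      using \<open>w \<in> span (u ` UNIV)\<close> span_finite[of "range u"] by auto
    then have "w = (\<Sum>i\<in>UNIV. f (u i) *\<^sub>R u i)" by (simp add: sum.reindex[OF inj])
    then show thesis by (rule *)
  qed
  have "r i = 0" for i using \<theta>_sum[of i r] zero[of i] unfolding w r by simp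
  then have "w = 0" using r by simp
  then show ?thesis unfolding w by (simp add: coord_0)
qed

end

text \<open>An overlap is relatively open in the chart domain; the homeomorphism carries it to a
  relatively open subset of an open image, hence to an open set.\<close>

lemma smooth_atlas_smooth_manifold:
  assumes "smooth_manifold \<A>" shows "smooth_atlas \<A>"
proof -
  have hom: "openin (top_of_set (points \<A>)) (fst c)" "open (snd c ` fst c)"
      "homeomorphism (fst c) (snd c ` fst c) (snd c) (cinv c)"
    and trans: "\<And>d. d \<in> \<A> \<Longrightarrow> smooth_on (snd c ` (fst c \<inter> fst d)) (snd d \<circ> cinv c)"
    if "c \<in> \<A>" for c
    using assms that unfolding smooth_manifold_def by fastforce+
  show ?thesis
  proof
    fix c assume c: "c \<in> \<A>"
    show "inj_on (snd c) (fst c)"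
      using homeomorphism_apply1[OF hom(3)[OF c]] by (rule inj_on_inverseI)
    fix d assume d: "d \<in> \<A>"
    show "smooth_on (snd c ` (fst c \<inter> fst d)) (snd d \<circ> cinv c)" by (rule trans[OF c d])
    have "openin (top_of_set (points \<A>)) (fst c \<inter> fst d)"
      using hom(1)[OF c] hom(1)[OF d] by blast
    then have "openin (top_of_set (fst c)) (fst c \<inter> fst d)"
      by (rule openin_subset_trans) (use c in \<open>auto simp: points_def\<close>)
    then have "openin (top_of_set (snd c ` fst c)) (snd c ` (fst c \<inter> fst d))"
      using homeomorphism_imp_open_map[OF hom(3)[OF c]] by blast
    then show "open (snd c ` (fst c \<inter> fst d))"
      using hom(2)[OF c] openin_open_trans by blast
  qed
qed

section \<open>The Levi-Civita connection in a frame\<close>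

lemma is_levi_civitaD:
  assumes "is_levi_civita \<A> h conn" "vector_field \<A> V" "vector_field \<A> W"
  shows "vector_field \<A> (conn V W)"
    and "p \<in> points \<A> \<Longrightarrow> conn V W p f - conn W V p f = lie_bracket \<A> V W p f"
    and "vector_field \<A> Z \<Longrightarrow> p \<in> points \<A> \<Longrightarrow>
      V p (\<lambda>q. h q (W q) (Z q)) = h p (conn V W p) (Z p) + h p (W p) (conn V Z p)"
proof -
  note lc = assms(1)[unfolded is_levi_civita_def]
  show "vector_field \<A> (conn V W)"
    using lc[THEN conjunct1] assms(2,3) by simp
  show "conn V W p f - conn W V p f = lie_bracket \<A> V W p f" if "p \<in> points \<A>"
    using lc[THEN conjunct2, THEN conjunct2, THEN conjunct2, THEN conjunct1] assms(2,3) that by simp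
  show "V p (\<lambda>q. h q (W q) (Z q)) = h p (conn V W p) (Z p) + h p (W p) (conn V Z p)"
    if "vector_field \<A> Z" "p \<in> points \<A>"
    using lc[THEN conjunct2, THEN conjunct2, THEN conjunct2, THEN conjunct2] assms(2,3) that by simp
qed

text \<open>Used three times: for the tetrads of X and of G, and for the eight fields on M, indexed
  by \<open>4 + 4\<close>. The signs \<open>\<epsilon>\<close> are the constant diagonal entries of
  the metric and, being their own reciprocals, also those of its inverse.\<close>

locale frame = smooth_atlas \<A>
  for \<A> :: "('a, 'e::euclidean_space) atlas" +
  fixes e :: "'i::finite \<Rightarrow> 'a vfield" and \<theta> :: "'i \<Rightarrow> 'a oneform"
    and \<epsilon> :: "'i \<Rightarrow> real" and h :: "'a metric_field"
  assumes frame_field: "vector_field \<A> (e i)"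
    and coframe_form: "one_form \<A> (\<theta> i)"
    and dual: "p \<in> points \<A> \<Longrightarrow> \<theta> i p (e j p) = (if i = j then 1 else 0)"
    and separating: "D \<in> tangent_space \<A> p \<Longrightarrow> (\<And>i. \<theta> i p D = 0) \<Longrightarrow> D = (\<lambda>f. 0)"
    and sign_square: "\<epsilon> i * \<epsilon> i = 1"
    and metric: "h p D E = (\<Sum>i\<in>UNIV. \<epsilon> i * (\<theta> i p D * \<theta> i p E))"
begin

lemma frame_tangent: "p \<in> points \<A> \<Longrightarrow> e i p \<in> tangent_space \<A> p"
  by (rule vector_field_tangent[OF frame_field])

lemma coframe_sum:
  assumes "p \<in> points \<A>" shows "\<theta> k p (\<lambda>f. \<Sum>i\<in>UNIV. r i * e i p f) = r k"
  using one_form_sum[where \<theta>="\<theta> k" and D="\<lambda>i. e i p" and I=UNIV and r=r,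
      OF coframe_form assms frame_tangent[OF assms]] dual[OF assms]
  by (simp add: mult_delta_right)

lemma coframe_eqI:
  assumes "D \<in> tangent_space \<A> p" "E \<in> tangent_space \<A> p" "\<And>i. \<theta> i p D = \<theta> i p E"
  shows "D = E"
proof -
  have "(\<lambda>f. D f - E f) = (\<lambda>f. 0)"
    by (rule separating[OF tangent_diff[OF assms(1,2)]]) (simp add: one_form_diff[OF coframe_form assms(1,2)] assms(3))
  then show ?thesis by (metis ext eq_iff_diff_eq_0)
qed

lemma frame_expand:
  assumes "D \<in> tangent_space \<A> p" shows "D f = (\<Sum>i\<in>UNIV. \<theta> i p D * e i p f)"
proof -
  have p: "p \<in> points \<A>" using assms tangent_points by blast
  have "D = (\<lambda>f. \<Sum>i\<in>UNIV. \<theta> i p D * e i p f)"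
    by (intro coframe_eqI[OF assms] tangent_sum frame_tangent p) (simp add: coframe_sum[OF p])
  then show ?thesis by (rule fun_cong)
qed

section \<open>Structure functions and connection coefficients\<close>

definition C :: "'i \<Rightarrow> 'i \<Rightarrow> 'i \<Rightarrow> 'a \<Rightarrow> real" where
  "C i j k p = \<theta> k p (lie_bracket \<A> (e i) (e j) p)"

text \<open>The Koszul formula: in a frame with constant inner products only the three bracket terms survive.\<close>

definition \<Gamma> :: "'i \<Rightarrow> 'i \<Rightarrow> 'i \<Rightarrow> 'a \<Rightarrow> real" where
  "\<Gamma> i j k p = (C i j k p - \<epsilon> k * \<epsilon> j * C i k j p - \<epsilon> k * \<epsilon> i * C j k i p) / 2"

lemma bracket_tangent: "p \<in> points \<A> \<Longrightarrow> lie_bracket \<A> (e i) (e j) p \<in> tangent_space \<A> p"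
  by (rule vector_field_tangent[OF vector_field_lie_bracket[OF frame_field frame_field]])

lemma C_antisym:
  assumes p: "p \<in> points \<A>" shows "C j i k p = - C i j k p"
proof -
  have "lie_bracket \<A> (e j) (e i) p = (\<lambda>f. (-1) * lie_bracket \<A> (e i) (e j) p f + 0)"
    by (rule ext) (simp add: lie_bracket_def)
  then have "C j i k p = \<theta> k p (\<lambda>f. (-1) * lie_bracket \<A> (e i) (e j) p f + 0)"
    unfolding C_def by (rule arg_cong)
  then show ?thesis
    using one_form_lincomb[OF coframe_form bracket_tangent[OF p] tangent_zero[OF p], of k "-1" i j]
      one_form_zero[OF coframe_form p] by (simp add: C_def)
qed

lemma smooth_at_C: "p \<in> points \<A> \<Longrightarrow> smooth_at \<A> p (C i j k)"
  unfolding C_def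
  by (rule smooth_at_one_form[OF coframe_form vector_field_lie_bracket[OF frame_field frame_field]])

lemma smooth_at_\<Gamma>: "p \<in> points \<A> \<Longrightarrow> smooth_at \<A> p (\<Gamma> i j k)"
  unfolding \<Gamma>_def
  by (intro smooth_at_bounded_linear[OF bounded_linear_divide] smooth_at_diff smooth_at_cmult smooth_at_C)

lemma \<Gamma>_torsion: "p \<in> points \<A> \<Longrightarrow> \<Gamma> i j k p - \<Gamma> j i k p = C i j k p"
  using C_antisym[of p i j k] by (simp add: \<Gamma>_def field_simps)

text \<open>With the last index lowered, twice \<open>\<Gamma>\<close> is C_ijk - C_ikj - C_jki.
  Exchanging j and k swaps the first two terms with a sign, and antisymmetry of \<open>C\<close>
  reverses the third.\<close>

lemma \<Gamma>_metric:
  assumes p: "p \<in> points \<A>" shows "\<epsilon> k * \<Gamma> i j k p = - (\<epsilon> j * \<Gamma> i k j p)"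
proof -
  have sq: "\<epsilon> k * (\<epsilon> k * x) = x" for k x by (simp add: mult.assoc[symmetric] sign_square)
  have "2 * (\<epsilon> k * \<Gamma> i j k p) = \<epsilon> k * C i j k p - \<epsilon> j * C i k j p - \<epsilon> i * C j k i p" for i j k
    by (simp add: \<Gamma>_def right_diff_distrib mult.assoc sq)
  from this[of k i j] this[of j i k] show ?thesis using C_antisym[OF p, of k j i] by simp
qed

text \<open>Frame fields, unlike coordinate fields, need not commute: after the Leibniz rule the
  antisymmetrised second derivatives of f do not cancel but leave exactly the terms with
  \<open>C\<close>.\<close>

lemma lie_bracket_frame:
  assumes V: "vector_field \<A> V" and W: "vector_field \<A> W" and p: "p \<in> points \<A>"
  shows "\<theta> k p (lie_bracket \<A> V W p) = V p (\<lambda>q. \<theta> k q (W q)) - W p (\<lambda>q. \<theta> k q (V q))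
    + (\<Sum>i\<in>UNIV. \<Sum>j\<in>UNIV. \<theta> i p (V p) * \<theta> j p (W p) * C i j k p)"
proof -
  have t: "V p \<in> tangent_space \<A> p" if "vector_field \<A> V" for V
    using vector_field_tangent[OF that p] .
  let ?B = "\<lambda>k. V p (\<lambda>q. \<theta> k q (W q)) - W p (\<lambda>q. \<theta> k q (V q))
    + (\<Sum>i\<in>UNIV. \<Sum>j\<in>UNIV. \<theta> i p (V p) * \<theta> j p (W p) * C i j k p)"
  have "lie_bracket \<A> V W p f = (\<Sum>k\<in>UNIV. ?B k * e k p f)" for f
  proof (cases "smooth_at \<A> p f")
    case True
    have second: "V p (\<lambda>q. W q f) = (\<Sum>k\<in>UNIV. V p (\<lambda>q. \<theta> k q (W q)) * e k p f)
        + (\<Sum>i\<in>UNIV. \<Sum>j\<in>UNIV. \<theta> i p (V p) * \<theta> j p (W p) * e i p (\<lambda>q. e j q f))"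
      if V: "vector_field \<A> V" and W: "vector_field \<A> W" for V W
    proof -
      have "\<forall>\<^sub>F q in nbhds \<A> p. W q f = (\<Sum>k\<in>UNIV. \<theta> k q (W q) * e k q f)"
        using eventually_in_points[OF p]
        by eventually_elim (rule frame_expand[OF vector_field_tangent[OF W]])
      then have "V p (\<lambda>q. W q f) = V p (\<lambda>q. \<Sum>k\<in>UNIV. \<theta> k q (W q) * e k q f)"
        by (rule tangent_cong[OF t[OF V]])
      also have "\<dots> = (\<Sum>k\<in>UNIV. V p (\<lambda>q. \<theta> k q (W q) * e k q f))"
        by (rule tangent_fun_sum[OF t[OF V] smooth_at_mult[OF
              smooth_at_one_form[OF coframe_form W p] vector_field_smooth[OF frame_field True]]])
      also have "\<dots> = (\<Sum>k\<in>UNIV. \<theta> k p (W p) * V p (\<lambda>q. e k q f) + V p (\<lambda>q. \<theta> k q (W q)) * e k p f)"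
        by (rule sum.cong[OF refl tangent_mult[OF t[OF V]
              smooth_at_one_form[OF coframe_form W p] vector_field_smooth[OF frame_field True]]])
      also have "\<dots> = (\<Sum>j\<in>UNIV. \<theta> j p (W p) * (\<Sum>i\<in>UNIV. \<theta> i p (V p) * e i p (\<lambda>q. e j q f)))
          + (\<Sum>k\<in>UNIV. V p (\<lambda>q. \<theta> k q (W q)) * e k p f)"
        unfolding sum.distrib by (subst frame_expand[OF t[OF V]]) (rule refl)
      also have "(\<Sum>j\<in>UNIV. \<theta> j p (W p) * (\<Sum>i\<in>UNIV. \<theta> i p (V p) * e i p (\<lambda>q. e j q f))) =
         (\<Sum>i\<in>UNIV. \<Sum>j\<in>UNIV. \<theta> i p (V p) * \<theta> j p (W p) * e i p (\<lambda>q. e j q f))"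
        unfolding sum_distrib_left by (subst sum.swap) (simp only: ac_simps)
      finally show ?thesis by simp
    qed
    have "e i p (\<lambda>q. e j q f) - e j p (\<lambda>q. e i q f) = (\<Sum>k\<in>UNIV. C i j k p * e k p f)" for i j
      using frame_expand[OF bracket_tangent[OF p], of i j f] True by (simp add: C_def lie_bracket_def)
    then have br: "e i p (\<lambda>q. e j q f) = e j p (\<lambda>q. e i q f) + (\<Sum>k\<in>UNIV. C i j k p * e k p f)" for i j
      by (metis add.commute diff_add_cancel)
    have "(\<Sum>i\<in>UNIV. \<Sum>j\<in>UNIV. \<theta> i p (V p) * \<theta> j p (W p) * e i p (\<lambda>q. e j q f))
      = (\<Sum>i\<in>UNIV. \<Sum>j\<in>UNIV. \<theta> i p (V p) * \<theta> j p (W p) * e j p (\<lambda>q. e i q f)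
          + (\<Sum>k\<in>UNIV. \<theta> i p (V p) * \<theta> j p (W p) * C i j k p * e k p f))"
      by (intro sum.cong refl) (subst br, simp only: distrib_left sum_distrib_left mult.assoc)
    also have "\<dots> = (\<Sum>i\<in>UNIV. \<Sum>j\<in>UNIV. \<theta> i p (V p) * \<theta> j p (W p) * e j p (\<lambda>q. e i q f))
          + (\<Sum>i\<in>UNIV. \<Sum>j\<in>UNIV. \<Sum>k\<in>UNIV. \<theta> i p (V p) * \<theta> j p (W p) * C i j k p * e k p f)"
      by (simp only: sum.distrib)
    also have "(\<Sum>i\<in>UNIV. \<Sum>j\<in>UNIV. \<theta> i p (V p) * \<theta> j p (W p) * e j p (\<lambda>q. e i q f)) =
       (\<Sum>i\<in>UNIV. \<Sum>j\<in>UNIV. \<theta> i p (W p) * \<theta> j p (V p) * e i p (\<lambda>q. e j q f))"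
      by (subst sum.swap) (simp only: ac_simps)
    also have "(\<Sum>i\<in>UNIV. \<Sum>j\<in>UNIV. \<Sum>k\<in>UNIV. \<theta> i p (V p) * \<theta> j p (W p) * C i j k p * e k p f)
      = (\<Sum>k\<in>UNIV. (\<Sum>i\<in>UNIV. \<Sum>j\<in>UNIV. \<theta> i p (V p) * \<theta> j p (W p) * C i j k p) * e k p f)"
    proof -
      have "(\<Sum>i\<in>UNIV. \<Sum>j\<in>UNIV. \<Sum>k\<in>UNIV. F i j k) = (\<Sum>k\<in>UNIV. \<Sum>i\<in>UNIV. \<Sum>j\<in>UNIV. F i j k)"
        for F :: "'i \<Rightarrow> 'i \<Rightarrow> 'i \<Rightarrow> real"
      proof -
        have "(\<Sum>i\<in>UNIV. \<Sum>j\<in>UNIV. \<Sum>k\<in>UNIV. F i j k) = (\<Sum>i\<in>UNIV. \<Sum>k\<in>UNIV. \<Sum>j\<in>UNIV. F i j k)"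
          by (rule sum.cong[OF refl sum.swap])
        also have "\<dots> = (\<Sum>k\<in>UNIV. \<Sum>i\<in>UNIV. \<Sum>j\<in>UNIV. F i j k)" by (rule sum.swap)
        finally show ?thesis .
      qed
      then show ?thesis by (simp only: sum_distrib_right)
    qed
    finally show ?thesis
      using True unfolding lie_bracket_def
      by (simp add: second[OF V W] second[OF W V] distrib_right left_diff_distrib sum.distrib sum_subtractf)
  next
    case False
    then show ?thesis
      using tangent_nonsmooth[OF frame_tangent[OF p] False] by (simp add: lie_bracket_def)
  qed
  then have "lie_bracket \<A> V W p = (\<lambda>f. \<Sum>k\<in>UNIV. ?B k * e k p f)" by (rule ext)
  then show ?thesis using coframe_sum[OF p, of k ?B] by simp
qed

text \<open>Components of an explicit connection: the components of W are differentiated, and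
  \<open>\<Gamma>\<close> accounts for the frame fields. It is the witness needed to know that
  \<open>levi_civita\<close> chooses anything at all.\<close>

definition nabla_coeff :: "'a vfield \<Rightarrow> 'a vfield \<Rightarrow> 'i \<Rightarrow> 'a \<Rightarrow> real" where
  "nabla_coeff V W k p = V p (\<lambda>q. \<theta> k q (W q))
     + (\<Sum>i\<in>UNIV. \<Sum>j\<in>UNIV. \<theta> i p (V p) * \<theta> j p (W p) * \<Gamma> i j k p)"

definition nabla :: "'a vfield \<Rightarrow> 'a vfield \<Rightarrow> 'a vfield" where
  "nabla V W p f = (\<Sum>k\<in>UNIV. nabla_coeff V W k p * e k p f)"

lemma coframe_nabla: "p \<in> points \<A> \<Longrightarrow> \<theta> k p (nabla V W p) = nabla_coeff V W k p"
  unfolding nabla_def by (rule coframe_sum)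

lemma vector_field_nabla:
  assumes "vector_field \<A> V" "vector_field \<A> W" shows "vector_field \<A> (nabla V W)"
proof -
  have "smooth_fun \<A> (nabla_coeff V W k)" for k
    unfolding smooth_fun_def
  proof
    fix p assume p: "p \<in> points \<A>"
    show "smooth_at \<A> p (nabla_coeff V W k)"
      unfolding nabla_coeff_def
      by (intro smooth_at_add smooth_at_sum smooth_at_mult smooth_at_\<Gamma> p
          vector_field_smooth[OF assms(1) smooth_at_one_form[OF coframe_form assms(2) p]]
          smooth_at_one_form[OF coframe_form assms(2) p] smooth_at_one_form[OF coframe_form assms(1) p])
  qed
  then show ?thesis unfolding nabla_def[abs_def] by (intro vector_field_sum frame_field)
qed

lemma nabla_scale_add_left:
  assumes "vector_field \<A> V" "vector_field \<A> V'" "p \<in> points \<A>"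
  shows "nabla (\<lambda>q k. s q * V q k + V' q k) W p f = s p * nabla V W p f + nabla V' W p f"
proof -
  have "nabla_coeff (\<lambda>q k. s q * V q k + V' q k) W k p = s p * nabla_coeff V W k p + nabla_coeff V' W k p" for k
    using one_form_lincomb[OF coframe_form vector_field_tangent[OF assms(1,3)] vector_field_tangent[OF assms(2,3)]]
    by (simp add: nabla_coeff_def algebra_simps sum.distrib sum_distrib_left)
  then show ?thesis by (simp add: nabla_def algebra_simps sum.distrib sum_distrib_left)
qed

lemma nabla_leibniz:
  assumes V: "vector_field \<A> V" and W: "vector_field \<A> W" and W': "vector_field \<A> W'"
    and s: "smooth_fun \<A> s" and p: "p \<in> points \<A>"
  shows "nabla V (\<lambda>q k. s q * W q k + W' q k) p f = s p * nabla V W p f + V p s * W p f + nabla V W' p f"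
proof -
  have Vp: "V p \<in> tangent_space \<A> p" by (rule vector_field_tangent[OF V p])
  have sp: "smooth_at \<A> p s" using s p unfolding smooth_fun_def by blast
  have lin: "\<theta> k q (\<lambda>f. s q * W q f + W' q f) = s q * \<theta> k q (W q) + \<theta> k q (W' q)" if "q \<in> points \<A>" for k q
    using one_form_lincomb[OF coframe_form vector_field_tangent[OF W that] vector_field_tangent[OF W' that]] .
  have "V p (\<lambda>q. \<theta> k q (\<lambda>f. s q * W q f + W' q f))
     = s p * V p (\<lambda>q. \<theta> k q (W q)) + V p s * \<theta> k p (W p) + V p (\<lambda>q. \<theta> k q (W' q))" for k
  proof -
    note sm = sp smooth_at_one_form[OF coframe_form W p, of k]
    have "V p (\<lambda>q. \<theta> k q (\<lambda>f. s q * W q f + W' q f)) = V p (\<lambda>q. s q * \<theta> k q (W q) + \<theta> k q (W' q))"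
      by (rule tangent_cong[OF Vp eventually_mono[OF eventually_in_points[OF p]]]) (rule lin)
    also have "\<dots> = V p (\<lambda>q. s q * \<theta> k q (W q)) + V p (\<lambda>q. \<theta> k q (W' q))"
      by (rule tangent_add[OF Vp smooth_at_mult[OF sm] smooth_at_one_form[OF coframe_form W' p]])
    also have "V p (\<lambda>q. s q * \<theta> k q (W q)) = s p * V p (\<lambda>q. \<theta> k q (W q)) + V p s * \<theta> k p (W p)"
      by (rule tangent_mult[OF Vp sm])
    finally show ?thesis .
  qed
  then have "nabla_coeff V (\<lambda>q k. s q * W q k + W' q k) k p
      = s p * nabla_coeff V W k p + V p s * \<theta> k p (W p) + nabla_coeff V W' k p" for k
    unfolding nabla_coeff_def lin[OF p] by (simp add: algebra_simps sum.distrib sum_distrib_left)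
  then show ?thesis
    unfolding nabla_def frame_expand[OF vector_field_tangent[OF W p], of f]
    by (simp add: algebra_simps sum.distrib sum_distrib_left)
qed

lemma nabla_torsion:
  assumes V: "vector_field \<A> V" and W: "vector_field \<A> W" and p: "p \<in> points \<A>"
  shows "nabla V W p f - nabla W V p f = lie_bracket \<A> V W p f"
proof -
  have "(\<Sum>i\<in>UNIV. \<Sum>j\<in>UNIV. \<theta> i p (V p) * \<theta> j p (W p) * \<Gamma> i j k p)
      - (\<Sum>i\<in>UNIV. \<Sum>j\<in>UNIV. \<theta> i p (W p) * \<theta> j p (V p) * \<Gamma> i j k p)
      = (\<Sum>i\<in>UNIV. \<Sum>j\<in>UNIV. \<theta> i p (V p) * \<theta> j p (W p) * C i j k p)" for k
    unfolding \<Gamma>_torsion[OF p, symmetric] right_diff_distrib sum_subtractf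
    by (subst (2) sum.swap) (simp only: ac_simps)
  then have nb: "nabla_coeff V W k p - nabla_coeff W V k p = \<theta> k p (lie_bracket \<A> V W p)" for k
    unfolding lie_bracket_frame[OF V W p] nabla_coeff_def by (simp add: algebra_simps)
  show ?thesis
    unfolding nabla_def frame_expand[OF vector_field_tangent[OF vector_field_lie_bracket[OF V W] p], of f]
    by (simp only: sum_subtractf[symmetric] left_diff_distrib[symmetric] nb)
qed

text \<open>The derivatives of the components match by the product rule. The two sums with
  \<open>\<Gamma>\<close> cancel by \<open>\<Gamma>_metric\<close> once the summation indices j and
  k are exchanged.\<close>

lemma nabla_metric:
  assumes V: "vector_field \<A> V" and W: "vector_field \<A> W" and Z: "vector_field \<A> Z" and p: "p \<in> points \<A>"
  shows "V p (\<lambda>q. h q (W q) (Z q)) = h p (nabla V W p) (Z p) + h p (W p) (nabla V Z p)"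
proof -
  have Vp: "V p \<in> tangent_space \<A> p" by (rule vector_field_tangent[OF V p])
  let ?w = "\<lambda>k. \<theta> k p (W p)" and ?z = "\<lambda>k. \<theta> k p (Z p)" and ?v = "\<lambda>k. \<theta> k p (V p)"
  have sm: "smooth_at \<A> p (\<lambda>q. \<theta> k q (W q))" "smooth_at \<A> p (\<lambda>q. \<theta> k q (Z q))" for k
    using smooth_at_one_form[OF coframe_form _ p] W Z by auto
  have "V p (\<lambda>q. h q (W q) (Z q)) = (\<Sum>k\<in>UNIV. V p (\<lambda>q. \<epsilon> k * (\<theta> k q (W q) * \<theta> k q (Z q))))"
    unfolding metric by (rule tangent_fun_sum[OF Vp smooth_at_cmult[OF smooth_at_mult[OF sm]]])
  also have "\<dots> = (\<Sum>k\<in>UNIV. \<epsilon> k * (?w k * V p (\<lambda>q. \<theta> k q (Z q)) + V p (\<lambda>q. \<theta> k q (W q)) * ?z k))"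
    by (intro sum.cong refl) (simp only: tangent_cmult[OF Vp smooth_at_mult[OF sm]] tangent_mult[OF Vp sm])
  finally have 1: "V p (\<lambda>q. h q (W q) (Z q)) = \<dots>" .
  have "(\<Sum>k\<in>UNIV. \<epsilon> k * ((\<Sum>i\<in>UNIV. \<Sum>j\<in>UNIV. ?v i * ?w j * \<Gamma> i j k p) * ?z k))
     = (\<Sum>k\<in>UNIV. \<Sum>i\<in>UNIV. \<Sum>j\<in>UNIV. ?v i * ?w j * ?z k * (\<epsilon> k * \<Gamma> i j k p))"
    by (simp only: sum_distrib_left sum_distrib_right ac_simps)
  also have "\<dots> = - (\<Sum>k\<in>UNIV. \<Sum>i\<in>UNIV. \<Sum>j\<in>UNIV. ?v i * ?w j * ?z k * (\<epsilon> j * \<Gamma> i k j p))"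
    unfolding sum_negf[symmetric] by (intro sum.cong refl) (subst \<Gamma>_metric[OF p], simp)
  also have "(\<Sum>k\<in>UNIV. \<Sum>i\<in>UNIV. \<Sum>j\<in>UNIV. ?v i * ?w j * ?z k * (\<epsilon> j * \<Gamma> i k j p))
     = (\<Sum>j\<in>UNIV. \<Sum>i\<in>UNIV. \<Sum>k\<in>UNIV. ?v i * ?w j * ?z k * (\<epsilon> j * \<Gamma> i k j p))"
  proof -
    have "(\<Sum>k\<in>UNIV. \<Sum>i\<in>UNIV. \<Sum>j\<in>UNIV. F i j k) = (\<Sum>j\<in>UNIV. \<Sum>i\<in>UNIV. \<Sum>k\<in>UNIV. F i j k)"
      for F :: "'i \<Rightarrow> 'i \<Rightarrow> 'i \<Rightarrow> real"
    proof -
      have "(\<Sum>k\<in>UNIV. \<Sum>i\<in>UNIV. \<Sum>j\<in>UNIV. F i j k) = (\<Sum>i\<in>UNIV. \<Sum>k\<in>UNIV. \<Sum>j\<in>UNIV. F i j k)"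
        by (rule sum.swap)
      also have "\<dots> = (\<Sum>i\<in>UNIV. \<Sum>j\<in>UNIV. \<Sum>k\<in>UNIV. F i j k)" by (rule sum.cong[OF refl sum.swap])
      also have "\<dots> = (\<Sum>j\<in>UNIV. \<Sum>i\<in>UNIV. \<Sum>k\<in>UNIV. F i j k)" by (rule sum.swap)
      finally show ?thesis .
    qed
    then show ?thesis .
  qed
  also have "\<dots> = (\<Sum>k\<in>UNIV. \<epsilon> k * (?w k * (\<Sum>i\<in>UNIV. \<Sum>j\<in>UNIV. ?v i * ?z j * \<Gamma> i j k p)))"
    by (simp only: sum_distrib_left sum_distrib_right ac_simps)
  finally show ?thesis
    unfolding 1 unfolding metric coframe_nabla[OF p] nabla_coeff_def
    by (simp add: distrib_left distrib_right sum.distrib)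
qed

lemma is_levi_civita_nabla: "is_levi_civita \<A> h nabla"
  unfolding is_levi_civita_def
  by (intro conjI allI impI ballI)
     (rule vector_field_nabla nabla_scale_add_left nabla_leibniz nabla_torsion nabla_metric, assumption+)+

text \<open>The difference of two Levi-Civita connections, paired with a third field, is symmetric in the
  first two arguments and skew in the last two, hence zero.\<close>

lemma levi_civita_unique:
  assumes c: "is_levi_civita \<A> h conn" and d: "is_levi_civita \<A> h conn'"
    and V: "vector_field \<A> V" and W: "vector_field \<A> W" and p: "p \<in> points \<A>"
  shows "conn V W p = conn' V W p"
proof -
  have vf: "vector_field \<A> (conn V W)" "vector_field \<A> (conn' V W)"
    if "vector_field \<A> V" "vector_field \<A> W" for V W
    using is_levi_civitaD(1)[OF c that] is_levi_civitaD(1)[OF d that] .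
  have tan: "conn V W p \<in> tangent_space \<A> p" "conn' V W p \<in> tangent_space \<A> p"
    if "vector_field \<A> V" "vector_field \<A> W" for V W
    using vector_field_tangent[OF vf(1)[OF that] p] vector_field_tangent[OF vf(2)[OF that] p] .
  define T where "T V W Z = h p (conn V W p) (Z p) - h p (conn' V W p) (Z p)" for V W Z
  have T_eq: "T V W Z = h p (\<lambda>f. conn V W p f - conn' V W p f) (Z p)"
    if "vector_field \<A> V" "vector_field \<A> W" for V W Z
    unfolding T_def metric one_form_diff[OF coframe_form tan[OF that]] sum_subtractf[symmetric]
    by (simp only: right_diff_distrib left_diff_distrib)
  have sym: "T V W Z = T W V Z" if "vector_field \<A> V" "vector_field \<A> W" for V W Z
  proof -
    have "conn V W p f - conn' V W p f = conn W V p f - conn' W V p f" for f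
      using is_levi_civitaD(2)[OF c that p, of f] is_levi_civitaD(2)[OF d that p, of f] by linarith
    then show ?thesis unfolding T_eq[OF that] T_eq[OF that(2,1)] by (simp only:)
  qed
  have h_sym: "h p D E = h p E D" for D E unfolding metric by (simp only: ac_simps)
  have skew: "T V W Z = - T V Z W"
    if "vector_field \<A> V" "vector_field \<A> W" "vector_field \<A> Z" for V W Z
  proof -
    show ?thesis
      using is_levi_civitaD(3)[OF c that p] is_levi_civitaD(3)[OF d that p]
      unfolding T_def h_sym[of "W p"] by linarith
  qed
  have "T V W Z = 0" if Z: "vector_field \<A> Z" for Z
  proof -
    \<comment> \<open>Symmetry and skewness alternate; three sign changes later the arguments are
      back in their initial order, so the value equals its own negative.\<close>
    have "T V W Z = T W V Z" by (rule sym[OF V W])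
    also have "\<dots> = - T W Z V" by (rule skew[OF W V Z])
    also have "\<dots> = - T Z W V" using sym[OF W Z] by simp
    also have "\<dots> = T Z V W" using skew[OF Z W V] by simp
    also have "\<dots> = T V Z W" by (rule sym[OF Z V])
    also have "\<dots> = - T V W Z" by (rule skew[OF V Z W])
    finally show ?thesis by simp
  qed
  \<comment> \<open>Pairing with e_k isolates the component of index k up to the sign
    \<open>\<epsilon> k\<close>, which is nonzero.\<close>
  from this[OF frame_field]
  have "\<epsilon> k = 0 \<or> \<theta> k p (\<lambda>f. conn V W p f - conn' V W p f) = 0" for k
    unfolding T_eq[OF V W] metric dual[OF p] by (simp add: mult_delta_left mult_delta_right)
  then have "\<theta> k p (\<lambda>f. conn V W p f - conn' V W p f) = 0" for k
    using sign_square[of k] by (metis mult_zero_left zero_neq_one)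
  then have "\<theta> k p (conn V W p) = \<theta> k p (conn' V W p)" for k
    by (simp add: one_form_diff[OF coframe_form tan[OF V W]])
  then show ?thesis by (rule coframe_eqI[OF tan[OF V W]])
qed

section \<open>Components of the chosen connection and of its curvature\<close>

lemma is_levi_civita_levi_civita: "is_levi_civita \<A> h (levi_civita \<A> h)"
  unfolding levi_civita_def by (rule someI[where P="is_levi_civita \<A> h", OF is_levi_civita_nabla])

lemma coframe_levi_civita:
  assumes "vector_field \<A> V" "vector_field \<A> W" "p \<in> points \<A>"
  shows "\<theta> k p (levi_civita \<A> h V W p) = nabla_coeff V W k p"
  using levi_civita_unique[OF is_levi_civita_levi_civita is_levi_civita_nabla assms] coframe_nabla[OF assms(3)]
  by simp

lemma vector_field_levi_civita:
  "vector_field \<A> V \<Longrightarrow> vector_field \<A> W \<Longrightarrow> vector_field \<A> (levi_civita \<A> h V W)"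
  by (rule is_levi_civitaD(1)[OF is_levi_civita_levi_civita])

lemma nabla_coeff_frame_left:
  assumes "p \<in> points \<A>"
  shows "nabla_coeff (e i) W l p = e i p (\<lambda>q. \<theta> l q (W q)) + (\<Sum>m\<in>UNIV. \<theta> m p (W p) * \<Gamma> i m l p)"
  unfolding nabla_coeff_def by (subst sum.swap) (simp add: dual[OF assms] mult_delta_left)

text \<open>The components of e_j are constant near p, so their derivative drops out and only the
  \<open>\<Gamma>\<close> term survives.\<close>

lemma nabla_coeff_frame:
  assumes "vector_field \<A> V" "p \<in> points \<A>"
  shows "nabla_coeff V (e j) k p = (\<Sum>i\<in>UNIV. \<theta> i p (V p) * \<Gamma> i j k p)"
proof -
  have "V p (\<lambda>q. \<theta> k q (e j q)) = V p (\<lambda>q. if k = j then 1 else 0)"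
    by (rule tangent_cong[OF vector_field_tangent[OF assms] eventually_mono[OF eventually_in_points[OF assms(2)]]])
       (rule dual)
  then show ?thesis
    using tangent_const[OF vector_field_tangent[OF assms]] dual[OF assms(2)]
    by (simp add: nabla_coeff_def mult_delta_left mult_delta_right)
qed

lemma coframe_levi_civita_frame:
  "p \<in> points \<A> \<Longrightarrow> \<theta> k p (levi_civita \<A> h (e i) (e j) p) = \<Gamma> i j k p"
  by (simp add: coframe_levi_civita frame_field nabla_coeff_frame dual mult_delta_left)

text \<open>Cartan's second structure equation. The iterated covariant derivative differentiates one
  coefficient \<open>\<Gamma>\<close> and multiplies it by another; the bracket is not a frame
  field, and its expansion contributes \<open>C\<close> times \<open>\<Gamma>\<close>. The sign
  \<open>\<epsilon> l\<close> lowers the last index.\<close>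

theorem curvature_frame:
  assumes p: "p \<in> points \<A>"
  shows "h p (curvature \<A> h (e i) (e j) (e k) p) (e l p) = \<epsilon> l * (e i p (\<Gamma> j k l) - e j p (\<Gamma> i k l)
    + (\<Sum>m\<in>UNIV. \<Gamma> j k m p * \<Gamma> i m l p - \<Gamma> i k m p * \<Gamma> j m l p - C i j m p * \<Gamma> m k l p))"
proof -
  let ?c = "levi_civita \<A> h"
  note vc = vector_field_levi_civita
  have second: "\<theta> l p (?c (e i) (?c (e j) (e k)) p) = e i p (\<Gamma> j k l) + (\<Sum>m\<in>UNIV. \<Gamma> j k m p * \<Gamma> i m l p)" for i j k l
  proof -
    have "e i p (\<lambda>q. \<theta> l q (?c (e j) (e k) q)) = e i p (\<Gamma> j k l)"
      by (rule tangent_cong[OF frame_tangent[OF p] eventually_mono[OF eventually_in_points[OF p]]])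
         (rule coframe_levi_civita_frame)
    then show ?thesis
      unfolding coframe_levi_civita[OF frame_field vc[OF frame_field frame_field] p]
        nabla_coeff_frame_left[OF p] coframe_levi_civita_frame[OF p] by simp
  qed
  have third: "\<theta> l p (?c (lie_bracket \<A> (e i) (e j)) (e k) p) = (\<Sum>m\<in>UNIV. C i j m p * \<Gamma> m k l p)"
    by (simp add: coframe_levi_civita vector_field_lie_bracket frame_field p nabla_coeff_frame C_def)
  have t1: "?c (lie_bracket \<A> (e i) (e j)) (e k) p \<in> tangent_space \<A> p"
    by (intro vector_field_tangent[OF _ p] vc frame_field vector_field_lie_bracket)
  have t2: "?c (e i) (?c (e j) (e k)) p \<in> tangent_space \<A> p" for i j k
    by (intro vector_field_tangent[OF _ p] vc frame_field)
  have "\<theta> l p (curvature \<A> h (e i) (e j) (e k) p) = \<theta> l p (?c (e i) (?c (e j) (e k)) p)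
     - \<theta> l p (?c (e j) (?c (e i) (e k)) p) - \<theta> l p (?c (lie_bracket \<A> (e i) (e j)) (e k) p)"
    unfolding curvature_def Let_def
    by (simp only: one_form_diff[OF coframe_form tangent_diff[OF t2 t2] t1] one_form_diff[OF coframe_form t2 t2])
  then have "\<theta> l p (curvature \<A> h (e i) (e j) (e k) p) = e i p (\<Gamma> j k l) - e j p (\<Gamma> i k l)
    + (\<Sum>m\<in>UNIV. \<Gamma> j k m p * \<Gamma> i m l p - \<Gamma> i k m p * \<Gamma> j m l p - C i j m p * \<Gamma> m k l p)"
    unfolding second third by (simp add: sum_subtractf)
  then show ?thesis
    unfolding metric dual[OF p] by (simp add: mult_delta_right)
qed

end

section \<open>Products\<close>

definition prod_chart :: "('a, 'e) chart \<Rightarrow> ('b, 'd) chart \<Rightarrow> ('a \<times> 'b, 'e \<times> 'd) chart" where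
  "prod_chart a b = (fst a \<times> fst b, map_prod (snd a) (snd b))"

lemma fst_prod_chart [simp]: "fst (prod_chart a b) = fst a \<times> fst b"
  and snd_prod_chart [simp]: "snd (prod_chart a b) = map_prod (snd a) (snd b)"
  by (simp_all add: prod_chart_def)

lemma in_prod_atlas: "c \<in> prod_atlas \<A> \<B> \<longleftrightarrow> (\<exists>a\<in>\<A>. \<exists>b\<in>\<B>. c = prod_chart a b)"
proof
  assume "c \<in> prod_atlas \<A> \<B>"
  then obtain U \<phi> V \<psi> where *: "c = (U \<times> V, map_prod \<phi> \<psi>)" "(U, \<phi>) \<in> \<A>" "(V, \<psi>) \<in> \<B>"
    unfolding prod_atlas_def by blast
  then have "c = prod_chart (U, \<phi>) (V, \<psi>)" by (simp add: prod_chart_def)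
  with * show "\<exists>a\<in>\<A>. \<exists>b\<in>\<B>. c = prod_chart a b" by blast
next
  assume "\<exists>a\<in>\<A>. \<exists>b\<in>\<B>. c = prod_chart a b"
  then obtain a b where "a \<in> \<A>" "b \<in> \<B>" "c = prod_chart a b" by blast
  then have "(fst a, snd a) \<in> \<A>" "(fst b, snd b) \<in> \<B>" "c = (fst a \<times> fst b, map_prod (snd a) (snd b))"
    by (simp_all add: prod_chart_def)
  then show "c \<in> prod_atlas \<A> \<B>" unfolding prod_atlas_def by blast
qed

lemma points_prod_atlas [simp]: "points (prod_atlas \<A> \<B>) = points \<A> \<times> points \<B>"
proof (rule set_eqI)
  fix p
  have "p \<in> points (prod_atlas \<A> \<B>) \<longleftrightarrow> (\<exists>a\<in>\<A>. \<exists>b\<in>\<B>. p \<in> fst (prod_chart a b))"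
    unfolding points_def UN_iff Bex_def in_prod_atlas by blast
  then show "p \<in> points (prod_atlas \<A> \<B>) \<longleftrightarrow> p \<in> points \<A> \<times> points \<B>"
    unfolding points_def by (simp add: mem_Times_iff)
qed

locale product_atlas = X: smooth_atlas \<A> + Y: smooth_atlas \<B>
  for \<A> :: "('a, 'e::euclidean_space) atlas" and \<B> :: "('b, 'd::euclidean_space) atlas"
begin

lemma inj_prod_chart: "a \<in> \<A> \<Longrightarrow> b \<in> \<B> \<Longrightarrow> inj_on (map_prod (snd a) (snd b)) (fst a \<times> fst b)"
  using X.inj_chart Y.inj_chart by (simp add: map_prod_inj_on)

lemma cinv_prod_chart:
  assumes "a \<in> \<A>" "b \<in> \<B>" "z \<in> snd a ` fst a" "w \<in> snd b ` fst b"
  shows "cinv (prod_chart a b) (z, w) = (cinv a z, cinv b w)"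
  unfolding fst_prod_chart snd_prod_chart
  by (rule inv_into_f_eq[OF inj_prod_chart]) (use assms in \<open>auto simp: f_inv_into_f inv_into_into\<close>)

abbreviation \<M> :: "('a \<times> 'b, 'e \<times> 'd) atlas" where "\<M> \<equiv> prod_atlas \<A> \<B>"

sublocale M: smooth_atlas \<M>
proof
  fix c assume "c \<in> \<M>"
  then obtain a b where a: "a \<in> \<A>" and b: "b \<in> \<B>" and c: "c = prod_chart a b"
    by (auto simp: in_prod_atlas)
  show "inj_on (snd c) (fst c)" using inj_prod_chart a b c by simp
  fix d assume "d \<in> \<M>"
  then obtain a' b' where a': "a' \<in> \<A>" and b': "b' \<in> \<B>" and d: "d = prod_chart a' b'"
    by (auto simp: in_prod_atlas)
  let ?S = "snd a ` (fst a \<inter> fst a')" and ?T = "snd b ` (fst b \<inter> fst b')"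
  have eq: "snd c ` (fst c \<inter> fst d) = ?S \<times> ?T" unfolding c d by force
  have o: "open ?S" "open ?T" "open (?S \<times> ?T)"
    using X.open_chart_inter[OF a a'] Y.open_chart_inter[OF b b'] by (auto intro: open_Times)
  show "open (snd c ` (fst c \<inter> fst d))" unfolding eq by (rule o(3))
  have "smooth_on (?S \<times> ?T) (\<lambda>z. ((snd a' \<circ> cinv a) (fst z), (snd b' \<circ> cinv b) (snd z)))"
    by (rule smooth_on_Pair[OF o(3) smooth_on_compose[OF o(3,1) _ _ X.smooth_transition[OF a a']]
          smooth_on_compose[OF o(3,2) _ _ Y.smooth_transition[OF b b']]])
       (auto intro: smooth_on_linear[OF bounded_linear_fst o(3)] smooth_on_linear[OF bounded_linear_snd o(3)])
  then show "smooth_on (snd c ` (fst c \<inter> fst d)) (snd d \<circ> cinv c)"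
    unfolding eq
  proof (rule smooth_on_cong[OF o(3)])
    fix z assume "z \<in> ?S \<times> ?T"
    then have "cinv c z = (cinv a (fst z), cinv b (snd z))"
      using cinv_prod_chart[OF a b, of "fst z" "snd z"] unfolding c by auto
    then show "(snd d \<circ> cinv c) z = ((snd a' \<circ> cinv a) (fst z), (snd b' \<circ> cinv b) (snd z))"
      by (simp add: d)
  qed
qed

lemma prod_chart_in: "a \<in> \<A> \<Longrightarrow> b \<in> \<B> \<Longrightarrow> prod_chart a b \<in> \<M>"
  by (auto simp: in_prod_atlas)

lemma prod_chartE:
  assumes "p \<in> points \<M>"
  obtains a b where "a \<in> \<A>" "b \<in> \<B>" "fst p \<in> fst a" "snd p \<in> fst b"
    "prod_chart a b \<in> \<M>" "p \<in> fst (prod_chart a b)"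
proof -
  have "fst p \<in> points \<A>" "snd p \<in> points \<B>" using assms by (auto simp: mem_Times_iff)
  then obtain a b where "a \<in> \<A>" "fst p \<in> fst a" "b \<in> \<B>" "snd p \<in> fst b"
    using X.chartE Y.chartE by metis
  with that prod_chart_in show thesis by (simp add: mem_Times_iff)
qed

section \<open>Smoothness on the product and on its slices\<close>

lemma smooth_at_fst:
  assumes "smooth_at \<A> (fst p) f" "snd p \<in> points \<B>"
  shows "smooth_at \<M> p (\<lambda>q. f (fst q))"
proof -
  have "p \<in> points \<M>"
    using X.smooth_at_points[OF assms(1)] assms(2) by (simp add: mem_Times_iff)
  then obtain a b where ab: "a \<in> \<A>" "b \<in> \<B>" "fst p \<in> fst a" "snd p \<in> fst b"
    and c: "prod_chart a b \<in> \<M>" "p \<in> fst (prod_chart a b)"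
    by (rule prod_chartE)
  obtain W where W: "open W" "snd a (fst p) \<in> W" "smooth_on W (f \<circ> cinv a)"
    using X.smooth_at_chartE[OF assms(1) ab(1,3)] by metis
  have oW: "open (W \<times> (UNIV :: 'd set))" using W by (auto intro: open_Times)
  have "smooth_on (W \<times> (UNIV :: 'd set)) (\<lambda>z. (f \<circ> cinv a) (fst z))"
    by (rule smooth_on_compose[OF oW W(1) _ smooth_on_linear[OF bounded_linear_fst oW] W(3)]) auto
  note * = M.smooth_at_chartI[OF c oW _ this]
  show ?thesis
    by (rule *)
       (use W M.eventually_in_chart[OF c] ab in \<open>auto simp: map_prod_def split_beta elim!: eventually_mono\<close>)
qed

lemma smooth_at_snd:
  assumes "smooth_at \<B> (snd p) f" "fst p \<in> points \<A>"
  shows "smooth_at \<M> p (\<lambda>q. f (snd q))"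
proof -
  have "p \<in> points \<M>"
    using Y.smooth_at_points[OF assms(1)] assms(2) by (simp add: mem_Times_iff)
  then obtain a b where ab: "a \<in> \<A>" "b \<in> \<B>" "fst p \<in> fst a" "snd p \<in> fst b"
    and c: "prod_chart a b \<in> \<M>" "p \<in> fst (prod_chart a b)"
    by (rule prod_chartE)
  obtain W where W: "open W" "snd b (snd p) \<in> W" "smooth_on W (f \<circ> cinv b)"
    using Y.smooth_at_chartE[OF assms(1) ab(2,4)] by metis
  have oW: "open ((UNIV :: 'e set) \<times> W)" using W by (auto intro: open_Times)
  have "smooth_on ((UNIV :: 'e set) \<times> W) (\<lambda>z. (f \<circ> cinv b) (snd z))"
    by (rule smooth_on_compose[OF oW W(1) _ smooth_on_linear[OF bounded_linear_snd oW] W(3)]) auto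
  note * = M.smooth_at_chartI[OF c oW _ this]
  show ?thesis
    by (rule *)
       (use W M.eventually_in_chart[OF c] ab in \<open>auto simp: map_prod_def split_beta elim!: eventually_mono\<close>)
qed

lemma smooth_on_Pair_left: "open S \<Longrightarrow> smooth_on S (\<lambda>z. (z, w))"
  by (intro smooth_on_Pair smooth_on_id smooth_on_const)

lemma smooth_on_Pair_right: "open S \<Longrightarrow> smooth_on S (\<lambda>z. (w, z))"
  by (intro smooth_on_Pair smooth_on_id smooth_on_const)

lemma smooth_at_slice_fst:
  assumes "smooth_at \<M> p f" shows "smooth_at \<A> (fst p) (\<lambda>x. f (x, snd p))"
proof -
  obtain a b where ab: "a \<in> \<A>" "b \<in> \<B>" "fst p \<in> fst a" "snd p \<in> fst b"
    and c: "prod_chart a b \<in> \<M>" "p \<in> fst (prod_chart a b)"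
    using M.smooth_at_points[OF assms] by (rule prod_chartE)
  obtain W where W: "open W" "snd (prod_chart a b) p \<in> W" "smooth_on W (f \<circ> cinv (prod_chart a b))"
    using M.smooth_at_chartE[OF assms c] by metis
  let ?W = "(\<lambda>z. (z, snd b (snd p))) -` W"
  have oW: "open ?W" by (intro open_vimage W continuous_intros)
  have "smooth_on ?W (\<lambda>z. (f \<circ> cinv (prod_chart a b)) (z, snd b (snd p)))"
    by (rule smooth_on_compose[OF oW W(1) _ smooth_on_Pair_left[OF oW] W(3)]) auto
  then show ?thesis
  proof (rule X.smooth_at_chartI[OF ab(1,3) oW, rotated])
    show "snd a (fst p) \<in> ?W" using W(2) by (simp add: map_prod_def split_beta)
    show "\<forall>\<^sub>F q in nbhds \<A> (fst p). f (q, snd p) = (f \<circ> cinv (prod_chart a b)) (snd a q, snd b (snd p))"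
      using X.eventually_in_chart[OF ab(1,3)]
      by eventually_elim (use cinv_prod_chart[OF ab(1,2)] ab in simp)
  qed
qed

lemma smooth_at_slice_snd:
  assumes "smooth_at \<M> p f" shows "smooth_at \<B> (snd p) (\<lambda>y. f (fst p, y))"
proof -
  obtain a b where ab: "a \<in> \<A>" "b \<in> \<B>" "fst p \<in> fst a" "snd p \<in> fst b"
    and c: "prod_chart a b \<in> \<M>" "p \<in> fst (prod_chart a b)"
    using M.smooth_at_points[OF assms] by (rule prod_chartE)
  obtain W where W: "open W" "snd (prod_chart a b) p \<in> W" "smooth_on W (f \<circ> cinv (prod_chart a b))"
    using M.smooth_at_chartE[OF assms c] by metis
  let ?W = "(\<lambda>z. (snd a (fst p), z)) -` W"
  have oW: "open ?W" by (intro open_vimage W continuous_intros)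
  have "smooth_on ?W (\<lambda>z. (f \<circ> cinv (prod_chart a b)) (snd a (fst p), z))"
    by (rule smooth_on_compose[OF oW W(1) _ smooth_on_Pair_right[OF oW] W(3)]) auto
  then show ?thesis
  proof (rule Y.smooth_at_chartI[OF ab(2,4) oW, rotated])
    show "snd b (snd p) \<in> ?W" using W(2) by (simp add: map_prod_def split_beta)
    show "\<forall>\<^sub>F q in nbhds \<B> (snd p). f (fst p, q) = (f \<circ> cinv (prod_chart a b)) (snd a (fst p), snd b q)"
      using Y.eventually_in_chart[OF ab(2,4)]
      by eventually_elim (use cinv_prod_chart[OF ab(1,2)] ab in simp)
  qed
qed

lemma smooth_at_fst_iff:
  "p \<in> points \<M> \<Longrightarrow> smooth_at \<M> p (\<lambda>q. f (fst q)) \<longleftrightarrow> smooth_at \<A> (fst p) f"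
  using smooth_at_fst[of p f] smooth_at_slice_fst[of p "\<lambda>q. f (fst q)"] by (auto simp: mem_Times_iff)

lemma smooth_at_snd_iff:
  "p \<in> points \<M> \<Longrightarrow> smooth_at \<M> p (\<lambda>q. f (snd q)) \<longleftrightarrow> smooth_at \<B> (snd p) f"
  using smooth_at_snd[of p f] smooth_at_slice_snd[of p "\<lambda>q. f (snd q)"] by (auto simp: mem_Times_iff)

text \<open>The derivative in a product chart is linear and (u, v) = (u, 0) + (0, v); each summand
  is the derivative along a slice through p.\<close>

lemma coord_vec_prod:
  assumes f: "smooth_at \<M> p f" and ab: "a \<in> \<A>" "b \<in> \<B>" "fst p \<in> fst a" "snd p \<in> fst b"
  shows "coord_vec \<M> (prod_chart a b) p (u, v) f =
    coord_vec \<A> a (fst p) u (\<lambda>x. f (x, snd p)) + coord_vec \<B> b (snd p) v (\<lambda>y. f (fst p, y))"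
proof -
  let ?c = "prod_chart a b" let ?F = "f \<circ> cinv ?c"
  let ?z = "snd a (fst p)" and ?w = "snd b (snd p)"
  let ?F' = "frechet_derivative ?F (at (snd ?c p))"
  have c: "?c \<in> \<M>" "p \<in> fst ?c" using prod_chart_in ab by (auto simp: mem_Times_iff)
  have z: "snd ?c p = (?z, ?w)" by (simp add: map_prod_def split_beta)
  have d: "(?F has_derivative ?F') (at (?z, ?w))"
    using M.smooth_at_has_derivative[OF f c] unfolding z .
  have "((\<lambda>s. (s, ?w)) has_derivative (\<lambda>u. (u, 0))) (at ?z)"
    by (intro derivative_intros)
  from has_derivative_compose[OF this d]
  have "((\<lambda>x. f (x, snd p)) \<circ> cinv a has_derivative (\<lambda>u. ?F' (u, 0))) (at ?z)"
    by (rule has_derivative_transform_within_open[OF _ X.open_chart[OF ab(1)]])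
       (use ab cinv_prod_chart[OF ab(1,2)] in auto)
  then have 1: "coord_vec \<A> a (fst p) u (\<lambda>x. f (x, snd p)) = ?F' (u, 0)"
    by (rule X.coord_vec_eqI[OF smooth_at_slice_fst[OF f]])
  have "((\<lambda>s. (?z, s)) has_derivative (\<lambda>v. (0, v))) (at ?w)"
    by (intro derivative_intros)
  from has_derivative_compose[OF this d]
  have "((\<lambda>y. f (fst p, y)) \<circ> cinv b has_derivative (\<lambda>v. ?F' (0, v))) (at ?w)"
    by (rule has_derivative_transform_within_open[OF _ Y.open_chart[OF ab(2)]])
       (use ab cinv_prod_chart[OF ab(1,2)] in auto)
  then have 2: "coord_vec \<B> b (snd p) v (\<lambda>y. f (fst p, y)) = ?F' (0, v)"
    by (rule Y.coord_vec_eqI[OF smooth_at_slice_snd[OF f]])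
  have "?F' (u, v) = ?F' ((u, 0) + (0, v))" by simp
  also have "\<dots> = ?F' (u, 0) + ?F' (0, v)"
    by (rule linear_add[OF has_derivative_linear[OF d]])
  finally show ?thesis unfolding 1 2 by (simp add: M.coord_vec_smooth[OF f])
qed

lemma lift_fst_coord_vec:
  assumes ab: "a \<in> \<A>" "b \<in> \<B>" "fst p \<in> fst a" "snd p \<in> fst b"
  shows "lift_fst \<M> p (coord_vec \<A> a (fst p) u) = coord_vec \<M> (prod_chart a b) p (u, 0)"
proof
  fix f show "lift_fst \<M> p (coord_vec \<A> a (fst p) u) f = coord_vec \<M> (prod_chart a b) p (u, 0) f"
  proof (cases "smooth_at \<M> p f")
    case True
    then show ?thesis
      using coord_vec_prod[OF True ab, of u 0] linear_0[OF Y.coord_vec_linear[OF ab(2,4)]]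
      by (simp add: lift_fst_def)
  qed (simp add: lift_fst_def coord_vec_def)
qed

lemma lift_snd_coord_vec:
  assumes ab: "a \<in> \<A>" "b \<in> \<B>" "fst p \<in> fst a" "snd p \<in> fst b"
  shows "lift_snd \<M> p (coord_vec \<B> b (snd p) v) = coord_vec \<M> (prod_chart a b) p (0, v)"
proof
  fix f show "lift_snd \<M> p (coord_vec \<B> b (snd p) v) f = coord_vec \<M> (prod_chart a b) p (0, v) f"
  proof (cases "smooth_at \<M> p f")
    case True
    then show ?thesis
      using coord_vec_prod[OF True ab, of 0 v] linear_0[OF X.coord_vec_linear[OF ab(1,3)]]
      by (simp add: lift_snd_def)
  qed (simp add: lift_snd_def coord_vec_def)
qed

section \<open>Lifted vectors and vector fields\<close>

lemma lift_fst_tangent: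
  assumes "D \<in> tangent_space \<A> (fst p)" "snd p \<in> points \<B>"
  shows "lift_fst \<M> p D \<in> tangent_space \<M> p"
proof -
  obtain a u where a: "a \<in> \<A>" "fst p \<in> fst a" and D: "D = coord_vec \<A> a (fst p) u"
    using assms(1) by (rule X.tangentE)
  obtain b where b: "b \<in> \<B>" "snd p \<in> fst b" using assms(2) by (rule Y.chartE)
  show ?thesis
    unfolding D lift_fst_coord_vec[OF a(1) b(1) a(2) b(2)]
    by (rule M.coord_vec_tangent[OF prod_chart_in[OF a(1) b(1)]]) (use a b in \<open>simp add: mem_Times_iff\<close>)
qed

lemma lift_snd_tangent:
  assumes "D \<in> tangent_space \<B> (snd p)" "fst p \<in> points \<A>"
  shows "lift_snd \<M> p D \<in> tangent_space \<M> p"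
proof -
  obtain b u where b: "b \<in> \<B>" "snd p \<in> fst b" and D: "D = coord_vec \<B> b (snd p) u"
    using assms(1) by (rule Y.tangentE)
  obtain a where a: "a \<in> \<A>" "fst p \<in> fst a" using assms(2) by (rule X.chartE)
  show ?thesis
    unfolding D lift_snd_coord_vec[OF a(1) b(1) a(2) b(2)]
    by (rule M.coord_vec_tangent[OF prod_chart_in[OF a(1) b(1)]]) (use a b in \<open>simp add: mem_Times_iff\<close>)
qed

text \<open>The pullback of f is smooth at p exactly when f is smooth at the projection, so the
  guard in \<open>lift_fst\<close> agrees with the convention that D is 0 on non-smooth
  functions.\<close>

lemma lift_fst_fst [simp]:
  assumes "D \<in> tangent_space \<A> (fst p)" "snd p \<in> points \<B>"
  shows "lift_fst \<M> p D (\<lambda>q. f (fst q)) = D f"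
  using smooth_at_fst[of p f] smooth_at_slice_fst[of p "\<lambda>q. f (fst q)"] X.tangent_nonsmooth[OF assms(1), of f] assms(2)
  by (auto simp: lift_fst_def)

lemma lift_snd_snd [simp]:
  assumes "D \<in> tangent_space \<B> (snd p)" "fst p \<in> points \<A>"
  shows "lift_snd \<M> p D (\<lambda>q. f (snd q)) = D f"
  using smooth_at_snd[of p f] smooth_at_slice_snd[of p "\<lambda>q. f (snd q)"] Y.tangent_nonsmooth[OF assms(1), of f] assms(2)
  by (auto simp: lift_snd_def)

lemma lift_fst_snd [simp]:
  "D \<in> tangent_space \<A> (fst p) \<Longrightarrow> lift_fst \<M> p D (\<lambda>q. f (snd q)) = 0"
  by (simp add: lift_fst_def X.tangent_const)

lemma lift_snd_fst [simp]:
  "D \<in> tangent_space \<B> (snd p) \<Longrightarrow> lift_snd \<M> p D (\<lambda>q. f (fst q)) = 0"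
  by (simp add: lift_snd_def Y.tangent_const)

lemma prod_coordinate: "snd (prod_chart a b) q \<bullet> w = snd a (fst q) \<bullet> fst w + snd b (snd q) \<bullet> snd w"
  by (simp add: map_prod_def split_beta inner_prod_def)

text \<open>Each coordinate of the product is a sum of functions pulled back from the factors, by
  \<open>prod_coordinate\<close>, so smoothness may be tested on pullbacks.\<close>

lemma vector_field_prodI:
  assumes t: "\<And>p. p \<in> points \<M> \<Longrightarrow> V p \<in> tangent_space \<M> p"
    and 1: "\<And>p f. p \<in> points \<M> \<Longrightarrow> smooth_at \<A> (fst p) f \<Longrightarrow> smooth_at \<M> p (\<lambda>q. V q (\<lambda>r. f (fst r)))"
    and 2: "\<And>p f. p \<in> points \<M> \<Longrightarrow> smooth_at \<B> (snd p) f \<Longrightarrow> smooth_at \<M> p (\<lambda>q. V q (\<lambda>r. f (snd r)))"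
  shows "vector_field \<M> V"
proof (rule M.vector_fieldI[OF t])
  fix p c and w :: "'e \<times> 'd" assume cM: "c \<in> \<M>" and pc: "p \<in> fst c"
  then obtain a b where ab: "a \<in> \<A>" "b \<in> \<B>" and c: "c = prod_chart a b"
    unfolding in_prod_atlas by blast
  have p: "p \<in> points \<M>" "fst p \<in> fst a" "snd p \<in> fst b" using M.points_chart[OF cM pc] pc c by auto
  have "smooth_at \<M> p (\<lambda>q. V q (\<lambda>r. snd a (fst r) \<bullet> fst w) + V q (\<lambda>r. snd b (snd r) \<bullet> snd w))"
    by (intro M.smooth_at_add 1[OF p(1)] 2[OF p(1)] X.smooth_at_coordinate[OF ab(1) p(2)]
        Y.smooth_at_coordinate[OF ab(2) p(3)])
  moreover have "\<forall>\<^sub>F q in nbhds \<M> p. V q (\<lambda>r. snd c r \<bullet> w)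
      = V q (\<lambda>r. snd a (fst r) \<bullet> fst w) + V q (\<lambda>r. snd b (snd r) \<bullet> snd w)"
    using M.eventually_in_chart[OF cM pc]
  proof eventually_elim
    case (elim q)
    then have q: "q \<in> points \<M>" "fst q \<in> fst a" "snd q \<in> fst b" using M.points_chart[OF cM elim] c by auto
    show ?case
      unfolding c prod_coordinate
      by (rule M.tangent_add[OF t[OF q(1)]])
         (use q ab in \<open>auto simp: mem_Times_iff intro!: smooth_at_fst smooth_at_snd X.smooth_at_coordinate Y.smooth_at_coordinate\<close>)
  qed
  ultimately show "smooth_at \<M> p (\<lambda>q. V q (\<lambda>r. snd c r \<bullet> w))" by (rule M.smooth_at_cong_imp)
qed

lemma vector_field_lift_fst:
  assumes V: "vector_field \<A> V"
  shows "vector_field \<M> (\<lambda>p. lift_fst \<M> p (V (fst p)))"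
proof (rule vector_field_prodI)
  fix p assume p: "p \<in> points \<M>"
  have t: "V (fst q) \<in> tangent_space \<A> (fst q)" "snd q \<in> points \<B>" if "q \<in> points \<M>" for q
    using X.vector_field_tangent[OF V] that by (auto simp: mem_Times_iff)
  show "lift_fst \<M> p (V (fst p)) \<in> tangent_space \<M> p" by (rule lift_fst_tangent[OF t[OF p]])
  note ev = eventually_mono[OF M.eventually_in_points[OF p]]
  show "smooth_at \<M> p (\<lambda>q. lift_fst \<M> q (V (fst q)) (\<lambda>r. f (fst r)))" if "smooth_at \<A> (fst p) f" for f
    by (rule M.smooth_at_cong_imp[OF smooth_at_fst[OF X.vector_field_smooth[OF V that] t(2)[OF p]] ev])
       (rule lift_fst_fst[OF t])
  show "smooth_at \<M> p (\<lambda>q. lift_fst \<M> q (V (fst q)) (\<lambda>r. f (snd r)))" for f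
    by (rule M.smooth_at_cong_imp[OF M.smooth_at_const[OF p] ev]) (rule lift_fst_snd[OF t(1)])
qed

lemma vector_field_lift_snd:
  assumes V: "vector_field \<B> V"
  shows "vector_field \<M> (\<lambda>p. lift_snd \<M> p (V (snd p)))"
proof (rule vector_field_prodI)
  fix p assume p: "p \<in> points \<M>"
  have t: "V (snd q) \<in> tangent_space \<B> (snd q)" "fst q \<in> points \<A>" if "q \<in> points \<M>" for q
    using Y.vector_field_tangent[OF V] that by (auto simp: mem_Times_iff)
  show "lift_snd \<M> p (V (snd p)) \<in> tangent_space \<M> p" by (rule lift_snd_tangent[OF t[OF p]])
  note ev = eventually_mono[OF M.eventually_in_points[OF p]]
  show "smooth_at \<M> p (\<lambda>q. lift_snd \<M> q (V (snd q)) (\<lambda>r. f (snd r)))" if "smooth_at \<B> (snd p) f" for f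
    by (rule M.smooth_at_cong_imp[OF smooth_at_snd[OF Y.vector_field_smooth[OF V that] t(2)[OF p]] ev])
       (rule lift_snd_snd[OF t])
  show "smooth_at \<M> p (\<lambda>q. lift_snd \<M> q (V (snd q)) (\<lambda>r. f (fst r)))" for f
    by (rule M.smooth_at_cong_imp[OF M.smooth_at_const[OF p] ev]) (rule lift_snd_fst[OF t(1)])
qed

section \<open>Projections of tangent vectors and pullbacks of forms\<close>

lemma push_fst_coord_vec:
  assumes ab: "a \<in> \<A>" "b \<in> \<B>" "fst p \<in> fst a" "snd p \<in> fst b"
  shows "(\<lambda>f. coord_vec \<M> (prod_chart a b) p w (\<lambda>q. f (fst q))) = coord_vec \<A> a (fst p) (fst w)"
proof
  fix f
  have p: "p \<in> points \<M>"
    using ab X.points_chart Y.points_chart by (simp add: mem_Times_iff)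
  show "coord_vec \<M> (prod_chart a b) p w (\<lambda>q. f (fst q)) = coord_vec \<A> a (fst p) (fst w) f"
  proof (cases "smooth_at \<A> (fst p) f")
    case True
    then have "smooth_at \<M> p (\<lambda>q. f (fst q))" using smooth_at_fst_iff[OF p] by blast
    from coord_vec_prod[OF this ab, of "fst w" "snd w"] show ?thesis
      using Y.tangent_const[OF Y.coord_vec_tangent[OF ab(2,4)]] by simp
  next
    case False
    then show ?thesis using smooth_at_fst_iff[OF p, of f] by (simp add: coord_vec_def)
  qed
qed

lemma push_snd_coord_vec:
  assumes ab: "a \<in> \<A>" "b \<in> \<B>" "fst p \<in> fst a" "snd p \<in> fst b"
  shows "(\<lambda>f. coord_vec \<M> (prod_chart a b) p w (\<lambda>q. f (snd q))) = coord_vec \<B> b (snd p) (snd w)"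
proof
  fix f
  have p: "p \<in> points \<M>"
    using ab X.points_chart Y.points_chart by (simp add: mem_Times_iff)
  show "coord_vec \<M> (prod_chart a b) p w (\<lambda>q. f (snd q)) = coord_vec \<B> b (snd p) (snd w) f"
  proof (cases "smooth_at \<B> (snd p) f")
    case True
    then have "smooth_at \<M> p (\<lambda>q. f (snd q))" using smooth_at_snd_iff[OF p] by blast
    from coord_vec_prod[OF this ab, of "fst w" "snd w"] show ?thesis
      using X.tangent_const[OF X.coord_vec_tangent[OF ab(1,3)]] by simp
  next
    case False
    then show ?thesis using smooth_at_snd_iff[OF p, of f] by (simp add: coord_vec_def)
  qed
qed

lemma product_tangentE:
  assumes "D \<in> tangent_space \<M> p"
  obtains a b w where "a \<in> \<A>" "b \<in> \<B>" "fst p \<in> fst a" "snd p \<in> fst b"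
    "D = coord_vec \<M> (prod_chart a b) p w"
proof -
  obtain c w where "c \<in> \<M>" "p \<in> fst c" "D = coord_vec \<M> c p w"
    using assms by (rule M.tangentE)
  moreover from this(1) obtain a b where "a \<in> \<A>" "b \<in> \<B>" "c = prod_chart a b"
    unfolding in_prod_atlas by blast
  ultimately show thesis using that by (simp add: mem_Times_iff)
qed

lemma push_fst_tangent:
  assumes "D \<in> tangent_space \<M> p"
  shows "(\<lambda>f. D (\<lambda>q. f (fst q))) \<in> tangent_space \<A> (fst p)"
  by (rule product_tangentE[OF assms]) (simp add: push_fst_coord_vec X.coord_vec_tangent)

lemma push_snd_tangent:
  assumes "D \<in> tangent_space \<M> p"
  shows "(\<lambda>f. D (\<lambda>q. f (snd q))) \<in> tangent_space \<B> (snd p)"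
  by (rule product_tangentE[OF assms]) (simp add: push_snd_coord_vec Y.coord_vec_tangent)

text \<open>The two projections of a coordinate vector carry the two halves of its direction w,
  which coordinate functions of the factors detect.\<close>

lemma product_tangent_eq_zero:
  assumes "D \<in> tangent_space \<M> p"
    and 1: "(\<lambda>f. D (\<lambda>q. f (fst q))) = (\<lambda>f. 0)" and 2: "(\<lambda>f. D (\<lambda>q. f (snd q))) = (\<lambda>f. 0)"
  shows "D = (\<lambda>f. 0)"
proof -
  obtain a b w where ab: "a \<in> \<A>" "b \<in> \<B>" "fst p \<in> fst a" "snd p \<in> fst b"
    and D: "D = coord_vec \<M> (prod_chart a b) p w"
    using assms(1) by (rule product_tangentE)
  have "fst w \<bullet> i = 0" for i
    using X.coord_vec_coordinate[OF ab(1,3), of "fst w" i] 1 unfolding D push_fst_coord_vec[OF ab] by simp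
  moreover have "snd w \<bullet> i = 0" for i
    using Y.coord_vec_coordinate[OF ab(2,4), of "snd w" i] 2 unfolding D push_snd_coord_vec[OF ab] by simp
  ultimately have "w = 0" by (metis inner_eq_zero_iff prod.collapse zero_prod_def)
  moreover have "p \<in> fst (prod_chart a b)" using ab by (simp add: mem_Times_iff)
  ultimately show ?thesis
    unfolding D using linear_0[OF M.coord_vec_linear[OF prod_chart_in[OF ab(1,2)]]] by (intro ext) blast
qed

lemma one_form_pull_fst:
  assumes "one_form \<A> \<theta>" shows "one_form \<M> (pull_fst \<theta>)"
  unfolding one_form_def
proof (intro ballI conjI allI impI)
  fix p D E r assume "D \<in> tangent_space \<M> p" "E \<in> tangent_space \<M> p"
  then show "pull_fst \<theta> p (\<lambda>f. r * D f + E f) = r * pull_fst \<theta> p D + pull_fst \<theta> p E"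
    unfolding pull_fst_def by (rule X.one_form_lincomb[OF assms push_fst_tangent push_fst_tangent])
next
  fix p c and u :: "'e \<times> 'd" assume cM: "c \<in> \<M>" and pc: "p \<in> fst c"
  then obtain a b where ab: "a \<in> \<A>" "b \<in> \<B>" and c: "c = prod_chart a b"
    unfolding in_prod_atlas by blast
  have p: "fst p \<in> fst a" "snd p \<in> fst b" using pc c by auto
  have "smooth_at \<A> (fst p) (\<lambda>x. \<theta> x (coord_vec \<A> a x (fst u)))"
    using assms ab p X.points_chart[OF ab(1) p(1)] unfolding one_form_def by blast
  then have "smooth_at \<M> p (\<lambda>q. \<theta> (fst q) (coord_vec \<A> a (fst q) (fst u)))"
    by (rule smooth_at_fst) (rule Y.points_chart[OF ab(2) p(2)])
  moreover have "\<forall>\<^sub>F q in nbhds \<M> p.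
      pull_fst \<theta> q (coord_vec \<M> c q u) = \<theta> (fst q) (coord_vec \<A> a (fst q) (fst u))"
    using M.eventually_in_chart[OF cM pc]
    by eventually_elim (auto simp: c pull_fst_def push_fst_coord_vec[OF ab])
  ultimately show "smooth_at \<M> p (\<lambda>q. pull_fst \<theta> q (coord_vec \<M> c q u))"
    by (rule M.smooth_at_cong_imp)
qed

lemma one_form_pull_snd:
  assumes "one_form \<B> \<theta>" shows "one_form \<M> (pull_snd \<theta>)"
  unfolding one_form_def
proof (intro ballI conjI allI impI)
  fix p D E r assume "D \<in> tangent_space \<M> p" "E \<in> tangent_space \<M> p"
  then show "pull_snd \<theta> p (\<lambda>f. r * D f + E f) = r * pull_snd \<theta> p D + pull_snd \<theta> p E"
    unfolding pull_snd_def by (rule Y.one_form_lincomb[OF assms push_snd_tangent push_snd_tangent])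
next
  fix p c and u :: "'e \<times> 'd" assume cM: "c \<in> \<M>" and pc: "p \<in> fst c"
  then obtain a b where ab: "a \<in> \<A>" "b \<in> \<B>" and c: "c = prod_chart a b"
    unfolding in_prod_atlas by blast
  have p: "fst p \<in> fst a" "snd p \<in> fst b" using pc c by auto
  have "smooth_at \<B> (snd p) (\<lambda>x. \<theta> x (coord_vec \<B> b x (snd u)))"
    using assms ab p Y.points_chart[OF ab(2) p(2)] unfolding one_form_def by blast
  then have "smooth_at \<M> p (\<lambda>q. \<theta> (snd q) (coord_vec \<B> b (snd q) (snd u)))"
    by (rule smooth_at_snd) (rule X.points_chart[OF ab(1) p(1)])
  moreover have "\<forall>\<^sub>F q in nbhds \<M> p.
      pull_snd \<theta> q (coord_vec \<M> c q u) = \<theta> (snd q) (coord_vec \<B> b (snd q) (snd u))"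
    using M.eventually_in_chart[OF cM pc]
    by eventually_elim (auto simp: c pull_snd_def push_snd_coord_vec[OF ab])
  ultimately show "smooth_at \<M> p (\<lambda>q. pull_snd \<theta> q (coord_vec \<M> c q u))"
    by (rule M.smooth_at_cong_imp)
qed

text \<open>Projectable fields have projectable brackets: near p the inner derivative of a pullback
  is again a pullback, to which the outer field applies in the same way. The fields v_K project to
  b_K, the vertical ones to the zero field.\<close>

lemma push_fst_lie_bracket:
  assumes V: "vector_field \<M> V" "vector_field \<M> V'"
    and W: "\<And>q f. q \<in> points \<M> \<Longrightarrow> V q (\<lambda>r. f (fst r)) = W (fst q) f"
      "\<And>q f. q \<in> points \<M> \<Longrightarrow> V' q (\<lambda>r. f (fst r)) = W' (fst q) f"
    and p: "p \<in> points \<M>"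
  shows "(\<lambda>f. lie_bracket \<M> V V' p (\<lambda>q. f (fst q))) = lie_bracket \<A> W W' (fst p)"
proof
  fix f :: "'a \<Rightarrow> real"
  have 1: "V p (\<lambda>q. V' q (\<lambda>r. f (fst r))) = W (fst p) (\<lambda>x. W' x f)"
    if "vector_field \<M> V"
      "\<And>q f. q \<in> points \<M> \<Longrightarrow> V q (\<lambda>r. f (fst r)) = W (fst q) f"
      "\<And>q f. q \<in> points \<M> \<Longrightarrow> V' q (\<lambda>r. f (fst r)) = W' (fst q) f" for V V' :: "('a \<times> 'b) vfield" and W W' :: "'a vfield"
  proof -
    have "\<forall>\<^sub>F q in nbhds \<M> p. V' q (\<lambda>r. f (fst r)) = W' (fst q) f"
      using M.eventually_in_points[OF p] by eventually_elim (rule that(3))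
    then have "V p (\<lambda>q. V' q (\<lambda>r. f (fst r))) = V p (\<lambda>q. W' (fst q) f)"
      by (rule M.tangent_cong[OF M.vector_field_tangent[OF that(1) p]])
    then show ?thesis using that(2)[OF p, of "\<lambda>x. W' x f"] by simp
  qed
  show "lie_bracket \<M> V V' p (\<lambda>q. f (fst q)) = lie_bracket \<A> W W' (fst p) f"
    unfolding lie_bracket_def smooth_at_fst_iff[OF p, of f]
    using 1[where V=V and V'=V' and W=W and W'=W', OF V(1) W] 1[where V=V' and V'=V and W=W' and W'=W, OF V(2) W(2,1)] by simp
qed

end

section \<open>The group\<close>

text \<open>\<open>G_atlas\<close> asks for a smooth \<open>inv_into\<close>. An explicit two-sided
  inverse \<open>\<psi>\<close>, smooth on its open domain, coincides with it there.\<close>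

lemma G_atlasI:
  assumes "open W" "open S" "smooth_on W \<phi>" "smooth_on S \<psi>"
    and 1: "\<And>q. q \<in> G_set \<inter> W \<Longrightarrow> \<phi> q \<in> S \<and> \<psi> (\<phi> q) = q"
    and 2: "\<And>w. w \<in> S \<Longrightarrow> \<psi> w \<in> G_set \<inter> W \<and> \<phi> (\<psi> w) = w"
  shows "(G_set \<inter> W, \<phi>) \<in> G_atlas"
proof -
  have inj: "inj_on \<phi> (G_set \<inter> W)" by (rule inj_on_inverseI[of _ \<psi>]) (use 1 in blast)
  have im: "\<phi> ` (G_set \<inter> W) = S"
  proof
    show "S \<subseteq> \<phi> ` (G_set \<inter> W)" using 2 by (metis image_eqI subsetI)
  qed (use 1 in blast)
  have "inv_into (G_set \<inter> W) \<phi> w = \<psi> w" if "w \<in> S" for w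
    by (rule inv_into_f_eq[OF inj]) (use 2[OF that] in auto)
  then have "smooth_on S (inv_into (G_set \<inter> W) \<phi>)"
    by (rule smooth_on_cong[OF assms(2,4)])
  then show ?thesis unfolding G_atlas_def using assms inj im by auto
qed

lemma G_atlasE:
  assumes "c \<in> G_atlas"
  obtains W where "open W" "fst c = G_set \<inter> W" "smooth_on W (snd c)" "inj_on (snd c) (fst c)"
    "open (snd c ` fst c)" "smooth_on (snd c ` fst c) (cinv c)"
  using assms unfolding G_atlas_def by (cases c) auto

text \<open>Coordinate maps are smooth on ambient open sets and their inverses are smooth into the
  ambient space, so transition maps are compositions of smooth maps between Euclidean spaces. An
  overlap appears in coordinates as the preimage of an ambient open set.\<close>

interpretation G: smooth_atlas G_atlas
proof
  fix c assume "c \<in> G_atlas"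
  then obtain W where c: "open W" "fst c = G_set \<inter> W" "smooth_on W (snd c)" "inj_on (snd c) (fst c)"
    "open (snd c ` fst c)" "smooth_on (snd c ` fst c) (cinv c)" by (rule G_atlasE)
  show "inj_on (snd c) (fst c)" by (rule c(4))
  fix d assume "d \<in> G_atlas"
  then obtain W' where d: "open W'" "fst d = G_set \<inter> W'" "smooth_on W' (snd d)" by (rule G_atlasE)
  have eq: "snd c ` (fst c \<inter> fst d) = snd c ` fst c \<inter> cinv c -` W'"
  proof (rule set_eqI)
    fix z
    have "cinv c (snd c q) = q" if "q \<in> fst c" for q using c(4) that by simp
    then show "z \<in> snd c ` (fst c \<inter> fst d) \<longleftrightarrow> z \<in> snd c ` fst c \<inter> cinv c -` W'"
      unfolding c(2) d(2) by (auto simp: image_iff)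
  qed
  show o: "open (snd c ` (fst c \<inter> fst d))"
    unfolding eq by (rule continuous_open_preimage[OF smooth_on_continuous[OF c(6)] c(5) d(1)])
  have "smooth_on (snd c ` (fst c \<inter> fst d)) (\<lambda>z. snd d (cinv c z))"
    by (rule smooth_on_compose[OF o d(1) _ smooth_on_subset[OF c(6)] d(3)]) (use eq in auto)
  then show "smooth_on (snd c ` (fst c \<inter> fst d)) (snd d \<circ> cinv c)" by (simp add: o_def)
qed

lemma smooth_on_vec:
  fixes f :: "'e::euclidean_space \<Rightarrow> 'b::euclidean_space ^ 'n"
  assumes "open S" "\<And>i. smooth_on S (\<lambda>x. f x $ i)"
  shows "smooth_on S f"
proof -
  have "linear (axis i :: 'b \<Rightarrow> 'b ^ 'n)" for i
    by (rule linearI) (auto simp: vec_eq_iff axis_def)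
  then have "bounded_linear (axis i :: 'b \<Rightarrow> 'b ^ 'n)" for i by (simp add: linear_conv_bounded_linear)
  then have "smooth_on S (\<lambda>x. \<Sum>i\<in>UNIV. axis i (f x $ i))"
    using assms by (intro smooth_on_sum smooth_on_bounded_linear[of "axis _"])
  then show ?thesis
  proof (rule smooth_on_cong[OF assms(1)])
    show "f x = (\<Sum>i\<in>UNIV. axis i (f x $ i))" for x
      by (simp add: vec_eq_iff axis_def)
  qed
qed

lemma smooth_on_Complex:
  assumes "open S" "smooth_on S f" "smooth_on S g"
  shows "smooth_on S (\<lambda>x. Complex (f x) (g x))"
proof -
  have "smooth_on S (\<lambda>x. f x *\<^sub>R 1 + g x *\<^sub>R \<i>)"
    by (rule smooth_on_add[OF assms(1) smooth_on_scaleR smooth_on_scaleR]) (auto intro: assms smooth_on_const)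
  then show ?thesis by (rule smooth_on_cong[OF assms(1)]) (simp add: complex_eq_iff)
qed

text \<open>Near the identity, \<open>SL(2,R)\<close> is parametrised by all matrix entries but the last, and \<open>U(1)\<close>
  by stereographic projection from \<open>-1\<close>; both directions are rational.\<close>

definition G_coord :: "gpoint \<Rightarrow> real^4" where
  "G_coord q = (\<chi> i. if i = 1 then fst q $ 1 $ 1 else if i = 2 then fst q $ 1 $ 2
     else if i = 3 then fst q $ 2 $ 1 else Im (snd q) * inverse (1 + Re (snd q)))"

definition G_param :: "real^4 \<Rightarrow> gpoint" where
  "G_param w = (\<chi> i j. if i = 1 then (if j = 1 then w $ 1 else w $ 2)
       else (if j = 1 then w $ 3 else (1 + w $ 2 * w $ 3) * inverse (w $ 1)),
     Complex ((1 - w $ 4 * w $ 4) * inverse (1 + w $ 4 * w $ 4)) (2 * w $ 4 * inverse (1 + w $ 4 * w $ 4)))"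

text \<open>Where the two denominators, the entry at position (1,1) and 1 + Re z, are positive. On
  the group \<open>G_coord\<close> maps this set onto the half-space of positive first
  coordinate.\<close>

definition G_dom :: "gpoint set" where
  "G_dom = {q. 0 < fst q $ 1 $ 1 \<and> -1 < Re (snd q)}"

lemma open_G_dom: "open G_dom"
  unfolding G_dom_def by (intro open_Collect_conj open_Collect_less continuous_intros)

lemma smooth_on_G_coord: "smooth_on G_dom G_coord"
proof (rule smooth_on_vec[OF open_G_dom])
  have bl: "bounded_linear (\<lambda>q::gpoint. fst q $ i $ j)" for i j
    unfolding linear_conv_bounded_linear[symmetric] by (rule linearI) auto
  have bl': "bounded_linear (\<lambda>q::gpoint. Re (snd q))" "bounded_linear (\<lambda>q::gpoint. Im (snd q))"
    unfolding linear_conv_bounded_linear[symmetric] by (rule linearI; simp)+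
  note lin = smooth_on_linear[OF _ open_G_dom]
  have "smooth_on G_dom (\<lambda>q. Im (snd q) * inverse (1 + Re (snd q)))"
    by (intro smooth_on_mult[OF open_G_dom] smooth_on_inverse[OF open_G_dom] smooth_on_add[OF open_G_dom]
        smooth_on_const lin[OF bl'(1)] lin[OF bl'(2)]) (auto simp: G_dom_def)
  then show "smooth_on G_dom (\<lambda>q. G_coord q $ i)" for i
    using lin[OF bl] by (cases "i = 1"; cases "i = 2"; cases "i = 3") (simp_all add: G_coord_def)
qed

lemma smooth_on_G_param: "smooth_on {w. 0 < w $ 1} G_param"
proof -
  let ?S = "{w :: real^4. 0 < w $ 1}"
  have o: "open ?S" by (intro open_Collect_less continuous_intros)
  have x: "smooth_on ?S (\<lambda>w. w $ i)" for i
    by (rule smooth_on_linear[OF bounded_linear_vec_nth o])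
  note ops = smooth_on_mult[OF o] smooth_on_inverse[OF o] smooth_on_add[OF o] smooth_on_const x
  have t: "smooth_on ?S (\<lambda>w. inverse (1 + w $ 4 * w $ 4))"
    by (intro ops) (metis add_pos_nonneg less_irrefl zero_le_square zero_less_one)
  have "smooth_on ?S (\<lambda>w. (1 + (- w $ 4) * w $ 4) * inverse (1 + w $ 4 * w $ 4))"
    by (intro smooth_on_mult[OF o] smooth_on_add[OF o] smooth_on_const x t smooth_on_minus[OF o])
  then have 1: "smooth_on ?S (\<lambda>w. (1 - w $ 4 * w $ 4) * inverse (1 + w $ 4 * w $ 4))"
    by simp
  have 2: "smooth_on ?S (\<lambda>w. 2 * w $ 4 * inverse (1 + w $ 4 * w $ 4))"
    by (intro smooth_on_mult[OF o] smooth_on_const x t)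
  have 3: "smooth_on ?S (\<lambda>w. (1 + w $ 2 * w $ 3) * inverse (w $ 1))"
    by (intro ops) auto
  have "smooth_on ?S (\<lambda>w. fst (G_param w) $ i $ j)" for i j
    using 3 x by (cases "i = 1"; cases "j = 1") (simp_all add: G_param_def)
  then have "smooth_on ?S (\<lambda>w. fst (G_param w))"
    by (intro smooth_on_vec[OF o])
  moreover have "smooth_on ?S (\<lambda>w. snd (G_param w))"
    using smooth_on_Complex[OF o 1 2] by (simp add: G_param_def)
  ultimately have "smooth_on ?S (\<lambda>w. (fst (G_param w), snd (G_param w)))"
    by (rule smooth_on_Pair[OF o])
  then show ?thesis by simp
qed

lemma G_param_coord:
  assumes "q \<in> G_set" "q \<in> G_dom" shows "0 < G_coord q $ 1" "G_param (G_coord q) = q"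
proof -
  obtain A z where q: "q = (A, z)" by (cases q)
  have A: "0 < A $ 1 $ 1" "A $ 1 $ 1 * A $ 2 $ 2 = 1 + A $ 1 $ 2 * A $ 2 $ 1"
    using assms by (auto simp: q G_set_def G_dom_def det_2)
  show "0 < G_coord q $ 1" using A by (simp add: G_coord_def q)
  obtain x y where z: "z = Complex x y" by (cases z)
  have xy: "x * x + y * y = 1" "0 < 1 + x"
    using assms by (auto simp: q z G_set_def G_dom_def cmod_def power2_eq_square)
  \<comment> \<open>The tangent of half the angle of z; x and y are recovered from it through the
    half-angle identity (1 + t^2) (1 + x) = 2.\<close>
  define t where "t = y * inverse (1 + x)"
  have "y = t * (1 + x)" using xy(2) by (simp add: t_def)
  then have "(1 + t * t) * ((1 + x) * (1 + x)) = (1 + x) * (1 + x) + y * y" by (simp add: algebra_simps)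
  also have "\<dots> = 2 * (1 + x)" using xy(1) by (simp add: algebra_simps)
  finally have "((1 + t * t) * (1 + x)) * (1 + x) = 2 * (1 + x)" by (simp only: mult.assoc)
  then have tt: "(1 + t * t) * (1 + x) = 2" using xy(2) by (metis less_irrefl mult_right_cancel)
  then have inv: "inverse (1 + t * t) = (1 + x) / 2" by (intro inverse_unique) simp
  have "(1 - t * t) * (1 + x) = 2 * x" using tt by (simp add: algebra_simps)
  then have "(1 - t * t) * inverse (1 + t * t) = x" unfolding inv by simp
  moreover have "2 * t * inverse (1 + t * t) = y"
    unfolding inv using xy(2) by (simp add: t_def)
  ultimately have "snd (G_param (G_coord q)) = z"
    by (simp add: G_param_def G_coord_def q z t_def)
  moreover have "fst (G_param (G_coord q)) = A"
    using A by (simp add: G_param_def G_coord_def q vec_eq_iff forall_2 field_simps)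
  ultimately show "G_param (G_coord q) = q" by (simp add: q prod_eq_iff)
qed

lemma G_coord_param:
  assumes "0 < w $ 1" shows "G_param w \<in> G_set" "G_param w \<in> G_dom" "G_coord (G_param w) = w"
proof -
  define t where "t = w $ 4"
  have t: "0 < 1 + t * t" by (simp add: add_pos_nonneg)
  have z: "snd (G_param w) = Complex ((1 - t * t) / (1 + t * t)) (2 * t / (1 + t * t))"
    by (simp add: G_param_def t_def divide_inverse)
  have Re1: "1 + Re (snd (G_param w)) = 2 / (1 + t * t)" unfolding z using t by (simp add: field_simps)
  have "((1 - t * t) / (1 + t * t))\<^sup>2 + (2 * t / (1 + t * t))\<^sup>2 = 1"
    using t by (simp add: power_divide add_divide_distrib[symmetric] divide_eq_eq) (simp add: power2_eq_square algebra_simps)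
  then have "cmod (snd (G_param w)) = 1" unfolding z by (simp add: cmod_def)
  moreover have "det (fst (G_param w)) = 1" using assms by (simp add: det_2 G_param_def field_simps)
  ultimately show "G_param w \<in> G_set" by (simp add: G_set_def split_beta mem_Times_iff)
  have "0 < 1 + Re (snd (G_param w))" unfolding Re1 using t by simp
  then show "G_param w \<in> G_dom" using assms by (simp add: G_dom_def G_param_def)
  have "G_coord (G_param w) $ 4 = w $ 4"
  proof -
    have "G_coord (G_param w) $ 4 = Im (snd (G_param w)) * inverse (1 + Re (snd (G_param w)))"
      by (simp add: G_coord_def)
    also have "\<dots> = t" unfolding Re1 unfolding z using t by (simp add: field_simps)
    finally show ?thesis by (simp add: t_def)
  qed
  then show "G_coord (G_param w) = w"
    by (simp add: vec_eq_iff forall_4) (simp add: G_coord_def G_param_def)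
qed

text \<open>Right translation extends to a linear map of the ambient space. It is therefore smooth,
  and charts can be translated without leaving \<open>G_atlas\<close>.\<close>

lemma bounded_linear_G_mult: "bounded_linear (\<lambda>q. G_mult q r)"
  unfolding linear_conv_bounded_linear[symmetric]
  by (rule linearI)
     (auto simp: G_mult_def matrix_matrix_mult_def vec_eq_iff sum_distrib_left algebra_simps sum.distrib)

section \<open>Translated charts cover the group\<close>

lemma G_mult_in: "q \<in> G_set \<Longrightarrow> r \<in> G_set \<Longrightarrow> G_mult q r \<in> G_set"
  by (auto simp: G_set_def G_mult_def det_mul norm_mult)

definition G_one :: gpoint where "G_one = (mat 1, 1)"

lemma G_one_in: "G_one \<in> G_set" by (simp add: G_one_def G_set_def)

lemma G_mult_one [simp]: "G_mult G_one q = q" "G_mult q G_one = q" by (simp_all add: G_mult_def G_one_def)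

lemma G_mult_assoc: "G_mult (G_mult p q) r = G_mult p (G_mult q r)"
  by (simp add: G_mult_def matrix_mul_assoc mult.assoc)

lemma G_inverse:
  assumes "g \<in> G_set"
  obtains g' where "g' \<in> G_set" "G_mult g g' = G_one" "G_mult g' g = G_one"
proof -
  have "invertible (fst g)" "snd g \<noteq> 0" using assms by (auto simp: G_set_def invertible_det_nz)
  then obtain B where B: "fst g ** B = mat 1" "B ** fst g = mat 1" unfolding invertible_def by blast
  have "det (fst g) * det B = 1" using B(1) by (metis det_I det_mul)
  then have "(B, inverse (snd g)) \<in> G_set" using assms by (auto simp: G_set_def norm_inverse)
  with that B \<open>snd g \<noteq> 0\<close> show thesis by (simp add: G_mult_def G_one_def)
qed

text \<open>A single chart around \<open>G_one\<close> is enough: composed with right multiplication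
  by the inverse of g, it becomes a chart around g.\<close>

lemma points_G_atlas [simp]: "points G_atlas = G_set"
proof
  show "points G_atlas \<subseteq> G_set" unfolding points_def by (auto elim: G_atlasE)
  show "G_set \<subseteq> points G_atlas"
  proof
    fix g assume g: "g \<in> G_set"
    then obtain g' where g': "g' \<in> G_set" "G_mult g g' = G_one" "G_mult g' g = G_one" by (rule G_inverse)
    let ?W = "(\<lambda>q. G_mult q g') -` G_dom" and ?S = "{w :: real^4. 0 < w $ 1}"
    have o: "open ?W" "open ?S"
      by (intro open_vimage open_G_dom linear_continuous_on bounded_linear_G_mult)
         (intro open_Collect_less continuous_intros)
    have "(G_set \<inter> ?W, \<lambda>q. G_coord (G_mult q g')) \<in> G_atlas"
    proof (rule G_atlasI[OF o])
      show "smooth_on ?W (\<lambda>q. G_coord (G_mult q g'))"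
        by (rule smooth_on_compose[OF o(1) open_G_dom _ smooth_on_linear[OF bounded_linear_G_mult o(1)] smooth_on_G_coord]) auto
      show "smooth_on ?S (\<lambda>w. G_mult (G_param w) g)"
        by (rule smooth_on_bounded_linear[OF bounded_linear_G_mult o(2) smooth_on_G_param])
    next
      fix q assume "q \<in> G_set \<inter> ?W"
      then show "G_coord (G_mult q g') \<in> ?S \<and> G_mult (G_param (G_coord (G_mult q g'))) g = q"
        using G_param_coord[of "G_mult q g'"] G_mult_in[of q g'] g' by (simp add: G_mult_assoc)
    next
      fix w :: "real^4" assume "w \<in> ?S"
      then show "G_mult (G_param w) g \<in> G_set \<inter> ?W \<and> G_coord (G_mult (G_mult (G_param w) g) g') = w"
        using G_coord_param[of w] G_mult_in[of "G_param w" g] g g' by (simp add: G_mult_assoc)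
    qed
    moreover have "g \<in> G_set \<inter> ?W" using g g'(2) by (simp add: G_dom_def G_one_def mat_def)
    ultimately show "g \<in> points G_atlas" unfolding points_def by force
  qed
qed

section \<open>Right-invariant fields acting on the phase\<close>

lemma smooth_at_G:
  assumes "smooth_on UNIV f" "q \<in> G_set" shows "smooth_at G_atlas q f"
proof -
  obtain c where c: "c \<in> G_atlas" "q \<in> fst c" using G.chartE[of q] assms(2) by auto
  then obtain W where W: "open (snd c ` fst c)" "smooth_on (snd c ` fst c) (cinv c)" by (elim G_atlasE)
  have "smooth_on (snd c ` fst c) (\<lambda>z. f (cinv c z))"
    by (rule smooth_on_compose[OF W(1) open_UNIV _ W(2) assms(1)]) simp
  then show ?thesis
    by (rule G.smooth_at_chartI[OF c W(1) imageI[OF c(2)]])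
       (use G.eventually_in_chart[OF c] c in \<open>auto elim!: eventually_mono\<close>)
qed

lemma smooth_at_phase:
  assumes "q \<in> G_set"
  shows "smooth_at G_atlas q (\<lambda>s. Re (snd s))" "smooth_at G_atlas q (\<lambda>s. Im (snd s))"
proof -
  have "bounded_linear (\<lambda>q::gpoint. Re (snd q))" "bounded_linear (\<lambda>q::gpoint. Im (snd q))"
    unfolding linear_conv_bounded_linear[symmetric] by (rule linearI; simp)+
  then show "smooth_at G_atlas q (\<lambda>s. Re (snd s))" "smooth_at G_atlas q (\<lambda>s. Im (snd s))"
    by (auto intro!: smooth_at_G[OF _ assms] smooth_on_linear)
qed

text \<open>D acts separately on real and imaginary parts, which multiplication by w mixes. The
  equation for f is known on the group only, which is enough because D is local.\<close>

lemma cderiv_phase_lincomb: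
  assumes "D \<in> tangent_space G_atlas q" "q \<in> G_set"
    and "\<And>s. s \<in> G_set \<Longrightarrow> f s = w * snd s"
  shows "cderiv D f = w * cderiv D snd"
proof -
  note sm = smooth_at_phase[OF assms(2)]
  have ev: "\<forall>\<^sub>F s in nbhds G_atlas q. s \<in> G_set" using G.eventually_in_points[of q] assms(2) by simp
  have "D (\<lambda>s. Re (f s)) = D (\<lambda>s. Re w * Re (snd s) - Im w * Im (snd s))"
    by (rule G.tangent_cong[OF assms(1) eventually_mono[OF ev]]) (simp add: assms(3))
  also have "\<dots> = Re w * D (\<lambda>s. Re (snd s)) - Im w * D (\<lambda>s. Im (snd s))"
    by (simp add: G.tangent_fun_diff[OF assms(1)] G.tangent_cmult[OF assms(1)] G.smooth_at_cmult sm)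
  finally have 1: "D (\<lambda>s. Re (f s)) = \<dots>" .
  have "D (\<lambda>s. Im (f s)) = D (\<lambda>s. Re w * Im (snd s) + Im w * Re (snd s))"
    by (rule G.tangent_cong[OF assms(1) eventually_mono[OF ev]]) (simp add: assms(3))
  also have "\<dots> = Re w * D (\<lambda>s. Im (snd s)) + Im w * D (\<lambda>s. Re (snd s))"
    by (simp add: G.tangent_add[OF assms(1)] G.tangent_cmult[OF assms(1)] G.smooth_at_cmult sm)
  finally show ?thesis using 1 by (simp add: cderiv_def complex_eq_iff)
qed

lemma right_invariant_tangent: "right_invariant V \<Longrightarrow> q \<in> G_set \<Longrightarrow> V q \<in> tangent_space G_atlas q"
  unfolding right_invariant_def using G.vector_field_tangent by simp

text \<open>Right translation by q multiplies the U(1) coordinate by the constant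
  \<open>snd q\<close>. A right-invariant field therefore acts on this coordinate as multiplication
  by one fixed number, its value at the identity.\<close>

lemma right_invariant_phase:
  assumes V: "right_invariant V" and q: "q \<in> G_set"
  shows "cderiv (V q) snd = cderiv (V G_one) snd * snd q"
proof -
  have "V q f = V G_one (\<lambda>s. f (G_mult s q))" if "smooth_at G_atlas q f" for f
    using V G_one_in q that unfolding right_invariant_def by (metis G_mult_one(1))
  then have "cderiv (V q) snd = cderiv (V G_one) (\<lambda>s. snd (G_mult s q))"
    unfolding cderiv_def using smooth_at_phase[OF q] by simp
  also have "\<dots> = snd q * cderiv (V G_one) snd"
    by (rule cderiv_phase_lincomb[OF right_invariant_tangent[OF V G_one_in] G_one_in]) (simp add: G_mult_def)
  finally show ?thesis by simp
qed

text \<open>On the phase both fields act as multiplication by constants, and such operators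
  commute.\<close>

lemma lie_bracket_phase:
  assumes V: "right_invariant V" and W: "right_invariant W" and q: "q \<in> G_set"
  shows "cderiv (lie_bracket G_atlas V W q) snd = 0"
proof -
  have *: "cderiv (V q) (\<lambda>s. cderiv (W s) snd) = cderiv (W G_one) snd * (cderiv (V G_one) snd * snd q)"
    if V: "right_invariant V" and W: "right_invariant W" for V W
    unfolding right_invariant_phase[OF V q, symmetric]
    by (rule cderiv_phase_lincomb[OF right_invariant_tangent[OF V q] q right_invariant_phase[OF W]])
  have "cderiv (lie_bracket G_atlas V W q) snd
      = cderiv (V q) (\<lambda>s. cderiv (W s) snd) - cderiv (W q) (\<lambda>s. cderiv (V s) snd)"
    by (simp add: cderiv_def lie_bracket_def smooth_at_phase[OF q] complex_eq_iff)
  then show ?thesis unfolding *[OF V W] *[OF W V] by simp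
qed

text \<open>Brackets are blind to the abelian factor, so only \<open>a\<^sub>3\<close> moves the phase.\<close>

lemma group_tetrad_phase:
  assumes a: "group_tetrad \<delta> \<delta>0 a" and \<delta>: "\<delta> \<noteq> 0" "\<delta>0 \<noteq> 0" and q: "q \<in> G_set"
  shows "cderiv (a K q) snd = (if K = 3 then - \<i> / of_real \<delta>0 * snd q else 0)"
proof -
  have ri: "right_invariant (a K)" for K using a unfolding group_tetrad_def by blast
  have br: "lie_bracket G_atlas (a J) (a K) q f = 1 / \<delta> * (\<Sum>L\<in>UNIV. struct_const J K L * a L q f)" for J K f
    using a q unfolding group_tetrad_def by blast
  \<comment> \<open>\<open>sum_4\<close> enumerates the index type as 1, 2, 3, 4, and its last
    element is the time index 0.\<close>
  have f4: "(4::4) = 0" by simp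
  have "a 0 q f = \<delta> * lie_bracket G_atlas (a 1) (a 2) q f"
    "a 1 q f = \<delta> * lie_bracket G_atlas (a 0) (a 2) q f"
    "a 2 q f = - \<delta> * lie_bracket G_atlas (a 0) (a 1) q f" for f
    using \<delta> by (simp_all add: br sum_4 struct_const_def f4)
  then have "cderiv (a K q) snd = (if K = 2 then - of_real \<delta> else of_real \<delta>) * cderiv (lie_bracket G_atlas
     (a (if K = 0 then 1 else 0)) (a (if K = 2 then 1 else 2)) q) snd" if "K \<noteq> 3" for K
    using that exhaust_4[of K] by (auto simp: cderiv_def complex_eq_iff)
  then have 1: "cderiv (a K q) snd = 0" if "K \<noteq> 3" for K
    using that lie_bracket_phase[OF ri ri q] by simp
  obtain y where y: "snd q = cis (y / \<delta>0)"
  proof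
    have "snd q = cis (Arg (snd q))" using q by (subst cis_Arg) (auto simp: G_set_def sgn_eq)
    then show "snd q = cis (\<delta>0 * Arg (snd q) / \<delta>0)" using \<delta> by simp
  qed
  have d: "((\<lambda>t. f (fst q, cis (t / \<delta>0))) has_real_derivative - a 3 q f) (at y)" if "smooth_at G_atlas q f" for f
  proof -
    have qy: "(fst q, cis (y / \<delta>0)) = q" by (simp add: y[symmetric])
    have "\<forall>A y f. (A, cis (y / \<delta>0)) \<in> G_set \<longrightarrow> smooth_at G_atlas (A, cis (y / \<delta>0)) f \<longrightarrow>
        ((\<lambda>t. f (A, cis (t / \<delta>0))) has_real_derivative - a 3 (A, cis (y / \<delta>0)) f) (at y)"
      using a unfolding group_tetrad_def by blast
    from this[rule_format, of "fst q" y f] show ?thesis unfolding qy using q that by blast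
  qed
  have "((\<lambda>t. cos (t / \<delta>0)) has_real_derivative - (sin (y / \<delta>0) / \<delta>0)) (at y)"
    using \<delta>(2) by (auto intro!: derivative_eq_intros)
  from DERIV_unique[OF this, of "- a 3 q (\<lambda>s. Re (snd s))"] d[OF smooth_at_phase(1)[OF q]]
  have re: "a 3 q (\<lambda>s. Re (snd s)) = sin (y / \<delta>0) / \<delta>0" by simp
  have "((\<lambda>t. sin (t / \<delta>0)) has_real_derivative cos (y / \<delta>0) / \<delta>0) (at y)"
    using \<delta>(2) by (auto intro!: derivative_eq_intros)
  from DERIV_unique[OF this, of "- a 3 q (\<lambda>s. Im (snd s))"] d[OF smooth_at_phase(2)[OF q]]
  have im: "a 3 q (\<lambda>s. Im (snd s)) = - (cos (y / \<delta>0) / \<delta>0)" by simp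
  have "cderiv (a 3 q) snd = - \<i> / of_real \<delta>0 * snd q"
    unfolding y using \<delta>(2) by (simp add: cderiv_def re im complex_eq_iff)
  with 1 show ?thesis by simp
qed

section \<open>The Kaluza-Klein metric\<close>

lemma sum_UNIV_sum:
  fixes f :: "'a::finite + 'b::finite \<Rightarrow> 'c::comm_monoid_add"
  shows "(\<Sum>i\<in>UNIV. f i) = (\<Sum>i\<in>UNIV. f (Inl i)) + (\<Sum>i\<in>UNIV. f (Inr i))"
  unfolding UNIV_Plus_UNIV[symmetric] by (subst sum.Plus) auto

lemma eta_delta: "eta J K = (if J = K then eta J J else 0)"
  by (simp add: eta_def)

lemma eta_square: "eta J J * eta J J = 1"
  by (simp add: eta_def)

lemma sum_eta:
  fixes f :: "4 \<Rightarrow> real"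
  shows "(\<Sum>K\<in>UNIV. eta J K * f K) = eta J J * f J" "(\<Sum>K\<in>UNIV. eta K J * f K) = eta J J * f J"
  by (subst eta_delta, simp add: mult_delta_left)+

lemma tetrad_metric_diag:
  "tetrad_metric \<theta> p D E = (\<Sum>J\<in>UNIV. eta J J * (\<theta> J p D * \<theta> J p E))"
  unfolding tetrad_metric_def sum_eta ..

lemma tetrad_curvature_diag:
  "tetrad_curvature \<A> h e p =
    (\<Sum>J\<in>UNIV. \<Sum>L\<in>UNIV. eta J J * eta L L * h p (curvature \<A> h (e J) (e L) (e J) p) (e L p))"
proof -
  have "(\<Sum>K\<in>UNIV. \<Sum>L\<in>UNIV. \<Sum>M\<in>UNIV. eta J K * eta L M * T K L M)
      = (\<Sum>L\<in>UNIV. eta J J * eta L L * T J L L)" for J and T :: "4 \<Rightarrow> 4 \<Rightarrow> 4 \<Rightarrow> real"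
    by (simp only: mult.assoc sum_distrib_left[symmetric] sum_eta)
  then show ?thesis unfolding tetrad_curvature_def by simp
qed

lemma sum_Basis_vec:
  fixes f :: "real ^ 'n \<Rightarrow> 'c::comm_monoid_add"
  shows "(\<Sum>b\<in>Basis. f b) = (\<Sum>i\<in>UNIV. f (axis i 1))"
proof -
  have "(Basis :: (real ^ 'n) set) = (\<lambda>i. axis i 1) ` UNIV" by (auto simp: Basis_vec_def)
  moreover have "inj (\<lambda>i. axis i (1::real) :: real ^ 'n)" by (rule injI) (simp add: axis_eq_axis)
  ultimately show ?thesis using sum.reindex[of "\<lambda>i. axis i 1 :: real ^ 'n" UNIV f] by (simp add: o_def)
qed

text \<open>A metric that is diagonal in the vectors E_J turns raising both indices and contracting
  into a signed sum of squares of tetrad components. This is how a coordinate expression becomes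
  comparable with one in the frame.\<close>

lemma contraction_rank_two:
  fixes E :: "'j::finite \<Rightarrow> 'i::finite \<Rightarrow> real" and F :: "'i \<Rightarrow> 'i \<Rightarrow> real"
  assumes g: "\<And>i j. g i j = (\<Sum>J\<in>UNIV. \<epsilon> J * E J i * E J j)"
  shows "(\<Sum>i\<in>UNIV. \<Sum>j\<in>UNIV. F i j * (\<Sum>k\<in>UNIV. \<Sum>l\<in>UNIV. g k i * g l j * F k l))
    = (\<Sum>J\<in>UNIV. \<Sum>K\<in>UNIV. \<epsilon> J * \<epsilon> K * (\<Sum>i\<in>UNIV. \<Sum>j\<in>UNIV. E J i * E K j * F i j)\<^sup>2)"
proof -
  have 1: "(\<Sum>k\<in>UNIV. \<Sum>l\<in>UNIV. g k i * g l j * F k l) =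
     (\<Sum>J\<in>UNIV. \<Sum>K\<in>UNIV. \<epsilon> J * \<epsilon> K * E J i * E K j * (\<Sum>k\<in>UNIV. \<Sum>l\<in>UNIV. E J k * E K l * F k l))" for i j
  proof -
    have "g k i * g l j * F k l = (\<Sum>J\<in>UNIV. \<Sum>K\<in>UNIV. \<epsilon> J * \<epsilon> K * E J i * E K j * (E J k * E K l * F k l))" for k l
      unfolding g sum_product by (simp only: sum_distrib_left sum_distrib_right ac_simps)
    \<comment> \<open>With the indices grouped in pairs, a single \<open>sum.swap\<close> exchanges
      two double sums.\<close>
    then have "(\<Sum>k\<in>UNIV. \<Sum>l\<in>UNIV. g k i * g l j * F k l) =
       (\<Sum>(k, l)\<in>UNIV. \<Sum>(J, K)\<in>UNIV. \<epsilon> J * \<epsilon> K * E J i * E K j * (E J k * E K l * F k l))"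
      unfolding UNIV_Times_UNIV[symmetric] sum.cartesian_product[symmetric] by (simp only:)
    also have "\<dots> = (\<Sum>(J, K)\<in>UNIV. \<Sum>(k, l)\<in>UNIV. \<epsilon> J * \<epsilon> K * E J i * E K j * (E J k * E K l * F k l))"
      unfolding split_def by (rule sum.swap)
    finally show ?thesis
      unfolding UNIV_Times_UNIV[symmetric] sum.cartesian_product[symmetric] sum_distrib_left .
  qed
  have "(\<Sum>i\<in>UNIV. \<Sum>j\<in>UNIV. F i j * (\<Sum>k\<in>UNIV. \<Sum>l\<in>UNIV. g k i * g l j * F k l)) =
     (\<Sum>(i, j)\<in>UNIV. \<Sum>(J, K)\<in>UNIV. \<epsilon> J * \<epsilon> K * (\<Sum>k\<in>UNIV. \<Sum>l\<in>UNIV. E J k * E K l * F k l) * (E J i * E K j * F i j))"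
    unfolding 1 UNIV_Times_UNIV[symmetric] sum.cartesian_product[symmetric]
    unfolding sum_distrib_left[of "F _ _"] by (simp only: ac_simps)
  also have "\<dots> = (\<Sum>(J, K)\<in>UNIV. \<Sum>(i, j)\<in>UNIV. \<epsilon> J * \<epsilon> K * (\<Sum>k\<in>UNIV. \<Sum>l\<in>UNIV. E J k * E K l * F k l) * (E J i * E K j * F i j))"
    unfolding split_def by (rule sum.swap)
  also have "\<dots> = (\<Sum>J\<in>UNIV. \<Sum>K\<in>UNIV. \<epsilon> J * \<epsilon> K * (\<Sum>i\<in>UNIV. \<Sum>j\<in>UNIV. E J i * E K j * F i j)\<^sup>2)"
    unfolding UNIV_Times_UNIV[symmetric] sum.cartesian_product[symmetric] sum_distrib_left[symmetric]
    by (simp only: power2_eq_square mult.assoc)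
  finally show ?thesis .
qed

text \<open>The same diagonalisation for a Hermitian form; the components E are real, so conjugation
  passes to D alone.\<close>

lemma contraction_rank_one:
  fixes E :: "'j::finite \<Rightarrow> 'i::finite \<Rightarrow> real" and D :: "'i \<Rightarrow> complex"
  assumes g: "\<And>i j. g i j = (\<Sum>J\<in>UNIV. \<epsilon> J * E J i * E J j)"
  shows "(\<Sum>i\<in>UNIV. \<Sum>j\<in>UNIV. of_real (g i j) * (cnj (D i) * D j))
    = (\<Sum>J\<in>UNIV. of_real (\<epsilon> J) * (cnj (\<Sum>i\<in>UNIV. of_real (E J i) * D i) * (\<Sum>i\<in>UNIV. of_real (E J i) * D i)))"
proof -
  have "(\<Sum>i\<in>UNIV. \<Sum>j\<in>UNIV. of_real (g i j) * (cnj (D i) * D j))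
    = (\<Sum>i\<in>UNIV. \<Sum>j\<in>UNIV. \<Sum>J\<in>UNIV. of_real (\<epsilon> J) * (of_real (E J i) * cnj (D i) * (of_real (E J j) * D j)))"
    unfolding g by (simp add: sum_distrib_left sum_distrib_right ac_simps)
  also have "\<dots> = (\<Sum>i\<in>UNIV. \<Sum>J\<in>UNIV. \<Sum>j\<in>UNIV. of_real (\<epsilon> J) * (of_real (E J i) * cnj (D i) * (of_real (E J j) * D j)))"
    by (rule sum.cong[OF refl sum.swap])
  also have "\<dots> = (\<Sum>J\<in>UNIV. \<Sum>i\<in>UNIV. \<Sum>j\<in>UNIV. of_real (\<epsilon> J) * (of_real (E J i) * cnj (D i) * (of_real (E J j) * D j)))"
    by (rule sum.swap)
  also have "\<dots> = (\<Sum>J\<in>UNIV. of_real (\<epsilon> J) * (cnj (\<Sum>i\<in>UNIV. of_real (E J i) * D i) * (\<Sum>i\<in>UNIV. of_real (E J i) * D i)))"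
    unfolding cnj_sum complex_cnj_mult complex_cnj_complex_of_real sum_product by (simp only: sum_distrib_left)
  finally show ?thesis .
qed

text \<open>A right inverse of a square matrix is two-sided and unique, hence the one selected by
  \<open>matrix_inv\<close>.\<close>

lemma matrix_inv_eqI:
  fixes A B :: "real ^ 'n ^ 'n" assumes "A ** B = mat 1" shows "matrix_inv A = B"
proof -
  have BA: "B ** A = mat 1" using assms by (rule matrix_left_right_inverse[THEN iffD1])
  have "A ** matrix_inv A = mat 1 \<and> matrix_inv A ** A = mat 1"
    unfolding matrix_inv_def by (rule someI[of _ B]) (use assms BA in simp)
  then have "B ** (A ** matrix_inv A) = B" by simp
  then show ?thesis by (simp add: matrix_mul_assoc BA)
qed

lemma cderiv_sum: "cderiv (\<lambda>f. \<Sum>i\<in>I. r i * D i f) g = (\<Sum>i\<in>I. of_real (r i) * cderiv (D i) g)"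
  by (simp add: cderiv_def complex_eq_iff)

locale kaluza_klein =
  fixes \<A> :: "('x, real^4) atlas"
    and \<kappa>0 \<delta> :: real
    and \<beta> :: "4 \<Rightarrow> 'x oneform" and b :: "4 \<Rightarrow> 'x vfield"
    and \<alpha> :: "4 \<Rightarrow> gpoint oneform" and a :: "4 \<Rightarrow> gpoint vfield"
    and \<rho> \<mu> :: "'x mpoint \<Rightarrow> complex"
    and \<rho>t :: "'x \<Rightarrow> complex" and \<mu>t :: complex
  assumes \<kappa>0_pos: "0 < \<kappa>0" and \<delta>_pos: "0 < \<delta>"
    and atlas: "smooth_atlas \<A>"
    and coframe: "coframe \<A> \<beta>" and dual_X: "dual_tetrads \<A> b \<beta>"
    and group: "group_tetrad \<delta> (delta0 \<delta>) a" and dual_G: "dual_tetrads G_atlas a \<alpha>"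
    and \<rho>_phase: "\<And>x A y. x \<in> points \<A> \<Longrightarrow> det A = 1 \<Longrightarrow>
      \<rho> (x, A, cis (y / delta0 \<delta>)) = cis (y / delta0 \<delta>) * \<rho>t x"
    and \<mu>_phase: "\<And>x A y. x \<in> points \<A> \<Longrightarrow> det A = 1 \<Longrightarrow>
      \<mu> (x, A, cis (y / delta0 \<delta>)) = cis (y / delta0 \<delta>) * \<mu>t"
    and smooth_\<rho>t: "smooth_fun \<A> \<rho>t" and smooth_cmod: "smooth_fun \<A> (\<lambda>x. cmod (\<rho>t x))"
begin

sublocale P: product_atlas \<A> G_atlas
  by (intro product_atlas.intro atlas G.smooth_atlas_axioms)

sublocale X: frame \<A> b \<beta> "\<lambda>K. eta K K" "tetrad_metric \<beta>"
proof
  show "vector_field \<A> (b i)" for i using dual_X unfolding dual_tetrads_def by blast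
  show "one_form \<A> (\<beta> i)" for i using dual_X unfolding dual_tetrads_def by blast
  show "\<beta> i p (b j p) = (if i = j then 1 else 0)" if "p \<in> points \<A>" for i j p
    using dual_X that unfolding dual_tetrads_def by auto
  show "D = (\<lambda>f. 0)" if D: "D \<in> tangent_space \<A> p" and "\<And>i. \<beta> i p D = 0" for D p
    using coframe that P.X.tangent_points[OF D] unfolding coframe_def by blast
qed (simp_all add: eta_square tetrad_metric_diag)

sublocale Gr: frame G_atlas a \<alpha> "\<lambda>K. eta K K" "tetrad_metric \<alpha>"
proof
  show vf: "vector_field G_atlas (a i)" for i using dual_G unfolding dual_tetrads_def by blast
  show of: "one_form G_atlas (\<alpha> i)" for i using dual_G unfolding dual_tetrads_def by blast
  show du: "\<alpha> i p (a j p) = (if i = j then 1 else 0)" if "p \<in> points G_atlas" for i j p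
    using dual_G that unfolding dual_tetrads_def by auto
  show "D = (\<lambda>f. 0)" if D: "D \<in> tangent_space G_atlas p" and zero: "\<And>i. \<alpha> i p D = 0" for D p
  proof (rule G.dual_separating[of a p \<alpha>, OF _ of _ _ D zero])
    have "p \<in> points G_atlas" by (rule G.tangent_points[OF D])
    then show "a i p \<in> tangent_space G_atlas p" "\<alpha> i p (a j p) = (if i = j then 1 else 0)" for i j
      using G.vector_field_tangent[OF vf] du by auto
  qed simp
qed (simp_all add: eta_square tetrad_metric_diag)

abbreviation \<M> :: "('x mpoint, (real^4) \<times> (real^4)) atlas" where "\<M> \<equiv> prod_atlas \<A> G_atlas"

abbreviation hM :: "'x mpoint metric_field" where "hM \<equiv> kk_metric \<kappa>0 \<delta> \<beta> \<alpha> \<rho>"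
abbreviation "Fp \<equiv> F_pot \<A> \<beta> \<rho>"
abbreviation "F \<equiv> F_field \<kappa>0 \<delta> \<A> \<beta> \<rho>"
abbreviation "Dc \<equiv> D_cov \<kappa>0 \<delta> \<A> \<beta> \<rho> \<mu>"

section \<open>Phase and modulus of the scalar field\<close>

definition k :: real where "k = root 3 (kappa \<kappa>0 * \<delta>)"

definition r :: "'x \<Rightarrow> real" where "r x = cmod (\<rho>t x)"

lemma \<delta>0_pos: "0 < delta0 \<delta>" using \<delta>_pos by (simp add: delta0_def)

lemma k_pos: "0 < k" using \<kappa>0_pos \<delta>_pos by (simp add: k_def kappa_def)

lemma k_cube: "k ^ 3 = kappa \<kappa>0 * \<delta>"
  unfolding k_def using \<kappa>0_pos \<delta>_pos by (intro real_root_pow_pos) (auto simp: kappa_def)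

text \<open>Every unit complex number has the form \<open>cis (y / delta0 \<delta>)\<close>, so the
  values prescribed in terms of y determine \<rho> and \<mu> on all of M.\<close>

lemma phases:
  assumes "p \<in> points \<M>"
  shows "\<rho> p = snd (snd p) * \<rho>t (fst p)" "\<mu> p = snd (snd p) * \<mu>t"
proof -
  obtain x A z where p: "p = (x, A, z)" by (cases p)
  have x: "x \<in> points \<A>" "det A = 1" "cmod z = 1" using assms by (auto simp: p G_set_def)
  have "z = cis (Arg z)" using x by (subst cis_Arg) (auto simp: sgn_eq)
  then have "z = cis (delta0 \<delta> * Arg z / delta0 \<delta>)" using \<delta>0_pos by simp
  then show "\<rho> p = snd (snd p) * \<rho>t (fst p)" "\<mu> p = snd (snd p) * \<mu>t"
    using \<rho>_phase[OF x(1,2)] \<mu>_phase[OF x(1,2)] unfolding p by (metis fst_conv snd_conv)+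
qed

text \<open>The phase has modulus 1, so |\<rho>| lives on X: the coefficient of the vertical part of
  v_K is constant along the fibres.\<close>

lemma cmod_\<rho>: "p \<in> points \<M> \<Longrightarrow> cmod (\<rho> p) = r (fst p)"
  by (auto simp: phases norm_mult r_def G_set_def mem_Times_iff)

lemma smooth_at_r: "x \<in> points \<A> \<Longrightarrow> smooth_at \<A> x r"
  using smooth_cmod unfolding smooth_fun_def r_def by blast

lemma smooth_at_cmod_\<rho>:
  assumes p: "p \<in> points \<M>" shows "smooth_at \<M> p (\<lambda>q. k * cmod (\<rho> q))"
proof (rule P.M.smooth_at_cong_imp)
  show "smooth_at \<M> p (\<lambda>q. k * r (fst q))"
    using p by (intro P.M.smooth_at_cmult P.smooth_at_fst smooth_at_r) (auto simp: mem_Times_iff)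
  show "\<forall>\<^sub>F q in nbhds \<M> p. k * cmod (\<rho> q) = k * r (fst q)"
    using P.M.eventually_in_points[OF p] by eventually_elim (simp only: cmod_\<rho>)
qed

section \<open>The frame of M and its dual\<close>

definition v :: "4 \<Rightarrow> 'x mpoint vfield" where
  "v K p f = lift_fst \<M> p (b K (fst p)) f + k * cmod (\<rho> p) * lift_snd \<M> p (a K (snd p)) f"

definition w :: "4 \<Rightarrow> 'x mpoint vfield" where
  "w K p = lift_snd \<M> p (a K (snd p))"

lemma vector_field_w: "vector_field \<M> (w K)"
  unfolding w_def[abs_def] by (rule P.vector_field_lift_snd[OF Gr.frame_field])

lemma vector_field_v: "vector_field \<M> (v K)"
proof -
  have "vector_field \<M> (\<lambda>p f. lift_fst \<M> p (b K (fst p)) f + k * cmod (\<rho> p) * w K p f)"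
    using smooth_at_cmod_\<rho>
    by (intro P.M.vector_field_add_scale P.vector_field_lift_fst X.frame_field vector_field_w)
       (simp add: smooth_fun_def)
  then show ?thesis by (simp add: v_def[abs_def] w_def)
qed

lemma nu_add_scale:
  "nu \<kappa>0 \<delta> \<beta> \<alpha> \<rho> K = (\<lambda>p D. pull_snd (\<alpha> K) p D + - (k * cmod (\<rho> p)) * pull_fst (\<beta> K) p D)"
  by (intro ext) (simp add: nu_def k_def)

lemma tangent_factors:
  assumes "p \<in> points \<M>"
  shows "b K (fst p) \<in> tangent_space \<A> (fst p)" "a K (snd p) \<in> tangent_space G_atlas (snd p)"
    "fst p \<in> points \<A>" "snd p \<in> points G_atlas"
  using assms X.frame_tangent Gr.frame_tangent by (auto simp: mem_Times_iff)

lemma v_fst: "p \<in> points \<M> \<Longrightarrow> v K p (\<lambda>q. f (fst q)) = b K (fst p) f"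
  using tangent_factors(1,2)[of p K] tangent_factors(3,4)[of p] by (simp add: v_def)

lemma v_snd: "p \<in> points \<M> \<Longrightarrow> v K p (\<lambda>q. f (snd q)) = k * r (fst p) * a K (snd p) f"
  using tangent_factors(1,2)[of p K] tangent_factors(3,4)[of p] by (simp add: v_def cmod_\<rho>)

lemma w_fst: "p \<in> points \<M> \<Longrightarrow> w K p (\<lambda>q. f (fst q)) = 0"
  using tangent_factors(1,2)[of p K] tangent_factors(3,4)[of p] by (simp add: w_def)

lemma w_snd: "p \<in> points \<M> \<Longrightarrow> w K p (\<lambda>q. f (snd q)) = a K (snd p) f"
  using tangent_factors(1,2)[of p K] tangent_factors(3,4)[of p] by (simp add: w_def)

lemma pull_fst_zero: "p \<in> points \<M> \<Longrightarrow> (\<And>f. D (\<lambda>q. f (fst q)) = 0) \<Longrightarrow> pull_fst (\<beta> K) p D = 0"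
  unfolding pull_fst_def using P.X.one_form_zero[OF X.coframe_form] tangent_factors(3) by simp

lemma pull_snd_scale:
  assumes p: "p \<in> points \<M>" and "\<And>f. D (\<lambda>q. f (snd q)) = s * a K (snd p) f"
  shows "pull_snd (\<alpha> L) p D = (if L = K then s else 0)"
proof -
  note sp = tangent_factors(4)[OF p]
  have "(\<lambda>f. D (\<lambda>q. f (snd q))) = (\<lambda>f. s * a K (snd p) f + 0)" using assms(2) by simp
  then have "pull_snd (\<alpha> L) p D = \<alpha> L (snd p) (\<lambda>f. s * a K (snd p) f + 0)"
    unfolding pull_snd_def by (rule arg_cong)
  also have "\<dots> = (if L = K then s else 0)"
    unfolding G.one_form_lincomb[OF Gr.coframe_form Gr.frame_tangent[OF sp] G.tangent_zero[OF sp]]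
      G.one_form_zero[OF Gr.coframe_form sp] Gr.dual[OF sp] by simp
  finally show ?thesis .
qed

abbreviation eM :: "4 + 4 \<Rightarrow> 'x mpoint vfield" where "eM \<equiv> case_sum v w"

abbreviation \<theta>M :: "4 + 4 \<Rightarrow> 'x mpoint oneform" where
  "\<theta>M \<equiv> case_sum (\<lambda>K. pull_fst (\<beta> K)) (nu \<kappa>0 \<delta> \<beta> \<alpha> \<rho>)"

abbreviation \<epsilon>M :: "4 + 4 \<Rightarrow> real" where "\<epsilon>M \<equiv> case_sum (\<lambda>K. eta K K) (\<lambda>K. eta K K)"

text \<open>In \<nu>^J(v_K) the contribution of \<alpha>^J cancels against k |\<rho>| \<beta>^J,
  which gives duality. For separation, \<nu> agrees with \<alpha> on D once all \<beta>^K vanish on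
  D, so both projections of D are 0. Smoothness of |\<rho>| is what makes v_K and \<nu>^K
  smooth.\<close>

sublocale M: frame \<M> eM \<theta>M \<epsilon>M hM
proof
  show "vector_field \<M> (eM i)" for i using vector_field_v vector_field_w by (cases i) auto
  have "smooth_fun \<M> (\<lambda>p. - (k * cmod (\<rho> p)))"
    unfolding smooth_fun_def using smooth_at_cmod_\<rho> P.M.smooth_at_minus by blast
  then have "one_form \<M> (nu \<kappa>0 \<delta> \<beta> \<alpha> \<rho> K)" for K
    unfolding nu_add_scale
    by (intro P.M.one_form_add_scale P.one_form_pull_fst P.one_form_pull_snd X.coframe_form Gr.coframe_form)
  then show "one_form \<M> (\<theta>M i)" for i
    using P.one_form_pull_fst[OF X.coframe_form] by (cases i) auto
  show "\<theta>M i p (eM j p) = (if i = j then 1 else 0)" if p: "p \<in> points \<M>" for i j p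
  proof -
    have 1: "pull_fst (\<beta> J) p (v K p) = (if J = K then 1 else 0)" for J K
      unfolding pull_fst_def v_fst[OF p] by (rule X.dual[OF tangent_factors(3)[OF p]])
    have 2: "pull_fst (\<beta> J) p (w K p) = 0" for J K
      by (rule pull_fst_zero[OF p w_fst[OF p]])
    have 3: "pull_snd (\<alpha> J) p (v K p) = (if J = K then k * r (fst p) else 0)" for J K
      by (rule pull_snd_scale[OF p v_snd[OF p]])
    have 4: "pull_snd (\<alpha> J) p (w K p) = (if J = K then 1 else 0)" for J K
      by (rule pull_snd_scale[OF p]) (simp add: w_snd[OF p])
    show ?thesis by (cases i; cases j) (simp_all add: 1 2 3 4 nu_add_scale cmod_\<rho>[OF p])
  qed
  show "D = (\<lambda>f. 0)" if D: "D \<in> tangent_space \<M> p" and zero: "\<And>i. \<theta>M i p D = 0" for D p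
  proof (rule P.product_tangent_eq_zero[OF D])
    have 1: "pull_fst (\<beta> K) p D = 0" for K using zero[of "Inl K"] by simp
    then have 2: "pull_snd (\<alpha> K) p D = 0" for K using zero[of "Inr K"] by (simp add: nu_def)
    show "(\<lambda>f. D (\<lambda>q. f (fst q))) = (\<lambda>f. 0)"
      by (rule X.separating[OF P.push_fst_tangent[OF D]]) (use 1 in \<open>simp add: pull_fst_def\<close>)
    show "(\<lambda>f. D (\<lambda>q. f (snd q))) = (\<lambda>f. 0)"
      by (rule Gr.separating[OF P.push_snd_tangent[OF D]]) (use 2 in \<open>simp add: pull_snd_def\<close>)
  qed
  show "\<epsilon>M i * \<epsilon>M i = 1" for i by (cases i) (simp_all add: eta_square)
  show "hM p D E = (\<Sum>i\<in>UNIV. \<epsilon>M i * (\<theta>M i p D * \<theta>M i p E))" for p D E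
    unfolding kk_metric_def tetrad_metric_diag sum_UNIV_sum by simp
qed

section \<open>Brackets and curvature of the horizontal fields\<close>

definition \<Omega> :: "4 \<Rightarrow> 4 \<Rightarrow> 4 \<Rightarrow> 'x mpoint \<Rightarrow> real" where
  "\<Omega> J K L = M.C (Inl J) (Inl K) (Inr L)"

lemma C_base:
  assumes p: "p \<in> points \<M>" shows "M.C (Inl J) (Inl K) (Inl L) p = X.C J K L (fst p)"
  unfolding M.C_def X.C_def sum.case pull_fst_def
  by (subst P.push_fst_lie_bracket[OF vector_field_v vector_field_v v_fst v_fst p]) simp_all

text \<open>The vertical field projects to the zero field, whose bracket with b_K is 0, so the mixed
  bracket has no horizontal component.\<close>

lemma C_mixed:
  assumes p: "p \<in> points \<M>"
  shows "M.C (Inr J) (Inl K) (Inl L) p = 0" "M.C (Inl K) (Inr J) (Inl L) p = 0"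
proof -
  have "(\<lambda>f. lie_bracket \<M> (w J) (v K) p (\<lambda>q. f (fst q))) = lie_bracket \<A> (\<lambda>_ _. 0) (b K) (fst p)"
    by (rule P.push_fst_lie_bracket[OF vector_field_w vector_field_v w_fst v_fst p])
  also have "\<dots> = (\<lambda>f. 0)"
    by (rule ext) (simp add: lie_bracket_def P.X.tangent_const[OF tangent_factors(1)[OF p]])
  finally have "\<And>f. lie_bracket \<M> (w J) (v K) p (\<lambda>q. f (fst q)) = 0" by (rule fun_cong)
  then have "pull_fst (\<beta> L) p (lie_bracket \<M> (w J) (v K) p) = 0"
    by (rule pull_fst_zero[OF p])
  then show "M.C (Inr J) (Inl K) (Inl L) p = 0" unfolding M.C_def by simp
  then show "M.C (Inl K) (Inr J) (Inl L) p = 0" using M.C_antisym[OF p, of "Inl K" "Inr J" "Inl L"] by simp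
qed

text \<open>With exactly one vertical index, two of the three bracket terms of
  \<open>\<Gamma>\<close> are horizontal components of mixed brackets and vanish by
  \<open>C_mixed\<close>; the third is \<Omega>. These four types are all that the curvature of
  horizontal fields involves.\<close>

lemma \<Gamma>_parts:
  assumes p: "p \<in> points \<M>"
  shows "M.\<Gamma> (Inl J) (Inl K) (Inl L) p = X.\<Gamma> J K L (fst p)"
    and "M.\<Gamma> (Inl J) (Inl K) (Inr A) p = \<Omega> J K A p / 2"
    and "M.\<Gamma> (Inl J) (Inr A) (Inl L) p = - (eta L L * eta A A * \<Omega> J L A p / 2)"
    and "M.\<Gamma> (Inr A) (Inl K) (Inl L) p = - (eta L L * eta A A * \<Omega> K L A p / 2)"
  unfolding M.\<Gamma>_def X.\<Gamma>_def \<Omega>_def by (simp_all add: C_base[OF p] C_mixed[OF p])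

lemma \<Omega>_antisym: "p \<in> points \<M> \<Longrightarrow> \<Omega> K J L p = - \<Omega> J K L p"
  unfolding \<Omega>_def by (rule M.C_antisym)

text \<open>Horizontal coefficients are pullbacks from X, where v_I acts as b_I.\<close>

lemma v_\<Gamma>:
  assumes p: "p \<in> points \<M>"
  shows "v I p (M.\<Gamma> (Inl J) (Inl K) (Inl L)) = b I (fst p) (X.\<Gamma> J K L)"
proof -
  have "v I p (M.\<Gamma> (Inl J) (Inl K) (Inl L)) = v I p (\<lambda>q. X.\<Gamma> J K L (fst q))"
    by (rule P.M.tangent_cong[OF P.M.vector_field_tangent[OF vector_field_v p]
          eventually_mono[OF P.M.eventually_in_points[OF p]]]) (rule \<Gamma>_parts(1))
  then show ?thesis by (simp add: v_fst[OF p])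
qed

text \<open>O'Neill's formula: the base curvature is corrected by the vertical parts of the brackets of the
  horizontal lifts.\<close>

lemma curvature_horizontal:
  assumes p: "p \<in> points \<M>"
  shows "hM p (curvature \<M> hM (v J) (v L) (v J) p) (v L p)
    = tetrad_metric \<beta> (fst p) (curvature \<A> (tetrad_metric \<beta>) (b J) (b L) (b J) (fst p)) (b L (fst p))
      + 3 / 4 * (\<Sum>A\<in>UNIV. eta A A * (\<Omega> J L A p)\<^sup>2)"
proof -
  \<comment> \<open>The first product contributes 1/4 and the bracket term 1/2; the middle product
    contains \<Omega> with two equal lower indices and is 0.\<close>
  have vert: "M.\<Gamma> (Inl L) (Inl J) (Inr A) p * M.\<Gamma> (Inl J) (Inr A) (Inl L) p
      - M.\<Gamma> (Inl J) (Inl J) (Inr A) p * M.\<Gamma> (Inl L) (Inr A) (Inl L) p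
      - M.C (Inl J) (Inl L) (Inr A) p * M.\<Gamma> (Inr A) (Inl J) (Inl L) p
     = eta L L * (3 / 4 * (eta A A * (\<Omega> J L A p)\<^sup>2))" for A
    using \<Omega>_antisym[OF p, of L J A] \<Omega>_antisym[OF p, of J J A]
    unfolding \<Gamma>_parts[OF p] \<Omega>_def[symmetric] by (simp add: power2_eq_square)
  have sq: "eta L L * (eta L L * x) = x" for x
    by (simp add: mult.assoc[symmetric] eta_square)
  have "hM p (curvature \<M> hM (v J) (v L) (v J) p) (v L p)
     = eta L L * (b J (fst p) (X.\<Gamma> L J L) - b L (fst p) (X.\<Gamma> J J L)
     + ((\<Sum>m\<in>UNIV. X.\<Gamma> L J m (fst p) * X.\<Gamma> J m L (fst p) - X.\<Gamma> J J m (fst p) * X.\<Gamma> L m L (fst p)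
          - X.C J L m (fst p) * X.\<Gamma> m J L (fst p))
       + (\<Sum>A\<in>UNIV. eta L L * (3 / 4 * (eta A A * (\<Omega> J L A p)\<^sup>2)))))"
    using M.curvature_frame[OF p, of "Inl J" "Inl L" "Inl J" "Inl L"]
    unfolding sum_UNIV_sum vert sum.case v_\<Gamma>[OF p] \<Gamma>_parts(1)[OF p] C_base[OF p] .
  then show ?thesis
    unfolding X.curvature_frame[OF tangent_factors(3)[OF p]] sum_distrib_left[symmetric]
    by (simp only: distrib_left sq add.assoc)
qed

lemma horizontal_scalar_curvature:
  assumes p: "p \<in> points \<M>"
  shows "tetrad_curvature \<M> hM v p = scalar_curvature \<A> \<beta> b (fst p)
    + 3 / 4 * (\<Sum>J\<in>UNIV. \<Sum>L\<in>UNIV. eta J J * eta L L * (\<Sum>A\<in>UNIV. eta A A * (\<Omega> J L A p)\<^sup>2))"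
  unfolding scalar_curvature_def tetrad_curvature_diag curvature_horizontal[OF p]
  by (simp add: distrib_left sum.distrib sum_distrib_left mult.left_commute)

text \<open>In the product k |\<rho>| a_K(g) the first factor lives on X and is moved by b_J alone;
  the second lives on G and is moved by the vertical part k |\<rho>| a_J.\<close>

lemma v_smooth_factor:
  assumes p: "p \<in> points \<M>" and g: "smooth_at G_atlas (snd p) g"
  shows "v J p (\<lambda>q. v K q (\<lambda>r. g (snd r))) =
    (k * r (fst p))\<^sup>2 * a J (snd p) (\<lambda>s. a K s g) + k * b J (fst p) r * a K (snd p) g"
proof -
  note x = tangent_factors(3)[OF p] and vp = P.M.vector_field_tangent[OF vector_field_v p, of J]
  have "v J p (\<lambda>q. v K q (\<lambda>r. g (snd r))) = v J p (\<lambda>q. (k * r (fst q)) * a K (snd q) g)"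
    by (rule P.M.tangent_cong[OF vp eventually_mono[OF P.M.eventually_in_points[OF p]]]) (rule v_snd)
  also have "\<dots> = k * r (fst p) * v J p (\<lambda>q. a K (snd q) g) + v J p (\<lambda>q. k * r (fst q)) * a K (snd p) g"
    using p by (intro P.M.tangent_mult[OF vp] P.M.smooth_at_cmult P.smooth_at_fst smooth_at_r x
        P.smooth_at_snd G.vector_field_smooth[OF Gr.frame_field g]) (auto simp: mem_Times_iff)
  also have "v J p (\<lambda>q. a K (snd q) g) = k * r (fst p) * a J (snd p) (\<lambda>s. a K s g)"
    by (rule v_snd[OF p])
  also have "v J p (\<lambda>q. k * r (fst q)) = k * b J (fst p) r"
    unfolding v_fst[OF p, of J "\<lambda>x. k * r x"]
    by (rule P.X.tangent_cmult[OF tangent_factors(1)[OF p] smooth_at_r[OF x]])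
  finally show ?thesis by (simp add: power2_eq_square algebra_simps)
qed

text \<open>Antisymmetrising \<open>v_smooth_factor\<close> gives the gradient terms and, through
  the commutators of the a_K, the structure constants times |\<rho>|^2. The term with
  \<open>X.C\<close> comes from the \<beta> part of \<open>nu\<close> evaluated on the bracket,
  whose horizontal components are those on X.\<close>

lemma \<Omega>_eq:
  assumes p: "p \<in> points \<M>"
  shows "\<Omega> J K L p = k * ((if L = K then b J (fst p) r else 0) - (if L = J then b K (fst p) r else 0)
    - r (fst p) * X.C J K L (fst p) + k / \<delta> * (struct_const J K L * (r (fst p))\<^sup>2))"
proof -
  let ?s = "snd p" and ?R = "k * r (fst p)"
  let ?c = "\<lambda>i. (if i = K then k * b J (fst p) r else 0) - (if i = J then k * b K (fst p) r else 0)
      + ?R\<^sup>2 / \<delta> * struct_const J K i"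
  have s: "?s \<in> G_set" "?s \<in> points G_atlas" using tangent_factors(4)[OF p] by auto
  have br: "lie_bracket G_atlas (a J) (a K) ?s f = 1 / \<delta> * (\<Sum>L\<in>UNIV. struct_const J K L * a L ?s f)" for f
    using group s unfolding group_tetrad_def by blast
  \<comment> \<open>\<open>pull_snd\<close> hands a functional on all functions to
    \<open>\<alpha> L\<close>, so the identity is required for non-smooth g too, where both sides
    are 0.\<close>
  have "lie_bracket \<M> (v J) (v K) p (\<lambda>q. g (snd q)) = (\<Sum>i\<in>UNIV. ?c i * a i ?s g)" for g
  proof (cases "smooth_at G_atlas ?s g")
    case True
    then have "smooth_at \<M> p (\<lambda>q. g (snd q))" using P.smooth_at_snd_iff[OF p] by blast
    then have "lie_bracket \<M> (v J) (v K) p (\<lambda>q. g (snd q)) =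
      ?R\<^sup>2 * (a J ?s (\<lambda>s. a K s g) - a K ?s (\<lambda>s. a J s g))
        + k * b J (fst p) r * a K ?s g - k * b K (fst p) r * a J ?s g"
      by (simp add: lie_bracket_def v_smooth_factor[OF p True] algebra_simps)
    also have "a J ?s (\<lambda>s. a K s g) - a K ?s (\<lambda>s. a J s g) = 1 / \<delta> * (\<Sum>L\<in>UNIV. struct_const J K L * a L ?s g)"
      using br[of g] True by (simp add: lie_bracket_def)
    finally show ?thesis
      by (simp add: distrib_right left_diff_distrib sum.distrib sum_subtractf mult_delta_left sum_distrib_left mult.assoc)
  next
    case False
    then have "\<not> smooth_at \<M> p (\<lambda>q. g (snd q))" using P.smooth_at_snd_iff[OF p] by blast
    then show ?thesis
      using G.tangent_nonsmooth[OF Gr.frame_tangent[OF s(2)] False] by (simp add: lie_bracket_def)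
  qed
  then have "pull_snd (\<alpha> L) p (lie_bracket \<M> (v J) (v K) p) = \<alpha> L ?s (\<lambda>g. \<Sum>i\<in>UNIV. ?c i * a i ?s g)"
    unfolding pull_snd_def by presburger
  also have "\<dots> = ?c L" by (rule Gr.coframe_sum[OF s(2)])
  finally have "\<Omega> J K L p = ?c L - ?R * X.C J K L (fst p)"
    using C_base[OF p, of J K L] unfolding \<Omega>_def M.C_def sum.case nu_add_scale cmod_\<rho>[OF p] by simp
  then show ?thesis by (cases "L = K"; cases "L = J") (simp_all add: algebra_simps power2_eq_square)
qed

section \<open>The tetrad in coordinates\<close>

definition E :: "('x, real^4) chart \<Rightarrow> 4 \<Rightarrow> 4 \<Rightarrow> 'x \<Rightarrow> real" where
  "E c J i x = b J x (\<lambda>q. snd c q \<bullet> axis i 1)"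

definition B :: "('x, real^4) chart \<Rightarrow> 4 \<Rightarrow> 4 \<Rightarrow> 'x \<Rightarrow> real" where
  "B c L i x = \<beta> L x (coord_vec \<A> c x (axis i 1))"

lemma b_coord:
  assumes "c \<in> \<A>" "x \<in> fst c"
  shows "b J x f = (\<Sum>i\<in>UNIV. E c J i x * coord_vec \<A> c x (axis i 1) f)"
  unfolding E_def
  by (rule P.X.tangent_expand(2)[OF X.frame_tangent[OF P.X.points_chart[OF assms]] assms, unfolded sum_Basis_vec])

text \<open>\<open>E\<close> holds the coordinate components of b_J and \<open>B\<close> those of
  \<beta>^L; duality of the tetrads says that the two matrices are inverse to each other.\<close>

lemma E_B:
  assumes "c \<in> \<A>" "x \<in> fst c"
  shows "(\<Sum>i\<in>UNIV. E c J i x * B c L i x) = (if L = J then 1 else 0)"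
proof -
  have x: "x \<in> points \<A>" by (rule P.X.points_chart[OF assms])
  have "\<beta> L x (b J x) = (\<Sum>i\<in>UNIV. E c J i x * B c L i x)"
    unfolding E_def B_def
    by (rule P.X.one_form_expand[OF X.coframe_form assms X.frame_tangent[OF x], unfolded sum_Basis_vec])
  then show ?thesis by (simp add: X.dual[OF x])
qed

lemma smooth_at_E: "c \<in> \<A> \<Longrightarrow> x \<in> fst c \<Longrightarrow> smooth_at \<A> x (E c J i)"
  unfolding E_def[abs_def] by (rule P.X.vector_field_smooth[OF X.frame_field P.X.smooth_at_coordinate])

lemma smooth_at_B: "c \<in> \<A> \<Longrightarrow> x \<in> fst c \<Longrightarrow> smooth_at \<A> x (B c L i)"
  using X.coframe_form[of L] P.X.points_chart[of c x] unfolding B_def[abs_def] one_form_def by blast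

text \<open>With N the matrix of \<open>eta\<close>, the metric is B^T N B. Since E inverts B and N
  is its own inverse, E N E^T inverts the metric.\<close>

lemma g_up_eq:
  assumes "c \<in> \<A>" "x \<in> fst c"
  shows "g_up \<A> \<beta> c x $ i $ j = (\<Sum>J\<in>UNIV. eta J J * E c J i x * E c J j x)"
proof -
  let ?B = "\<chi> L i. B c L i x" and ?E = "\<chi> i J. E c J i x" and ?N = "\<chi> J K. eta J K"
  have BE: "?B ** ?E = mat 1"
    using E_B[OF assms] by (simp add: matrix_matrix_mult_def vec_eq_iff mat_def mult.commute)
  have EB: "?E ** ?B = mat 1" using BE by (rule matrix_left_right_inverse[THEN iffD1])
  have NN: "?N ** ?N = mat 1"
    by (simp add: matrix_matrix_mult_def vec_eq_iff mat_def sum_eta(1)) (simp add: eta_def)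
  have low: "g_low \<A> \<beta> c x = transpose ?B ** (?N ** ?B)"
    by (simp add: g_low_def partial_X_def tetrad_metric_diag matrix_matrix_mult_def transpose_def vec_eq_iff
        sum_eta(1) B_def mult.left_commute)
  have "g_low \<A> \<beta> c x ** (?E ** (?N ** transpose ?E)) = transpose ?B ** (?N ** ((?B ** ?E) ** (?N ** transpose ?E)))"
    unfolding low by (simp only: matrix_mul_assoc)
  also have "\<dots> = transpose ?B ** ((?N ** ?N) ** transpose ?E)"
    unfolding BE by (simp only: matrix_mul_lid matrix_mul_assoc)
  also have "\<dots> = transpose (?E ** ?B)"
    unfolding NN by (simp only: matrix_mul_lid matrix_transpose_mul)
  finally have "g_low \<A> \<beta> c x ** (?E ** (?N ** transpose ?E)) = mat 1"
    unfolding EB by (simp add: transpose_mat)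
  then have "g_up \<A> \<beta> c x = ?E ** (?N ** transpose ?E)"
    unfolding g_up_def by (rule matrix_inv_eqI)
  then show ?thesis
    by (simp add: matrix_matrix_mult_def transpose_def sum_eta(1) ac_simps)
qed

text \<open>Brings derivatives on M of functions such as the potentials down to X. Agreement with a
  pullback is asked for on M only, which locality allows.\<close>

lemma partial_M_base:
  assumes p: "p \<in> points \<M>" and c: "c \<in> \<A>" "fst p \<in> fst c"
    and f: "\<And>q. q \<in> points \<M> \<Longrightarrow> f q = \<phi> (fst q)"
  shows "partial_M \<A> c p i f = coord_vec \<A> c (fst p) (axis i 1) \<phi>"
proof -
  note t = P.X.coord_vec_tangent[OF c, of "axis i 1"] and s = tangent_factors(4)[OF p]
  have "lift_fst \<M> p (coord_vec \<A> c (fst p) (axis i 1)) f =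
      lift_fst \<M> p (coord_vec \<A> c (fst p) (axis i 1)) (\<lambda>q. \<phi> (fst q))"
    by (rule P.M.tangent_cong[OF P.lift_fst_tangent[OF t s] eventually_mono[OF P.M.eventually_in_points[OF p] f]])
  then show ?thesis unfolding partial_M_def partial_X_def M_atlas_def P.lift_fst_fst[OF t s] .
qed

section \<open>The field strength in the tetrad\<close>

lemma F_pot_base: "p \<in> points \<M> \<Longrightarrow> Fp c L i p = r (fst p) * B c L i (fst p)"
  by (simp add: F_pot_def cmod_\<rho> B_def partial_X_def del: points_prod_atlas)

lemma F_field_base:
  assumes p: "p \<in> points \<M>" and c: "c \<in> \<A>" "fst p \<in> fst c"
  shows "F c L i j p =
    coord_vec \<A> c (fst p) (axis i 1) (\<lambda>x. r x * B c L j x) - coord_vec \<A> c (fst p) (axis j 1) (\<lambda>x. r x * B c L i x)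
    + k / \<delta> * (r (fst p))\<^sup>2 * (\<Sum>J\<in>UNIV. \<Sum>K\<in>UNIV. struct_const J K L * B c J i (fst p) * B c K j (fst p))"
proof -
  have "partial_M \<A> c p i (Fp c L j) = coord_vec \<A> c (fst p) (axis i 1) (\<lambda>x. r x * B c L j x)" for i j
    by (rule partial_M_base[OF p c]) (rule F_pot_base)
  then show ?thesis
    unfolding F_field_def F_pot_base[OF p] coupling_def k_def[symmetric]
    by (simp add: sum_distrib_left power2_eq_square ac_simps)
qed

text \<open>This is the derivative along \<open>b\<^sub>J\<close> of
  \<open>|\<rho>| \<beta>\<^sup>L(b\<^sub>K) = |\<rho>| \<delta>\<^sup>L\<^sub>K\<close>.\<close>

lemma frame_derivative_potential:
  assumes c: "c \<in> \<A>" "x \<in> fst c"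
  shows "(\<Sum>j\<in>UNIV. E c K j x * b J x (\<lambda>x. r x * B c L j x)) =
    (if L = K then b J x r else 0) - r x * (\<Sum>j\<in>UNIV. b J x (E c K j) * B c L j x)"
proof -
  have x: "x \<in> points \<A>" by (rule P.X.points_chart[OF c])
  note bt = X.frame_tangent[OF x, of J]
  have sm: "smooth_at \<A> x (E c K j)" "smooth_at \<A> x (\<lambda>x. r x * B c L j x)" for j
    using smooth_at_E[OF c] P.X.smooth_at_mult[OF smooth_at_r[OF x] smooth_at_B[OF c]] by auto
  have "b J x (\<lambda>q. \<Sum>j\<in>UNIV. E c K j q * (r q * B c L j q)) = b J x (\<lambda>q. if L = K then r q else 0)"
  proof (rule P.X.tangent_cong[OF bt eventually_mono[OF P.X.eventually_in_chart[OF c]]])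
    fix q assume "q \<in> fst c"
    from E_B[OF c(1) this, of K L]
    show "(\<Sum>j\<in>UNIV. E c K j q * (r q * B c L j q)) = (if L = K then r q else 0)"
      by (simp add: mult.left_commute[of _ "r q"] flip: sum_distrib_left split: if_splits)
  qed
  also have "\<dots> = (if L = K then b J x r else 0)" using P.X.tangent_const[OF bt] by simp
  finally have "(\<Sum>j\<in>UNIV. E c K j x * b J x (\<lambda>x. r x * B c L j x) + b J x (E c K j) * (r x * B c L j x))
      = (if L = K then b J x r else 0)"
    by (simp only: P.X.tangent_fun_sum[OF bt P.X.smooth_at_mult[OF sm]] P.X.tangent_mult[OF bt sm])
  then show ?thesis
    by (simp add: sum.distrib sum_distrib_left mult.left_commute)
qed

lemma C_coord:
  assumes c: "c \<in> \<A>" "x \<in> fst c"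
  shows "X.C J K L x = (\<Sum>j\<in>UNIV. (b J x (E c K j) - b K x (E c J j)) * B c L j x)"
proof -
  have x: "x \<in> points \<A>" by (rule P.X.points_chart[OF c])
  have "lie_bracket \<A> (b J) (b K) x (\<lambda>q. snd c q \<bullet> axis j 1) = b J x (E c K j) - b K x (E c J j)" for j
    using P.X.smooth_at_coordinate[OF c] by (simp add: lie_bracket_def E_def[abs_def])
  then show ?thesis
    using P.X.one_form_expand[OF X.coframe_form c X.bracket_tangent[OF x], of L J K]
    unfolding X.C_def B_def sum_Basis_vec by simp
qed

text \<open>Taking the factors E inside the derivatives of |\<rho>| \<beta> costs derivatives of E,
  which assemble into the bracket coefficients \<open>X.C\<close>. In the quadratic term E contracts
  every B to a Kronecker symbol, leaving the structure constants with g = k / \<delta>.\<close>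

lemma F_field_frame:
  assumes p: "p \<in> points \<M>" and c: "c \<in> \<A>" "fst p \<in> fst c"
  shows "k * (\<Sum>i\<in>UNIV. \<Sum>j\<in>UNIV. E c J i (fst p) * E c K j (fst p) * F c L i j p) = \<Omega> J K L p"
proof -
  let ?x = "fst p"
  let ?E = "\<lambda>J i. E c J i ?x" and ?B = "\<lambda>J i. B c J i ?x"
  let ?d = "\<lambda>i j. coord_vec \<A> c ?x (axis i 1) (\<lambda>x. r x * B c L j x)"
  have d: "(\<Sum>i\<in>UNIV. \<Sum>j\<in>UNIV. ?E J i * ?E K j * ?d i j) =
    (if L = K then b J ?x r else 0) - r ?x * (\<Sum>j\<in>UNIV. b J ?x (E c K j) * ?B L j)" for J K
  proof -
    have "(\<Sum>i\<in>UNIV. \<Sum>j\<in>UNIV. ?E J i * ?E K j * ?d i j) = (\<Sum>j\<in>UNIV. ?E K j * (\<Sum>i\<in>UNIV. ?E J i * ?d i j))"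
      by (subst sum.swap) (simp only: sum_distrib_left ac_simps)
    then show ?thesis
      unfolding b_coord[OF c, symmetric] frame_derivative_potential[OF c] .
  qed
  have d': "(\<Sum>i\<in>UNIV. \<Sum>j\<in>UNIV. ?E J i * ?E K j * ?d j i) =
    (if L = J then b K ?x r else 0) - r ?x * (\<Sum>j\<in>UNIV. b K ?x (E c J j) * ?B L j)"
    unfolding d[symmetric] by (subst sum.swap) (simp only: ac_simps)
  have q: "(\<Sum>i\<in>UNIV. \<Sum>j\<in>UNIV. ?E J i * ?E K j *
      (\<Sum>J'\<in>UNIV. \<Sum>K'\<in>UNIV. struct_const J' K' L * ?B J' i * ?B K' j)) = struct_const J K L"
  proof -
    have "(\<Sum>i\<in>UNIV. \<Sum>j\<in>UNIV. ?E J i * ?E K j * (\<Sum>J'\<in>UNIV. \<Sum>K'\<in>UNIV. struct_const J' K' L * ?B J' i * ?B K' j))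
      = (\<Sum>(i, j)\<in>UNIV. \<Sum>(J', K')\<in>UNIV. struct_const J' K' L * ((?E J i * ?B J' i) * (?E K j * ?B K' j)))"
      unfolding UNIV_Times_UNIV[symmetric] sum.cartesian_product[symmetric]
      by (simp only: sum_distrib_left ac_simps)
    also have "\<dots> = (\<Sum>(J', K')\<in>UNIV. \<Sum>(i, j)\<in>UNIV. struct_const J' K' L * ((?E J i * ?B J' i) * (?E K j * ?B K' j)))"
      unfolding split_def by (rule sum.swap)
    also have "\<dots> = (\<Sum>J'\<in>UNIV. \<Sum>K'\<in>UNIV. struct_const J' K' L *
        ((\<Sum>i\<in>UNIV. ?E J i * ?B J' i) * (\<Sum>j\<in>UNIV. ?E K j * ?B K' j)))"
      unfolding UNIV_Times_UNIV[symmetric] sum.cartesian_product[symmetric] sum_product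
      by (simp only: sum_distrib_left)
    also have "\<dots> = struct_const J K L"
      unfolding E_B[OF c] by (simp add: mult_delta_left mult_delta_right)
    finally show ?thesis .
  qed
  have "(\<Sum>i\<in>UNIV. \<Sum>j\<in>UNIV. ?E J i * ?E K j * F c L i j p) =
      (\<Sum>i\<in>UNIV. \<Sum>j\<in>UNIV. ?E J i * ?E K j * ?d i j) - (\<Sum>i\<in>UNIV. \<Sum>j\<in>UNIV. ?E J i * ?E K j * ?d j i)
    + k / \<delta> * (r ?x)\<^sup>2 * (\<Sum>i\<in>UNIV. \<Sum>j\<in>UNIV. ?E J i * ?E K j *
      (\<Sum>J'\<in>UNIV. \<Sum>K'\<in>UNIV. struct_const J' K' L * ?B J' i * ?B K' j))"
    unfolding F_field_base[OF p c] distrib_left right_diff_distrib sum.distrib sum_subtractf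
    unfolding mult.left_commute[of "_ * _" "k / \<delta> * (r ?x)\<^sup>2"] sum_distrib_left[symmetric] ..
  also have "\<dots> = (if L = K then b J ?x r else 0) - (if L = J then b K ?x r else 0)
     - r ?x * X.C J K L ?x + k / \<delta> * (struct_const J K L * (r ?x)\<^sup>2)"
    unfolding d d' q C_coord[OF c] by (simp add: left_diff_distrib sum_subtractf right_diff_distrib)
  finally show ?thesis unfolding \<Omega>_eq[OF p] by simp
qed

text \<open>\<open>contraction_rank_two\<close> rewrites the coordinate contraction in tetrad
  components, each of which is \<Omega> / k by \<open>F_field_frame\<close>.\<close>

lemma F_contraction:
  assumes p: "p \<in> points \<M>" and c: "c \<in> \<A>" "fst p \<in> fst c"
  shows "(\<Sum>K\<in>UNIV. \<Sum>i\<in>UNIV. \<Sum>j\<in>UNIV. F c K i j p * F_field_up \<kappa>0 \<delta> \<A> \<beta> \<rho> c K i j p)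
    = (\<Sum>J\<in>UNIV. \<Sum>L\<in>UNIV. eta J J * eta L L * (\<Sum>A\<in>UNIV. eta A A * (\<Omega> J L A p)\<^sup>2)) / k\<^sup>2"
proof -
  let ?F = "\<lambda>K i j. F c K i j p"
  let ?g = "\<lambda>i j. g_up \<A> \<beta> c (fst p) $ i $ j"
  have up: "F_field_up \<kappa>0 \<delta> \<A> \<beta> \<rho> c K i j p = eta K K * (\<Sum>i'\<in>UNIV. \<Sum>j'\<in>UNIV. ?g i' i * ?g j' j * ?F K i' j')" for K i j
    unfolding F_field_up_def mult.assoc sum_distrib_left[symmetric] sum_eta
    by (simp only: sum_distrib_left mult.left_commute)
  have \<Omega>: "(\<Sum>i\<in>UNIV. \<Sum>j\<in>UNIV. E c J i (fst p) * E c L j (fst p) * ?F A i j) = \<Omega> J L A p / k" for J L A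
    using F_field_frame[OF p c, of J L A] k_pos by (simp add: field_simps)
  have "(\<Sum>i\<in>UNIV. \<Sum>j\<in>UNIV. ?F A i j * F_field_up \<kappa>0 \<delta> \<A> \<beta> \<rho> c A i j p)
     = eta A A * (\<Sum>J\<in>UNIV. \<Sum>L\<in>UNIV. eta J J * eta L L * (\<Omega> J L A p / k)\<^sup>2)" for A
    unfolding up mult.left_commute[of "?F _ _ _"] sum_distrib_left[symmetric]
      contraction_rank_two[where E="\<lambda>J i. E c J i (fst p)" and F="?F A" and g="?g" and \<epsilon>="\<lambda>J. eta J J", OF g_up_eq[OF c]] \<Omega> ..
  then have "(\<Sum>A\<in>UNIV. \<Sum>i\<in>UNIV. \<Sum>j\<in>UNIV. ?F A i j * F_field_up \<kappa>0 \<delta> \<A> \<beta> \<rho> c A i j p)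
     = (\<Sum>A\<in>UNIV. \<Sum>J\<in>UNIV. \<Sum>L\<in>UNIV. eta J J * eta L L * (eta A A * (\<Omega> J L A p / k)\<^sup>2))"
    by (simp only: sum_distrib_left ac_simps)
  also have "\<dots> = (\<Sum>J\<in>UNIV. \<Sum>L\<in>UNIV. \<Sum>A\<in>UNIV. eta J J * eta L L * (eta A A * (\<Omega> J L A p / k)\<^sup>2))"
    by (subst sum.swap) (rule sum.cong[OF refl sum.swap])
  finally show ?thesis by (simp add: power_divide sum_distrib_left sum_divide_distrib)
qed

section \<open>The scalar term\<close>

lemma smooth_at_\<rho>:
  assumes p: "p \<in> points \<M>"
  shows "smooth_at \<M> p (\<lambda>q. Re (\<rho> q))" "smooth_at \<M> p (\<lambda>q. Im (\<rho> q))"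
    "smooth_at \<M> p (\<lambda>q. Re (\<mu> q))" "smooth_at \<M> p (\<lambda>q. Im (\<mu> q))"
proof -
  note x = tangent_factors(3)[OF p] and s = tangent_factors(4)[OF p]
  have \<rho>t: "smooth_at \<A> (fst p) \<rho>t" using smooth_\<rho>t x unfolding smooth_fun_def by blast
  have s': "snd p \<in> G_set" using s by simp
  note sm = P.smooth_at_fst[OF P.X.smooth_at_bounded_linear[OF bounded_linear_Re \<rho>t] s]
    P.smooth_at_fst[OF P.X.smooth_at_bounded_linear[OF bounded_linear_Im \<rho>t] s]
    P.smooth_at_snd[OF smooth_at_phase(1)[OF s'] x] P.smooth_at_snd[OF smooth_at_phase(2)[OF s'] x]
    P.M.smooth_at_const[OF p]
  have ev: "\<forall>\<^sub>F q in nbhds \<M> p. \<rho> q = snd (snd q) * \<rho>t (fst q) \<and> \<mu> q = snd (snd q) * \<mu>t"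
    using P.M.eventually_in_points[OF p] by eventually_elim (use phases in blast)
  show "smooth_at \<M> p (\<lambda>q. Re (\<rho> q))"
    by (rule P.M.smooth_at_cong_imp[OF P.M.smooth_at_diff[OF P.M.smooth_at_mult[OF sm(3,1)] P.M.smooth_at_mult[OF sm(4,2)]]])
       (use ev in eventually_elim, simp)
  show "smooth_at \<M> p (\<lambda>q. Im (\<rho> q))"
    by (rule P.M.smooth_at_cong_imp[OF P.M.smooth_at_add[OF P.M.smooth_at_mult[OF sm(3,2)] P.M.smooth_at_mult[OF sm(4,1)]]])
       (use ev in eventually_elim, simp)
  show "smooth_at \<M> p (\<lambda>q. Re (\<mu> q))"
    by (rule P.M.smooth_at_cong_imp[OF P.M.smooth_at_diff[OF P.M.smooth_at_mult[OF sm(3) sm(5)[of "Re \<mu>t"]]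
          P.M.smooth_at_mult[OF sm(4) sm(5)[of "Im \<mu>t"]]]])
       (use ev in eventually_elim, simp)
  show "smooth_at \<M> p (\<lambda>q. Im (\<mu> q))"
    by (rule P.M.smooth_at_cong_imp[OF P.M.smooth_at_add[OF P.M.smooth_at_mult[OF sm(3) sm(5)[of "Im \<mu>t"]]
          P.M.smooth_at_mult[OF sm(4) sm(5)[of "Re \<mu>t"]]]])
       (use ev in eventually_elim, simp)
qed

text \<open>The horizontal part of v_J differentiates \<rho> but not \<mu>, which varies with the
  phase only. The vertical part acts for J = 3 only, as multiplication by - i / \<delta>0; times k
  |\<rho>| this is - i g_0 |\<rho>|, and |\<rho>| is exactly the contraction of F^3 with b_3, while
  F^3 gives 0 on the other b_J.\<close>

lemma D_cov_frame:
  assumes p: "p \<in> points \<M>" and c: "c \<in> \<A>" "fst p \<in> fst c"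
  shows "(\<Sum>i\<in>UNIV. of_real (E c J i (fst p)) * Dc c i p) = cderiv (v J p) (\<lambda>q. \<rho> q + \<mu> q)"
proof -
  note t = tangent_factors[OF p]
  let ?H = "lift_fst \<M> p (b J (fst p))" and ?V = "lift_snd \<M> p (a J (snd p))"
  have H: "?H \<in> tangent_space \<M> p" by (rule P.lift_fst_tangent[OF t(1,4)])
  have "?H = (\<lambda>f. \<Sum>i\<in>UNIV. E c J i (fst p) * partial_M \<A> c p i f)"
    by (rule ext) (simp add: lift_fst_def partial_M_def partial_X_def M_atlas_def b_coord[OF c])
  then have 1: "(\<Sum>i\<in>UNIV. of_real (E c J i (fst p)) * cderiv (partial_M \<A> c p i) \<rho>) = cderiv ?H \<rho>"
    using cderiv_sum[of "\<lambda>i. E c J i (fst p)" "partial_M \<A> c p" UNIV \<rho>] by simp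
  have "(\<Sum>i\<in>UNIV. E c J i (fst p) * Fp c 3 i p) = (if J = 3 then r (fst p) else 0)"
    using E_B[OF c, of J 3] unfolding F_pot_base[OF p]
    by (simp add: mult.left_commute[of _ "r (fst p)"] flip: sum_distrib_left split: if_splits)
  then have 2: "(\<Sum>i\<in>UNIV. of_real (E c J i (fst p)) * of_real (Fp c 3 i p)) = complex_of_real (if J = 3 then r (fst p) else 0)"
    by (simp flip: of_real_mult of_real_sum)
  have "(\<Sum>i\<in>UNIV. of_real (E c J i (fst p)) * Dc c i p) =
     (\<Sum>i\<in>UNIV. of_real (E c J i (fst p)) * cderiv (partial_M \<A> c p i) \<rho>)
     - \<i> * of_real (coupling0 \<kappa>0 \<delta>) * (\<Sum>i\<in>UNIV. of_real (E c J i (fst p)) * of_real (Fp c 3 i p)) * (\<rho> p + \<mu> p)"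
    unfolding D_cov_def right_diff_distrib sum_subtractf sum_distrib_left sum_distrib_right
    by (simp only: ac_simps)
  also have "\<dots> = cderiv ?H \<rho> - \<i> * of_real (coupling0 \<kappa>0 \<delta>) * of_real (if J = 3 then r (fst p) else 0) * (\<rho> p + \<mu> p)"
    unfolding 1 2 ..
  finally have lhs: "(\<Sum>i\<in>UNIV. of_real (E c J i (fst p)) * Dc c i p) = \<dots>" .
  have "?H (\<lambda>q. Re (\<mu> q)) = ?H (\<lambda>q. Re (snd (snd q) * \<mu>t))" "?H (\<lambda>q. Im (\<mu> q)) = ?H (\<lambda>q. Im (snd (snd q) * \<mu>t))"
    by (rule P.M.tangent_cong[OF H eventually_mono[OF P.M.eventually_in_points[OF p]]], simp only: phases)+
  then have "cderiv ?H \<mu> = 0"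
    using P.lift_fst_snd[OF t(1), where f="\<lambda>s. Re (snd s * \<mu>t)"] P.lift_fst_snd[OF t(1), where f="\<lambda>s. Im (snd s * \<mu>t)"]
    by (simp add: cderiv_def complex_eq_iff)
  then have h: "cderiv ?H (\<lambda>q. \<rho> q + \<mu> q) = cderiv ?H \<rho>"
    using P.M.cderiv_add[OF H smooth_at_\<rho>[OF p]] by simp
  have sm: "smooth_at \<M> p (\<lambda>q. Re (\<rho> q + \<mu> q))" "smooth_at \<M> p (\<lambda>q. Im (\<rho> q + \<mu> q))"
    using P.M.smooth_at_add[OF smooth_at_\<rho>(1)[OF p] smooth_at_\<rho>(3)[OF p]]
      P.M.smooth_at_add[OF smooth_at_\<rho>(2)[OF p] smooth_at_\<rho>(4)[OF p]] by simp_all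
  have s: "snd p \<in> G_set" using t(4) by simp
  have "cderiv ?V (\<lambda>q. \<rho> q + \<mu> q) = cderiv (a J (snd p)) (\<lambda>s. \<rho> (fst p, s) + \<mu> (fst p, s))"
    using sm by (simp add: cderiv_def lift_snd_def)
  also have "\<dots> = (\<rho>t (fst p) + \<mu>t) * cderiv (a J (snd p)) snd"
    by (rule cderiv_phase_lincomb[OF t(2) s]) (use t(3) in \<open>simp add: phases algebra_simps\<close>)
  also have "\<dots> = (if J = 3 then - \<i> / of_real (delta0 \<delta>) * (\<rho> p + \<mu> p) else 0)"
    using group_tetrad_phase[OF group _ _ s, of J] \<delta>_pos \<delta>0_pos by (simp add: phases[OF p] algebra_simps)
  finally have vert: "cderiv ?V (\<lambda>q. \<rho> q + \<mu> q) = \<dots>" .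
  have "cderiv (v J p) (\<lambda>q. \<rho> q + \<mu> q) = cderiv ?H (\<lambda>q. \<rho> q + \<mu> q) + of_real (k * r (fst p)) * cderiv ?V (\<lambda>q. \<rho> q + \<mu> q)"
    by (simp add: cderiv_def v_def cmod_\<rho>[OF p] complex_eq_iff)
  also have "\<dots> = cderiv ?H \<rho> - \<i> * of_real (coupling0 \<kappa>0 \<delta>) * of_real (if J = 3 then r (fst p) else 0) * (\<rho> p + \<mu> p)"
    unfolding h vert coupling0_def k_def[symmetric] by simp
  finally show ?thesis unfolding lhs ..
qed

lemma kk_v_eq: "kk_v \<kappa>0 \<delta> \<A> b a \<rho> = v"
  by (intro ext) (simp add: kk_v_def v_def k_def M_atlas_def)

text \<open>Both Lagrangians reduce to the same tetrad sums, one over the squares of \<Omega> and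
  one over the derivatives v_J(\<rho> + \<mu>); only the constants in front of the first remain to
  be compared.\<close>

theorem kk_lagrangian_eq:
  assumes p: "p \<in> points \<A> \<times> G_set" and c: "c \<in> \<A>" "fst p \<in> fst c"
  shows "kk_lagrangian \<kappa>0 \<delta> \<A> \<beta> b \<alpha> a \<rho> \<mu> p
    = 1 / (16 * pi * \<kappa>0) * scalar_curvature \<A> \<beta> b (fst p) + ym_lagrangian \<kappa>0 \<delta> \<A> \<beta> \<rho> \<mu> c p"
proof -
  have p: "p \<in> points \<M>" using p by simp
  let ?S = "\<Sum>J\<in>UNIV. \<Sum>L\<in>UNIV. eta J J * eta L L * (\<Sum>A\<in>UNIV. eta A A * (\<Omega> J L A p)\<^sup>2)"
  let ?d = "\<lambda>J. cderiv (v J p) (\<lambda>q. \<rho> q + \<mu> q)"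
  have "(\<Sum>K\<in>UNIV. of_real (eta J K) * T K) = of_real (eta J J) * T J" for J and T :: "4 \<Rightarrow> complex"
  proof -
    have "(\<Sum>K\<in>UNIV. of_real (eta J K) * T K) = (\<Sum>K\<in>UNIV. if J = K then of_real (eta J J) * T J else 0)"
      by (rule sum.cong) (auto simp: eta_def)
    then show ?thesis by simp
  qed
  then have "(\<Sum>J\<in>UNIV. \<Sum>K\<in>UNIV. of_real (eta J K) * (cnj (?d K) * ?d J))
     = (\<Sum>J\<in>UNIV. of_real (eta J J) * (cnj (?d J) * ?d J))"
    by simp
  also have "\<dots> = (\<Sum>i\<in>UNIV. \<Sum>j\<in>UNIV. of_real (g_up \<A> \<beta> c (fst p) $ i $ j) *
      (cnj (Dc c i p) * Dc c j p))"
    unfolding contraction_rank_one[where E="\<lambda>J i. E c J i (fst p)" and g="\<lambda>i j. g_up \<A> \<beta> c (fst p) $ i $ j"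
        and \<epsilon>="\<lambda>J. eta J J", OF g_up_eq[OF c]] D_cov_frame[OF p c] ..
  finally have scalar: "(\<Sum>J\<in>UNIV. \<Sum>K\<in>UNIV. of_real (eta J K) * (cnj (?d K) * ?d J)) = \<dots>" .
  \<comment> \<open>Both sides are \<open>?S\<close> divided by 4 \<open>kappa \<kappa>0\<close>,
    because g k^2 = k^3 / \<delta> = \<open>kappa \<kappa>0\<close>.\<close>
  have "1 / (16 * pi * \<kappa>0) * (3 / 4 * ?S) = 1 / (4 * coupling \<kappa>0 \<delta>) * (?S / k\<^sup>2)"
  proof -
    have "4 * coupling \<kappa>0 \<delta> * k\<^sup>2 = 4 * k ^ 3 / \<delta>"
      by (simp add: coupling_def k_def[symmetric] power2_eq_square power3_eq_cube)
    also have "\<dots> = 64 * pi / 3 * \<kappa>0" using \<delta>_pos unfolding k_cube by (simp add: kappa_def)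
    finally have "1 / (4 * coupling \<kappa>0 \<delta>) * (?S / k\<^sup>2) = ?S / (64 * pi / 3 * \<kappa>0)"
      by (simp only: times_divide_times_eq mult_1)
    then show ?thesis by simp
  qed
  then show ?thesis
    unfolding kk_lagrangian_def ym_lagrangian_def kk_v_eq M_atlas_def scalar F_contraction[OF p c]
      horizontal_scalar_curvature[OF p]
    by (simp add: distrib_left)
qed

end

section \<open>The limit of strong coupling\<close>

lemma coupling0_eq: "coupling0 \<kappa>0 d = 3 / 2 * coupling \<kappa>0 d"
  by (simp add: coupling0_def coupling_def delta0_def)

text \<open>For positive d the coupling satisfies \<open>coupling \<kappa>0 d\<close>^3 d^2 =
  \<open>kappa \<kappa>0\<close>, so a lower bound on the coupling is an upper bound on the
  length.\<close>

lemma length_le_of_coupling: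
  assumes "0 < \<kappa>0" "0 < d" "0 < g" "g \<le> coupling \<kappa>0 d"
  shows "d\<^sup>2 \<le> kappa \<kappa>0 / g ^ 3"
proof -
  have kd: "0 \<le> kappa \<kappa>0 * d" using assms by (simp add: kappa_def)
  have "g * d \<le> root 3 (kappa \<kappa>0 * d)" using assms by (simp add: coupling_def pos_le_divide_eq)
  then have "(g * d) ^ 3 \<le> root 3 (kappa \<kappa>0 * d) ^ 3" using assms by (intro power_mono) auto
  then have "g ^ 3 * d\<^sup>2 * d \<le> kappa \<kappa>0 * d"
    using real_root_pow_pos2[of 3, OF _ kd] by (simp add: power3_eq_cube power2_eq_square ac_simps)
  then have "g ^ 3 * d\<^sup>2 \<le> kappa \<kappa>0" using assms by simp
  then show ?thesis using assms by (simp add: pos_le_divide_eq mult.commute)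
qed

lemma coupling_at_top_imp_length_tendsto_0:
  assumes \<kappa>0: "0 < \<kappa>0" and pos: "\<forall>\<^sub>F d in F. 0 < d" and top: "filterlim (coupling \<kappa>0) at_top F"
  shows "((\<lambda>d. d) \<longlongrightarrow> 0) F"
proof (rule tendstoI)
  fix e :: real assume e: "0 < e"
  \<comment> \<open>A threshold with \<open>kappa \<kappa>0\<close> / g^3 < e^2; the added 1 makes
    the inequality strict.\<close>
  define g where "g = root 3 (kappa \<kappa>0 / e\<^sup>2) + 1"
  have k: "0 < kappa \<kappa>0 / e\<^sup>2" using \<kappa>0 e by (simp add: kappa_def)
  have g: "0 < g" "kappa \<kappa>0 / e\<^sup>2 < g ^ 3"
  proof -
    have r: "0 < root 3 (kappa \<kappa>0 / e\<^sup>2)" using k by simp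
    then show "0 < g" unfolding g_def by linarith
    have "root 3 (kappa \<kappa>0 / e\<^sup>2) ^ 3 < g ^ 3" using r by (intro power_strict_mono) (auto simp: g_def)
    then show "kappa \<kappa>0 / e\<^sup>2 < g ^ 3" using k by (simp add: real_root_pow_pos)
  qed
  have "\<forall>\<^sub>F d in F. g \<le> coupling \<kappa>0 d" using top by (simp add: filterlim_at_top)
  with pos show "\<forall>\<^sub>F d in F. dist d 0 < e"
  proof eventually_elim
    case (elim d)
    have "d\<^sup>2 \<le> kappa \<kappa>0 / g ^ 3" by (rule length_le_of_coupling[OF \<kappa>0 elim(1) g(1) elim(2)])
    also have "\<dots> < e\<^sup>2" using g e by (simp add: field_simps)
    finally have "d < e" by (rule power2_less_imp_less) (use e in simp)
    then show ?case using elim by simp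
  qed
qed

text \<open>F is any filter containing the positive lengths, so every way of sending g to infinity
  is covered. The couplings differ by the constant factor 3/2 and the lengths by 2/3, so one limit
  decides all.\<close>

lemma coupling_limit:
  assumes \<kappa>0: "0 < \<kappa>0" and pos: "\<forall>\<^sub>F d in F. 0 < d"
  shows "filterlim (coupling \<kappa>0) at_top F \<longleftrightarrow> filterlim (coupling0 \<kappa>0) at_top F"
    and "filterlim (coupling \<kappa>0) at_top F \<Longrightarrow>
      ((\<lambda>d. d / sqrt \<kappa>0) \<longlongrightarrow> 0) F \<and> ((\<lambda>d. delta0 d / sqrt \<kappa>0) \<longlongrightarrow> 0) F"
proof -
  have "coupling0 \<kappa>0 = (\<lambda>d. 3 / 2 * coupling \<kappa>0 d)" by (rule ext) (rule coupling0_eq)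
  then show "filterlim (coupling \<kappa>0) at_top F \<longleftrightarrow> filterlim (coupling0 \<kappa>0) at_top F"
    using filterlim_tendsto_pos_mult_at_top_iff[OF tendsto_const, of "3 / 2" "coupling \<kappa>0" F] by simp
  assume "filterlim (coupling \<kappa>0) at_top F"
  then have "((\<lambda>d. d) \<longlongrightarrow> 0) F" by (rule coupling_at_top_imp_length_tendsto_0[OF \<kappa>0 pos])
  from tendsto_mult_left_zero[OF this, of "1 / sqrt \<kappa>0"] tendsto_mult_left_zero[OF this, of "2 / (3 * sqrt \<kappa>0)"]
  show "((\<lambda>d. d / sqrt \<kappa>0) \<longlongrightarrow> 0) F \<and> ((\<lambda>d. delta0 d / sqrt \<kappa>0) \<longlongrightarrow> 0) F"
    by (simp add: delta0_def mult.commute)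
qed

theorem mainTheorem1:
  fixes \<A> :: "('x::{t2_space,second_countable_topology}, real^4) atlas"
    and \<kappa>0 \<delta> :: real
    and \<beta> :: "4 \<Rightarrow> 'x oneform" and b :: "4 \<Rightarrow> 'x vfield"
    and \<alpha> :: "4 \<Rightarrow> gpoint oneform" and a :: "4 \<Rightarrow> gpoint vfield"
    and \<rho> \<mu> :: "'x mpoint \<Rightarrow> complex"
    and \<rho>t :: "'x \<Rightarrow> complex" and \<mu>t :: complex
  assumes "0 < \<kappa>0" and "0 < \<delta>"
    and "smooth_manifold \<A>"
    and "coframe \<A> \<beta>" and "dual_tetrads \<A> b \<beta>"
    and "group_tetrad \<delta> (delta0 \<delta>) a" and "dual_tetrads G_atlas a \<alpha>"
    and "\<And>x A y. x \<in> points \<A> \<Longrightarrow> det A = 1 \<Longrightarrow>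
      \<rho> (x, A, cis (y / delta0 \<delta>)) = cis (y / delta0 \<delta>) * \<rho>t x"
    and "\<And>x A y. x \<in> points \<A> \<Longrightarrow> det A = 1 \<Longrightarrow>
      \<mu> (x, A, cis (y / delta0 \<delta>)) = cis (y / delta0 \<delta>) * \<mu>t"
    and "smooth_fun \<A> \<rho>t" and "smooth_fun \<A> (\<lambda>x. cmod (\<rho>t x))"
  shows
    "(\<forall>p\<in>points \<A> \<times> G_set. \<forall>c\<in>\<A>. fst p \<in> fst c \<longrightarrow>
        kk_lagrangian \<kappa>0 \<delta> \<A> \<beta> b \<alpha> a \<rho> \<mu> p
          = 1 / (16 * pi * \<kappa>0) * scalar_curvature \<A> \<beta> b (fst p) + ym_lagrangian \<kappa>0 \<delta> \<A> \<beta> \<rho> \<mu> c p) \<and>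
     (\<forall>c. (\<forall>x\<in>points \<A>. c x \<in> \<A> \<and> x \<in> fst (c x)) \<longrightarrow>
        (set_integrable (tetrad_volume \<A> \<beta> \<Otimes>\<^sub>M tetrad_volume G_atlas \<alpha>) (points \<A> \<times> G_set)
            (kk_lagrangian \<kappa>0 \<delta> \<A> \<beta> b \<alpha> a \<rho> \<mu>) \<longleftrightarrow>
         set_integrable (tetrad_volume \<A> \<beta> \<Otimes>\<^sub>M tetrad_volume G_atlas \<alpha>) (points \<A> \<times> G_set)
            (\<lambda>p. 1 / (16 * pi * \<kappa>0) * scalar_curvature \<A> \<beta> b (fst p)
               + ym_lagrangian \<kappa>0 \<delta> \<A> \<beta> \<rho> \<mu> (c (fst p)) p)) \<and>
        (LINT p : points \<A> \<times> G_set | tetrad_volume \<A> \<beta> \<Otimes>\<^sub>M tetrad_volume G_atlas \<alpha>.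
            kk_lagrangian \<kappa>0 \<delta> \<A> \<beta> b \<alpha> a \<rho> \<mu> p)
          = (LINT p : points \<A> \<times> G_set | tetrad_volume \<A> \<beta> \<Otimes>\<^sub>M tetrad_volume G_atlas \<alpha>.
              1 / (16 * pi * \<kappa>0) * scalar_curvature \<A> \<beta> b (fst p)
                + ym_lagrangian \<kappa>0 \<delta> \<A> \<beta> \<rho> \<mu> (c (fst p)) p)) \<and>
     ((\<forall>d. coupling0 \<kappa>0 d = 3 / 2 * coupling \<kappa>0 d) \<and>
      (\<forall>F. (\<forall>\<^sub>F d in F. 0 < d) \<longrightarrow>
        (filterlim (coupling \<kappa>0) at_top F \<longleftrightarrow> filterlim (coupling0 \<kappa>0) at_top F) \<and>
        (filterlim (coupling \<kappa>0) at_top F \<longrightarrow>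
           ((\<lambda>d. d / sqrt \<kappa>0) \<longlongrightarrow> 0) F \<and> ((\<lambda>d. delta0 d / sqrt \<kappa>0) \<longlongrightarrow> 0) F)))"
proof -
  interpret kaluza_klein \<A> \<kappa>0 \<delta> \<beta> b \<alpha> a \<rho> \<mu> \<rho>t \<mu>t
    by (rule kaluza_klein.intro[OF assms(1,2) smooth_atlas_smooth_manifold[OF assms(3)] assms(4-11)])
  let ?M = "tetrad_volume \<A> \<beta> \<Otimes>\<^sub>M tetrad_volume G_atlas \<alpha>" and ?S = "points \<A> \<times> G_set"
  \<comment> \<open>The integrands agree at every point of the product and the indicator removes all
    others. Integrability and integral therefore transfer together, however irregularly the chart
    \<open>c x\<close> depends on x.\<close>
  have integrands: "(\<lambda>p. indicator ?S p *\<^sub>R kk_lagrangian \<kappa>0 \<delta> \<A> \<beta> b \<alpha> a \<rho> \<mu> p) =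
      (\<lambda>p. indicator ?S p *\<^sub>R (1 / (16 * pi * \<kappa>0) * scalar_curvature \<A> \<beta> b (fst p)
         + ym_lagrangian \<kappa>0 \<delta> \<A> \<beta> \<rho> \<mu> (c (fst p)) p))"
    if c: "\<forall>x\<in>points \<A>. c x \<in> \<A> \<and> x \<in> fst (c x)" for c
  proof
    fix p
    show "indicator ?S p *\<^sub>R kk_lagrangian \<kappa>0 \<delta> \<A> \<beta> b \<alpha> a \<rho> \<mu> p =
      indicator ?S p *\<^sub>R (1 / (16 * pi * \<kappa>0) * scalar_curvature \<A> \<beta> b (fst p)
         + ym_lagrangian \<kappa>0 \<delta> \<A> \<beta> \<rho> \<mu> (c (fst p)) p)"
    proof (cases "p \<in> ?S")
      case True
      then have "c (fst p) \<in> \<A>" "fst p \<in> fst (c (fst p))" using c by (auto simp: mem_Times_iff)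
      from kk_lagrangian_eq[OF True this] show ?thesis by simp
    qed simp
  qed
  show ?thesis
    unfolding set_integrable_def set_lebesgue_integral_def
    using kk_lagrangian_eq integrands coupling0_eq coupling_limit[OF assms(1)] by simp
qed

end
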